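(* Let $q\le1$. Uniformizing variables $\gamma$ (one variable for each vertex of $G$) determine a hyperbolic orthogonal ring pattern if and only if they lie in the interval $\gamma\in[0,2K]$ and for all internal vertices satisfy the condition $$\sum_{k=1}^4 \big(g(\gamma+\gamma_k)+g(\gamma-\gamma_k)\big)=2\pi,$$ where $\gamma$ is the variable at the vertex and the sum is taken over all four neighboring rings, with variables $\gamma_k$. For a boundary vertex $v$ the variable $\gamma$ satisfies $$\sum_k \big(g(\gamma-\gamma_k)+g(\gamma+\gamma_k)\big)=\Theta(v)\quad\text{if } r>0,$$ $$\sum_k \big(g(\gamma-\gamma_k)+g(\gamma+\gamma_k)\big)=\Theta(v)+\pi V(v)\quad\text{if } r<0,$$ where the sums are over the neighboring rings of $v$, $\Theta(v)$ is the total nominal angle at the vertex (positive for $r>0$ and negative for $r<0$), and $V(v)$ is the valence of $v$, i.e. the number of neighboring rings orthogonal to the ring centered at $v$.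
   Context: Combinatorics: $\Pi\subset\mathbb{Z}^2$ is a simply connected cell complex defined by a subset of elementary squares of the $\mathbb{Z}^2$ lattice, identified with its vertex set. $G=\{(m,n)\in\Pi: m+n\text{ even}\}$, $G^*=\{(m,n)\in\Pi:m+n\text{ odd}\}$. Vertices $v_{m,n}$ and $v_{m\pm1,n\pm1}$ of $G$ are called neighboring. A vertex of $G$ is internal if it has four neighbors in $G$, and a boundary vertex if it has fewer than four. Rings: a hyperbolic ring is a pair of concentric circles in the hyperbolic plane $H^2$ forming an annulus: the inner circle $c$ with signed hyperbolic radius $r$ (positive for counter-clockwise, negative for clockwise orientation) and the outer circle $C$ with hyperbolic radius $R>0$. A hyperbolic orthogonal ring pattern with combinatorics $\Pi$ consists of rings $(C_{m,n},c_{m,n})$ associated to the vertices of $G$ and points $\ell\in H^2$ associated to the vertices of $G^*$ such that: (1) the rings at neighboring vertices $v_i,v_j$ intersect orthogonally: $C_i$ intersects $c_j$ orthogonally and $C_j$ intersects $c_i$ orthogonally; (2) for any four consecutively neighboring orthogonal rings at $v_{m,n},v_{m+1,n-1},v_{m+2,n},v_{m+1,n+1}$ ($m+n$ even) the inner circles $c_{m,n},c_{m+2,n}$ and the outer circles $C_{m+1,n-1},C_{m+1,n+1}$ pass through one point $\ell_{m+1,n}$ (so the two inner circles touch there, and so do the two outer circles); (3) for any ring the four touching points $\ell_{m+1,n}=c_{m,n}\cap c_{m+2,n}$, $\ell_{m,n+1}=C_{m,n}\cap C_{m,n+2}$, $\ell_{m-1,n}=c_{m,n}\cap c_{m-2,n}$,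 $\ell_{m,n-1}=C_{m,n}\cap C_{m,n-2}$ are in counter-clockwise order if $r_{m,n}>0$ and in clockwise order if $r_{m,n}<0$. Uniformization: all rings of a pattern satisfy $\cosh r=q\cosh R$ with a common constant $q\le1$, and the ring corresponding to $\gamma\in[0,2K]$ is given by $\cosh R=\frac{1}{q\operatorname{sn}(\gamma,q)}$, $\tanh R=\operatorname{dn}(\gamma,q)$, $\sinh r=\frac{\operatorname{cn}(\gamma,q)}{\operatorname{sn}(\gamma,q)}$ (infinite radii are allowed). Here $\operatorname{sn},\operatorname{cn},\operatorname{dn}$ are the Jacobi elliptic functions of modulus $q$, and $K,K'$ are the complete elliptic integrals of the first kind of modulus $q$ and of the complementary modulus. For $q=1$ (circle patterns, $r=R$) one has $\operatorname{sn}=\tanh$, $\operatorname{cn}=\operatorname{dn}=1/\cosh$, $K'=\pi/2$, $K=\infty$. Function $g$: $g:\mathbb{R}\to\mathbb{R}$ is the smooth function $g(x)=\frac{\pi}{2}-\arg\operatorname{sn}\big(\frac{x+iK'}{2},q\big)$ with the continuous branch normalized by $g(0)=0$. Angles: the opening angle at the ring $(r,R)$ of $v$ towards the neighboring ring $(r_k,R_k)$ is $\theta_k=\varphi_k+\psi_k$, $\varphi_k=\arctan\frac{\tanh R_k}{\sinh r}$, $\psi_k=\arctan\frac{\tanh r_k}{\sinh R}$; the cone angle is $\Theta(v)=\sum_k\theta_k$ over all neighboring rings. For an internal vertex of an orthogonal ring pattern $\Theta=2\pi$ if $r>0$ and $\Theta=-2\pi$ if $r<0$. *)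

theory Defs
  imports "HOL-Complex_Analysis.Complex_Analysis"
begin

section \<open>Jacobi elliptic functions\<close>

definition ell_F :: "real \<Rightarrow> real \<Rightarrow> real" where
  "ell_F q x = (LBINT t=0..x. 1 / sqrt (1 - q\<^sup>2 * (sin t)\<^sup>2))"

text \<open>
  The complete integral \<open>K\<close> for a modulus \<open>0 \<le> q < 1\<close>. For \<open>q = 1\<close> the integral diverges, and the
  value of \<open>ell_K 1\<close> is never used.
\<close>

definition ell_K :: "real \<Rightarrow> real" where
  "ell_K q = ell_F q (pi / 2)"

definition ell_K' :: "real \<Rightarrow> real" where
  "ell_K' q = ell_K (sqrt (1 - q\<^sup>2))"

definition jacobi_am :: "real \<Rightarrow> real \<Rightarrow> real" where
  "jacobi_am q u = (THE x. ell_F q x = u)"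

text \<open>
  For \<open>q = 1\<close> the amplitude is only an inverse of \<open>ell_F 1\<close> on \<open>(-\<pi>/2, \<pi>/2)\<close>, so the explicit
  values are given directly.
\<close>

definition jacobi_sn :: "real \<Rightarrow> real \<Rightarrow> real" where
  "jacobi_sn q u = (if q = 1 then tanh u else sin (jacobi_am q u))"

definition jacobi_cn :: "real \<Rightarrow> real \<Rightarrow> real" where
  "jacobi_cn q u = (if q = 1 then 1 / cosh u else cos (jacobi_am q u))"

definition jacobi_dn :: "real \<Rightarrow> real \<Rightarrow> real" where
  "jacobi_dn q u = sqrt (1 - q\<^sup>2 * (jacobi_sn q u)\<^sup>2)"

text \<open>
  The function \<open>sn\<close> of a complex argument is the analytic continuation of the real function. The
  poles closest to the real axis have imaginary part \<open>\<plusminus>K'\<close>, so the continuation is holomorphic in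
  the strip below. It is unique there, and outside of this strip the value is not specified.
\<close>

definition complex_sn :: "real \<Rightarrow> complex \<Rightarrow> complex" where
  "complex_sn q = (SOME f. f holomorphic_on {z. \<bar>Im z\<bar> < ell_K' q} \<and>
     (\<forall>x::real. f (of_real x) = of_real (jacobi_sn q x)))"

text \<open>
  \<open>g(x) = \<pi>/2 - arg sn((x + iK')/2, q)\<close>: the function \<open>\<lambda>x. \<pi>/2 - g x\<close> is a continuous branch of the
  argument.
\<close>

definition ring_g :: "real \<Rightarrow> real \<Rightarrow> real" where
  "ring_g q = (THE g. continuous_on UNIV g \<and> g 0 = 0 \<and>
     (\<forall>x. let w = complex_sn q (Complex (x / 2) (ell_K' q / 2))
          in w = of_real (norm w) * cis (pi / 2 - g x)))"

text \<open>The interval \<open>[0, 2K]\<close>, where \<open>K = \<infinity>\<close> for \<open>q = 1\<close>.\<close>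

definition uniformizing_interval :: "real \<Rightarrow> real set" where
  "uniformizing_interval q = (if q = 1 then {0..} else {0..2 * ell_K q})"


section \<open>Combinatorics\<close>

type_synonym vertex = "int \<times> int"

text \<open>
  A cell complex is given by the set \<open>S\<close> of the lower left corners of its elementary squares.
\<close>

definition corners :: "vertex \<Rightarrow> vertex set" where
  "corners = (\<lambda>(m, n). {m, m + 1} \<times> {n, n + 1})"

definition cells :: "vertex set \<Rightarrow> (real \<times> real) set" where
  "cells S = (\<Union>(m, n)\<in>S. {of_int m .. of_int m + 1} \<times> {of_int n .. of_int n + 1})"

definition vertices_G :: "vertex set \<Rightarrow> vertex set" where
  "vertices_G S = {(m, n) \<in> \<Union> (corners ` S). even (m + n)}"

definition vertices_Gstar :: "vertex set \<Rightarrow> vertex set" where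
  "vertices_Gstar S = {(m, n) \<in> \<Union> (corners ` S). odd (m + n)}"

text \<open>
  Vertices of \<open>G\<close> are neighbours if they are opposite corners of a square of the complex. (Two
  vertices of the complex which are opposite corners of a missing square do not count: the complex
  does not relate them.)
\<close>

definition neighbours :: "vertex set \<Rightarrow> vertex \<Rightarrow> vertex set" where
  "neighbours S v = {w \<in> vertices_G S. \<bar>fst w - fst v\<bar> = 1 \<and> \<bar>snd w - snd v\<bar> = 1 \<and>
     (\<exists>s\<in>S. v \<in> corners s \<and> w \<in> corners s)}"

definition internal_vertex :: "vertex set \<Rightarrow> vertex \<Rightarrow> bool" where
  "internal_vertex S v \<longleftrightarrow> v \<in> vertices_G S \<and> card (neighbours S v) = 4"

definition boundary_vertex :: "vertex set \<Rightarrow> vertex \<Rightarrow> bool" where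
  "boundary_vertex S v \<longleftrightarrow> v \<in> vertices_G S \<and> card (neighbours S v) < 4"

definition hor_edge :: "vertex set \<Rightarrow> vertex \<Rightarrow> vertex \<Rightarrow> bool" where
  "hor_edge S a b \<longleftrightarrow> \<bar>fst a - fst b\<bar> = 1 \<and> snd a = snd b \<and> (\<exists>s\<in>S. a \<in> corners s \<and> b \<in> corners s)"

definition ver_edge :: "vertex set \<Rightarrow> vertex \<Rightarrow> vertex \<Rightarrow> bool" where
  "ver_edge S a b \<longleftrightarrow> fst a = fst b \<and> \<bar>snd a - snd b\<bar> = 1 \<and> (\<exists>s\<in>S. a \<in> corners s \<and> b \<in> corners s)"

text \<open>
  The pairs of consecutive vertices of \<open>G\<^sup>*\<close> around \<open>v\<close>, in the counter-clockwise order east, north,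
  west, south. There is one pair for each square at \<open>v\<close>.
\<close>

definition consecutive :: "vertex set \<Rightarrow> vertex \<Rightarrow> (vertex \<times> vertex) set" where
  "consecutive S = (\<lambda>(m, n).
     {p. p = ((m + 1, n), (m, n + 1)) \<and> (m, n) \<in> S} \<union>
     {p. p = ((m, n + 1), (m - 1, n)) \<and> (m - 1, n) \<in> S} \<union>
     {p. p = ((m - 1, n), (m, n - 1)) \<and> (m - 1, n - 1) \<in> S} \<union>
     {p. p = ((m, n - 1), (m + 1, n)) \<and> (m, n - 1) \<in> S})"

definition edge_connected :: "vertex set \<Rightarrow> bool" where
  "edge_connected S \<longleftrightarrow> (\<forall>s\<in>S. \<forall>t\<in>S.
     (s, t) \<in> {(a, b). a \<in> S \<and> b \<in> S \<and> \<bar>fst a - fst b\<bar> + \<bar>snd a - snd b\<bar> = 1}\<^sup>*)"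


section \<open>The hyperbolic plane\<close>

text \<open>The Poincare disc model, with the unit circle as the ideal boundary.\<close>

definition hyp_plane :: "complex set" where
  "hyp_plane = {z. norm z < 1}"

definition hyp_dist :: "complex \<Rightarrow> complex \<Rightarrow> real" where
  "hyp_dist z w = arcosh (1 + 2 * (norm (z - w))\<^sup>2 / ((1 - (norm z)\<^sup>2) * (1 - (norm w)\<^sup>2)))"

definition hyp_circle :: "complex \<Rightarrow> real \<Rightarrow> complex set" where
  "hyp_circle a \<rho> = {z \<in> hyp_plane. hyp_dist a z = \<rho>}"

text \<open>
  Horocycles, the circles of infinite radius with an ideal point \<open>a\<close> as centre, are the level sets of
  \<open>|z - a|\<^sup>2 / (1 - |z|\<^sup>2)\<close>. This is the limit of \<open>(1 - |b|\<^sup>2) / 2 * cosh (hyp_dist b z)\<close> for \<open>b \<rightarrow> a\<close>,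
  i.e. of the renormalized \<open>cosh\<close> of the distance to the centre.
\<close>

definition horocycle :: "complex \<Rightarrow> real \<Rightarrow> complex set" where
  "horocycle a s = {z \<in> hyp_plane. (norm (z - a))\<^sup>2 / (1 - (norm z)\<^sup>2) = s}"

text \<open>
  The tangent direction at \<open>z\<close> of the geodesic from \<open>z\<close> to \<open>p\<close>, where \<open>p\<close> may be an ideal point: the
  isometry \<open>\<lambda>x. (x - z) / (1 - cnj z * x)\<close> moves \<open>z\<close> to \<open>0\<close> and has a positive derivative at \<open>z\<close>. The
  model is conformal, so angles between directions at \<open>z\<close> are Euclidean angles.
  Note that \<open>hyp_dir z z = 0\<close>.
\<close>

definition hyp_dir :: "complex \<Rightarrow> complex \<Rightarrow> complex" where
  "hyp_dir z p = (p - z) / (1 - cnj z * p)"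

text \<open>
  The hyperbolic triangle \<open>p, z, w\<close> is positively oriented, i.e. seen from \<open>p\<close> the point \<open>w\<close> follows
  \<open>z\<close> in counter-clockwise direction (at an angle less than \<open>\<pi>\<close>). The orientation is tested at \<open>z\<close>
  since \<open>p\<close> may be ideal.
\<close>

definition ccw_from :: "complex \<Rightarrow> complex \<Rightarrow> complex \<Rightarrow> bool" where
  "ccw_from p z w \<longleftrightarrow> Im (cnj (hyp_dir z w) * hyp_dir z p) > 0"

definition hyp_isometry :: "(complex \<Rightarrow> complex) \<Rightarrow> bool" where
  "hyp_isometry f \<longleftrightarrow> (\<exists>a u. norm a < 1 \<and> norm u = 1 \<and> f = (\<lambda>z. u * (z - a) / (1 - cnj a * z)))"


section \<open>Rings\<close>

record ring =
  center :: complex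
  inner :: "complex set"
  outer :: "complex set"
  rad :: ereal
  Rad :: ereal

text \<open>
  Rings with the common constant \<open>q\<close>, i.e. with \<open>cosh r = q * cosh R\<close>. (The inner and the outer
  circle coincide if \<open>q = 1\<close>.) For infinite radii the circles are horocycles, with the ratio of the
  levels in place of the ratio of \<open>cosh r\<close> and \<open>cosh R\<close>; the inner circle still carries an
  orientation, the sign of its radius.
\<close>

definition finite_ring :: "real \<Rightarrow> ring \<Rightarrow> bool" where
  "finite_ring q X \<longleftrightarrow> (\<exists>r R. rad X = ereal r \<and> Rad X = ereal R \<and> R > 0 \<and> \<bar>r\<bar> \<le> R \<and>
     cosh r = q * cosh R \<and> center X \<in> hyp_plane \<and>
     inner X = hyp_circle (center X) \<bar>r\<bar> \<and> outer X = hyp_circle (center X) R)"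

definition infinite_ring :: "real \<Rightarrow> ring \<Rightarrow> bool" where
  "infinite_ring q X \<longleftrightarrow> \<bar>rad X\<bar> = \<infinity> \<and> Rad X = \<infinity> \<and> norm (center X) = 1 \<and>
     (\<exists>s>0. inner X = horocycle (center X) (q * s) \<and> outer X = horocycle (center X) s)"

definition hyperbolic_ring :: "real \<Rightarrow> ring \<Rightarrow> bool" where
  "hyperbolic_ring q X \<longleftrightarrow> finite_ring q X \<or> infinite_ring q X"

text \<open>
  Circles are given as sets together with their centres; they intersect at the angle of their radii.
  If one of them is a single point, orthogonality just means incidence.
\<close>

definition orthogonal_circles :: "complex set \<Rightarrow> complex \<Rightarrow> complex set \<Rightarrow> complex \<Rightarrow> bool" where
  "orthogonal_circles A a B b \<longleftrightarrow>
     A \<inter> B \<noteq> {} \<and> (\<forall>z \<in> A \<inter> B. Re (cnj (hyp_dir z a) * hyp_dir z b) = 0)"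

definition orthogonal_rings :: "ring \<Rightarrow> ring \<Rightarrow> bool" where
  "orthogonal_rings X Y \<longleftrightarrow> orthogonal_circles (outer X) (center X) (inner Y) (center Y) \<and>
     orthogonal_circles (outer Y) (center Y) (inner X) (center X)"

text \<open>Circles with centres \<open>a\<close> and \<open>b\<close> through \<open>z\<close> have a common tangent at \<open>z\<close>.\<close>

definition touch_at :: "complex \<Rightarrow> complex \<Rightarrow> complex \<Rightarrow> bool" where
  "touch_at z a b \<longleftrightarrow> Im (cnj (hyp_dir z a) * hyp_dir z b) = 0"

text \<open>They touch externally at \<open>z\<close> if the radii have opposite directions.\<close>

definition touch_externally_at :: "complex \<Rightarrow> complex \<Rightarrow> complex \<Rightarrow> bool" where
  "touch_externally_at z a b \<longleftrightarrow> touch_at z a b \<and> Re (cnj (hyp_dir z a) * hyp_dir z b) < 0"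


section \<open>Orthogonal ring patterns\<close>

text \<open>
  A pattern consists of rings \<open>X v\<close> for the vertices of \<open>G\<close> and points \<open>l x\<close> for the vertices of
  \<open>G\<^sup>*\<close>. The conditions apply to all rings and points that are present, also at the boundary of the
  complex:

  \<^item> The points \<open>l\<close> are on the inner circles of their horizontal, and on the outer circles of their
    vertical neighbours. If two of the rings face each other at a point, their inner resp. outer
    circles touch there. For \<open>r \<noteq> 0\<close> the touching, and that it is external for the outer circles,
    follows from the other conditions. If \<open>r = 0\<close>, when the inner circle is a point through which
    the outer circles of the neighbours pass, external touching replaces the orientation condition.

  \<^item> Consecutive touching points at a ring with \<open>r > 0\<close> follow each other in counter-clockwise
    direction, and for \<open>r < 0\<close> in clockwise direction. The angle is less than \<open>\<pi>\<close>, so for four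
    points this means that they are passed in this order in a single turn.
\<close>

definition ring_pattern :: "vertex set \<Rightarrow> real \<Rightarrow> (vertex \<Rightarrow> ring) \<Rightarrow> (vertex \<Rightarrow> complex) \<Rightarrow> bool" where
  "ring_pattern S q X l \<longleftrightarrow>
     (\<forall>v \<in> vertices_G S. hyperbolic_ring q (X v)) \<and>
     (\<forall>x \<in> vertices_Gstar S. l x \<in> hyp_plane) \<and>
     (\<forall>v \<in> vertices_G S. \<forall>w \<in> neighbours S v. orthogonal_rings (X v) (X w)) \<and>
     (\<forall>x \<in> vertices_Gstar S.
        (\<forall>v. hor_edge S x v \<longrightarrow> l x \<in> inner (X v)) \<and>
        (\<forall>v. ver_edge S x v \<longrightarrow> l x \<in> outer (X v)) \<and>
        (\<forall>v w. hor_edge S x v \<and> hor_edge S x w \<and> v \<noteq> w \<longrightarrow>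
           touch_at (l x) (center (X v)) (center (X w))) \<and>
        (\<forall>v w. ver_edge S x v \<and> ver_edge S x w \<and> v \<noteq> w \<longrightarrow>
           touch_externally_at (l x) (center (X v)) (center (X w)))) \<and>
     (\<forall>v \<in> vertices_G S. \<forall>(x, y) \<in> consecutive S v.
        (rad (X v) > 0 \<longrightarrow> ccw_from (center (X v)) (l x) (l y)) \<and>
        (rad (X v) < 0 \<longrightarrow> ccw_from (center (X v)) (l y) (l x)))"

definition uniformizes :: "real \<Rightarrow> real \<Rightarrow> ring \<Rightarrow> bool" where
  "uniformizes q \<gamma> X \<longleftrightarrow> \<gamma> \<in> uniformizing_interval q \<and>
     (if jacobi_sn q \<gamma> = 0
      then Rad X = \<infinity> \<and> rad X = (if jacobi_cn q \<gamma> > 0 then \<infinity> else -\<infinity>)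
      else \<exists>r R. rad X = ereal r \<and> Rad X = ereal R \<and>
             cosh R = 1 / (q * jacobi_sn q \<gamma>) \<and> tanh R = jacobi_dn q \<gamma> \<and>
             sinh r = jacobi_cn q \<gamma> / jacobi_sn q \<gamma>)"

definition pattern_with ::
  "vertex set \<Rightarrow> real \<Rightarrow> (vertex \<Rightarrow> real) \<Rightarrow> (vertex \<Rightarrow> ring) \<Rightarrow> (vertex \<Rightarrow> complex) \<Rightarrow> bool" where
  "pattern_with S q \<gamma> X l \<longleftrightarrow> ring_pattern S q X l \<and> (\<forall>v \<in> vertices_G S. uniformizes q (\<gamma> v) (X v))"

definition congruent_patterns ::
  "vertex set \<Rightarrow> (vertex \<Rightarrow> ring) \<Rightarrow> (vertex \<Rightarrow> complex) \<Rightarrow> (vertex \<Rightarrow> ring) \<Rightarrow> (vertex \<Rightarrow> complex) \<Rightarrow> bool" where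
  "congruent_patterns S X l X' l' \<longleftrightarrow> (\<exists>f. hyp_isometry f \<and>
     (\<forall>v \<in> vertices_G S. inner (X' v) = f ` inner (X v) \<and> outer (X' v) = f ` outer (X v)) \<and>
     (\<forall>x \<in> vertices_Gstar S. l' x = f (l x)))"

text \<open>
  The variables \<open>\<gamma>\<close> determine a pattern: there is one, and it is unique up to isometry. A complex in
  which two parts are only joined at a vertex is flexible (the parts can be rotated around the
  vertex), so there is no uniqueness in this case.
\<close>

definition determines_pattern :: "vertex set \<Rightarrow> real \<Rightarrow> (vertex \<Rightarrow> real) \<Rightarrow> bool" where
  "determines_pattern S q \<gamma> \<longleftrightarrow>
     (\<exists>X l. pattern_with S q \<gamma> X l) \<and>
     (edge_connected S \<longrightarrow> (\<forall>X l X' l'. pattern_with S q \<gamma> X l \<and> pattern_with S q \<gamma> X' l' \<longrightarrow>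
        congruent_patterns S X l X' l'))"


section \<open>Angles\<close>

definition tanh_ereal :: "ereal \<Rightarrow> real" where
  "tanh_ereal r = (if r = \<infinity> then 1 else if r = -\<infinity> then -1 else tanh (real_of_ereal r))"

text \<open>\<open>arctan (t / sinh r)\<close>, with the limit \<open>0\<close> for infinite \<open>r\<close>; not meant for \<open>r = 0\<close>.\<close>

definition radius_angle :: "real \<Rightarrow> ereal \<Rightarrow> real" where
  "radius_angle t r = (if \<bar>r\<bar> = \<infinity> then 0 else arctan (t / sinh (real_of_ereal r)))"

definition opening_angle :: "ring \<Rightarrow> ring \<Rightarrow> real" where
  "opening_angle X Y = radius_angle (tanh_ereal (Rad Y)) (rad X) + radius_angle (tanh_ereal (rad Y)) (Rad X)"

definition cone_angle :: "vertex set \<Rightarrow> (vertex \<Rightarrow> ring) \<Rightarrow> vertex \<Rightarrow> real" where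
  "cone_angle S X v = (\<Sum>w \<in> neighbours S v. opening_angle (X v) (X w))"

end

theory Submission
  imports Defs
begin

text \<open>
  Write \<open>theta q a b\<close> for \<open>g(a + b) + g(a - b)\<close>. The theorem rests on two facts: \<open>theta\<close> is the angle
  between consecutive touching points, seen from the centre of a ring, and a pattern is the same as
  a flat transport of frames along the complex.

  \<^bold>\<open>The angle.\<close> The value of \<open>sn\<close> at \<open>(x + iK')/2\<close> has modulus \<open>1 / sqrt q\<close>, and its argument gives
  \<open>g(x) = (am x + arcsin (q sn x)) / 2\<close> (\<open>ring_g_explicit\<close>). The addition theorems then turn
  \<open>theta q \<gamma> \<gamma>'\<close> into a sum of two arcus tangents. These are the two parts of the opening angle of the
  ring \<open>\<gamma>\<close> towards \<open>\<gamma>'\<close>, up to a summand \<open>\<pi>\<close> if \<open>cn \<gamma> < 0\<close>, that is, if \<open>r < 0\<close>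
  (\<open>opening_angle_uniformized\<close>). Summation over the neighbours is the statement on boundary vertices.

  \<^bold>\<open>The geometry.\<close> In the hyperboloid model a ring is one vector \<open>C\<close> with \<open>\<langle>C, C\<rangle> = - q\<^sup>2 sn\<^sup>2 \<gamma>\<close>; the outer
  circle is \<open>\<langle>C, x\<rangle> = - 1\<close>, the inner circle \<open>\<langle>C, x\<rangle> = - q\<close>, and orthogonality of neighbours is
  \<open>\<langle>C, C'\<rangle> = - q\<close>. Infinite radii correspond to light-like \<open>C\<close>. At each touching point there is an
  orthonormal frame which points north. In a square, the frame at one touching point and the two
  variables determine the other touching point and its frame (\<open>square_rigid\<close>); the change of frames
  is an explicit Lorentz matrix \<open>transition\<close>. Moved to the centre of a finite ring, it is the rotation
  by \<open>theta - \<pi>/2\<close>, up to a sign (\<open>transition_rotation\<close>).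

  \<^bold>\<open>Closing.\<close> Around an internal vertex the four transitions of a pattern compose to the identity, so
  the sum of the four angles is a multiple of \<open>2\<pi>\<close>; it is \<open>2\<pi>\<close> since each angle is between \<open>0\<close> and \<open>\<pi>\<close>
  (\<open>internal_vertex_angle_sum\<close>). The ring cannot be infinite, since points on a horocycle do not close
  up. Conversely, if the sum is \<open>2\<pi>\<close>, the transitions around every vertex are compatible. They form a
  local system on the complex, which has a global section because the complex is simply connected
  (\<open>global_section\<close>, \<open>frames_exist\<close>), and the frames give the rings and points
  (\<open>pattern_from_frames\<close>). Two patterns with the same variables are congruent since adjacent squares have
  a touching point in common, so the frame at one point propagates to all (\<open>framed_unique\<close>).
\<close>

text \<open>
  Elimination of a square in normal forms in which products associate to the right and powers are
  written as products.
\<close>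

lemma square_rewrites:
  fixes x y :: "'a::comm_semiring_1"
  assumes "x\<^sup>2 = y"
  shows "x * x = y" "x * (x * z) = y * z"
  using assms by (auto simp: power2_eq_square mult.assoc[symmetric])

section \<open>The amplitude and the real Jacobi functions\<close>

lemma delta_positive:
  fixes q t :: real
  assumes "0 \<le> q" "q < 1"
  shows "0 < 1 - q\<^sup>2 * (sin t)\<^sup>2"
proof -
  have "q\<^sup>2 * (sin t)\<^sup>2 \<le> q\<^sup>2 * 1"
    by (intro mult_left_mono) (auto simp: abs_square_le_1)
  also have "\<dots> < 1" using assms by (simp add: power_less_one_iff)
  finally show ?thesis by simp
qed

lemma DERIV_ell_F:
  assumes "0 \<le> q" "q < 1"
  shows "(ell_F q has_real_derivative 1 / sqrt (1 - q\<^sup>2 * (sin x)\<^sup>2)) (at x)"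
proof -
  define b where "b = \<bar>x\<bar> + 1"
  let ?f = "\<lambda>t::real. 1 / sqrt (1 - q\<^sup>2 * (sin t)\<^sup>2)"
  have "continuous_on {-b..b} ?f"
    using delta_positive[OF assms] by (intro continuous_intros) (simp add: less_imp_neq[symmetric])
  then have "((\<lambda>u. LBINT y=ereal 0..u. ?f y) has_vector_derivative ?f x) (at x within {-b..b})"
    by (intro interval_integral_FTC2) (auto simp: b_def)
  moreover have "x \<in> interior {-b..b}" by (auto simp: b_def)
  ultimately have "((\<lambda>u. LBINT y=ereal 0..u. ?f y) has_vector_derivative ?f x) (at x)"
    by (metis at_within_interior)
  moreover have "ell_F q = (\<lambda>u. LBINT y=ereal 0..u. ?f y)"
    by (simp add: ell_F_def[abs_def] zero_ereal_def)
  ultimately show ?thesis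
    by (simp only: has_real_derivative_iff_has_vector_derivative)
qed

lemma ell_F_0 [simp]: "ell_F q 0 = 0"
  by (simp add: ell_F_def zero_ereal_def[symmetric])

lemma ell_F_expands:
  assumes q: "0 \<le> q" "q < 1" and "x \<le> y"
  shows "y - x \<le> ell_F q y - ell_F q x"
proof -
  have "ell_F q x - x \<le> ell_F q y - y"
  proof (rule DERIV_nonneg_imp_nondecreasing[OF \<open>x \<le> y\<close>])
    fix t
    have "sqrt (1 - q\<^sup>2 * (sin t)\<^sup>2) \<le> 1" by simp
    moreover have "0 < sqrt (1 - q\<^sup>2 * (sin t)\<^sup>2)" using delta_positive[OF q] by simp
    ultimately have "0 \<le> 1 / sqrt (1 - q\<^sup>2 * (sin t)\<^sup>2) - 1" by (simp add: field_simps)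
    then show "\<exists>d. ((\<lambda>t. ell_F q t - t) has_real_derivative d) (at t) \<and> 0 \<le> d"
      by (intro exI conjI) (auto intro!: derivative_intros DERIV_ell_F q)
  qed
  then show ?thesis by simp
qed

lemma continuous_on_ell_F: "0 \<le> q \<Longrightarrow> q < 1 \<Longrightarrow> continuous_on A (ell_F q)"
  by (intro continuous_at_imp_continuous_on ballI DERIV_isCont[OF DERIV_ell_F])

lemma ell_F_bij:
  assumes q: "0 \<le> q" "q < 1"
  shows "\<exists>!x. ell_F q x = u"
proof -
  have "ell_F q (-\<bar>u\<bar>) \<le> u" "u \<le> ell_F q \<bar>u\<bar>"
    using ell_F_expands[OF q, of "-\<bar>u\<bar>" 0] ell_F_expands[OF q, of 0 "\<bar>u\<bar>"] by simp_all
  moreover have "-\<bar>u\<bar> \<le> \<bar>u\<bar>" by simp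
  ultimately obtain x where x: "ell_F q x = u"
    using IVT'[OF _ _ _ continuous_on_ell_F[OF q]] by blast
  show ?thesis
  proof (rule ex1I[where P = "\<lambda>x. ell_F q x = u", OF x])
    fix y assume "ell_F q y = u"
    then show "y = x"
      using x ell_F_expands[OF q, of x y] ell_F_expands[OF q, of y x] by (cases "x \<le> y") auto
  qed
qed

text \<open>At \<open>q = 1\<close> the amplitude is the Gudermannian; with it both cases satisfy the same equations.\<close>

definition amp :: "real \<Rightarrow> real \<Rightarrow> real" where
  "amp q u = (if q = 1 then arctan (sinh u) else jacobi_am q u)"

lemma ell_F_amp: "0 \<le> q \<Longrightarrow> q < 1 \<Longrightarrow> ell_F q (amp q u) = u"
  using theI'[OF ell_F_bij[of q u]] by (simp add: amp_def jacobi_am_def)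

lemma amp_ell_F: "0 \<le> q \<Longrightarrow> q < 1 \<Longrightarrow> amp q (ell_F q x) = x"
  using ell_F_bij[of q "ell_F q x"] ell_F_amp[of q "ell_F q x"] by auto

lemma jacobi_sn_amp: "jacobi_sn q u = sin (amp q u)"
proof -
  have "sqrt (1 + (sinh u)\<^sup>2) = cosh u"
    using cosh_square_eq[of u] by (simp add: add.commute real_sqrt_unique)
  then show ?thesis
    by (simp add: jacobi_sn_def amp_def sin_arctan tanh_def)
qed

lemma jacobi_cn_amp: "jacobi_cn q u = cos (amp q u)"
proof -
  have "sqrt (1 + (sinh u)\<^sup>2) = cosh u"
    using cosh_square_eq[of u] by (simp add: add.commute real_sqrt_unique)
  then show ?thesis
    by (simp add: jacobi_cn_def amp_def cos_arctan)
qed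

lemma sn_cn_square: "(jacobi_sn q u)\<^sup>2 + (jacobi_cn q u)\<^sup>2 = 1"
  by (simp add: jacobi_sn_amp jacobi_cn_amp)

lemma modular_positive:
  assumes "0 \<le> q" "q \<le> 1"
  shows "0 < 1 - q\<^sup>2 * (jacobi_sn q u)\<^sup>2"
proof (cases "q = 1")
  case True
  have "(tanh u)\<^sup>2 < 1"
    using tanh_real_bounds[of u] by (simp add: abs_square_less_1 abs_less_iff)
  then show ?thesis using True by (simp add: jacobi_sn_def)
next
  case False
  then show ?thesis using delta_positive[of q] assms by (simp add: jacobi_sn_amp)
qed

lemma dn_positive: "0 \<le> q \<Longrightarrow> q \<le> 1 \<Longrightarrow> 0 < jacobi_dn q u"
  using modular_positive by (simp add: jacobi_dn_def)

lemma dn_square: "0 \<le> q \<Longrightarrow> q \<le> 1 \<Longrightarrow> (jacobi_dn q u)\<^sup>2 = 1 - q\<^sup>2 * (jacobi_sn q u)\<^sup>2"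
  using modular_positive[of q u] by (simp add: jacobi_dn_def)

lemma DERIV_amp:
  assumes "0 \<le> q" "q \<le> 1"
  shows "(amp q has_real_derivative jacobi_dn q u) (at u)"
proof (cases "q = 1")
  case True
  have "((\<lambda>u. arctan (sinh u)) has_real_derivative inverse (1 + (sinh u)\<^sup>2) * cosh u) (at u)"
    by (auto intro!: derivative_eq_intros)
  moreover have "inverse (1 + (sinh u)\<^sup>2) * cosh u = jacobi_dn q u"
  proof -
    have "(jacobi_dn q u)\<^sup>2 = (jacobi_cn q u)\<^sup>2"
      using True dn_square[of q u] sn_cn_square[of q u] by simp
    then have "jacobi_dn q u = jacobi_cn q u"
      using True dn_positive[of q u] cosh_real_pos[of u]
      by (auto simp: power2_eq_iff jacobi_cn_def simp del: cosh_real_pos)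
    moreover have "1 + (sinh u)\<^sup>2 = (cosh u)\<^sup>2" using cosh_square_eq[of u] by simp
    ultimately show ?thesis
      using True cosh_real_pos[of u] by (simp add: jacobi_cn_def power2_eq_square divide_simps del: cosh_real_pos)
  qed
  ultimately show ?thesis using True by (simp add: amp_def[abs_def])
next
  case False
  then have q: "0 \<le> q" "q < 1" using assms by auto
  have cont: "isCont (amp q) u"
    unfolding isCont_def
  proof (rule LIM_I)
    fix e :: real assume "0 < e"
    moreover have "\<bar>amp q z - amp q u\<bar> \<le> \<bar>z - u\<bar>" for z
      using ell_F_expands[OF q, of "amp q z" "amp q u"] ell_F_expands[OF q, of "amp q u" "amp q z"]
      by (simp add: ell_F_amp[OF q]) linarith
    ultimately show "\<exists>s>0. \<forall>z. z \<noteq> u \<and> norm (z - u) < s \<longrightarrow> norm (amp q z - amp q u) < e"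
      by (metis order_le_less_trans real_norm_def)
  qed
  have "(amp q has_real_derivative inverse (1 / sqrt (1 - q\<^sup>2 * (sin (amp q u))\<^sup>2))) (at u)"
    by (rule DERIV_inverse_function[where f = "ell_F q" and a = "u - 1" and b = "u + 1"])
      (use delta_positive[OF q, of "amp q u"] DERIV_ell_F[OF q] ell_F_amp[OF q] cont in auto)
  then show ?thesis by (simp add: jacobi_dn_def jacobi_sn_amp)
qed

lemma DERIV_sn:
  "0 \<le> q \<Longrightarrow> q \<le> 1 \<Longrightarrow> (jacobi_sn q has_real_derivative jacobi_cn q u * jacobi_dn q u) (at u)"
  unfolding jacobi_sn_amp[abs_def] jacobi_cn_amp
  by (auto intro!: derivative_eq_intros DERIV_amp)

lemma DERIV_cn:
  "0 \<le> q \<Longrightarrow> q \<le> 1 \<Longrightarrow> (jacobi_cn q has_real_derivative - jacobi_sn q u * jacobi_dn q u) (at u)"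
  unfolding jacobi_cn_amp[abs_def] jacobi_sn_amp
  by (auto intro!: derivative_eq_intros DERIV_amp)

lemma DERIV_dn:
  assumes "0 \<le> q" "q \<le> 1"
  shows "(jacobi_dn q has_real_derivative - q\<^sup>2 * jacobi_sn q u * jacobi_cn q u) (at u)"
proof -
  have "((\<lambda>u. sqrt (1 - q\<^sup>2 * (jacobi_sn q u)\<^sup>2)) has_real_derivative
      - (q\<^sup>2 * (2 * jacobi_sn q u * (jacobi_cn q u * jacobi_dn q u))) *
        (inverse (sqrt (1 - q\<^sup>2 * (jacobi_sn q u)\<^sup>2)) / 2)) (at u)"
    using modular_positive[OF assms, of u]
    by (auto intro!: derivative_eq_intros DERIV_sn assms)
  moreover have "- (q\<^sup>2 * (2 * jacobi_sn q u * (jacobi_cn q u * jacobi_dn q u))) *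
        (inverse (jacobi_dn q u) / 2) = - q\<^sup>2 * jacobi_sn q u * jacobi_cn q u"
    using dn_positive[OF assms, of u] by (simp add: field_simps)
  ultimately show ?thesis
    unfolding jacobi_dn_def[abs_def] by (metis (no_types, lifting) DERIV_cong)
qed

lemma amp_0 [simp]: "0 \<le> q \<Longrightarrow> q \<le> 1 \<Longrightarrow> amp q 0 = 0"
  using amp_ell_F[of q 0] by (cases "q = 1") (auto simp: amp_def)

lemma jacobi_at_0 [simp]:
  assumes "0 \<le> q" "q \<le> 1"
  shows "jacobi_sn q 0 = 0" "jacobi_cn q 0 = 1" "jacobi_dn q 0 = 1"
  using assms by (auto simp: jacobi_sn_amp jacobi_cn_amp jacobi_dn_def)

lemma amp_strict_mono:
  assumes "0 \<le> q" "q \<le> 1" "x < y"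
  shows "amp q x < amp q y"
  using assms DERIV_amp dn_positive by (intro DERIV_pos_imp_increasing[OF \<open>x < y\<close>]) blast

lemma amp_minus:
  assumes "0 \<le> q" "q \<le> 1"
  shows "amp q (- u) = - amp q u"
proof (cases "q = 1")
  case True
  then show ?thesis by (simp add: amp_def arctan_minus)
next
  case False
  then have q: "0 \<le> q" "q < 1" using assms by auto
  have const: "\<forall>x. ((\<lambda>x. ell_F q (- x) + ell_F q x) has_real_derivative 0) (at x)"
  proof
    fix x
    have "((\<lambda>x. ell_F q (- x)) has_real_derivative 1 / sqrt (1 - q\<^sup>2 * (sin (- x))\<^sup>2) * (- 1)) (at x)"
      by (rule DERIV_chain2[OF DERIV_ell_F[OF q]]) (auto intro!: derivative_eq_intros)
    then show "((\<lambda>x. ell_F q (- x) + ell_F q x) has_real_derivative 0) (at x)"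
      by (auto intro!: derivative_eq_intros DERIV_ell_F q)
  qed
  have "ell_F q (- amp q u) = - u"
    using DERIV_isconst_all[OF const, of "amp q u" 0] ell_F_amp[OF q, of u] by simp
  then show ?thesis using amp_ell_F[OF q, of "- amp q u"] by simp
qed

lemma jacobi_minus:
  assumes "0 \<le> q" "q \<le> 1"
  shows "jacobi_sn q (- u) = - jacobi_sn q u" "jacobi_cn q (- u) = jacobi_cn q u"
    "jacobi_dn q (- u) = jacobi_dn q u"
  using assms by (auto simp: jacobi_sn_amp jacobi_cn_amp jacobi_dn_def amp_minus)

lemma amp_K: "0 \<le> q \<Longrightarrow> q < 1 \<Longrightarrow> amp q (ell_K q) = pi / 2"
  by (simp add: ell_K_def amp_ell_F)

lemma amp_2K:
  assumes q: "0 \<le> q" "q < 1"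
  shows "amp q (2 * ell_K q) = pi"
proof -
  have const: "\<forall>x. ((\<lambda>x. ell_F q (pi - x) + ell_F q x) has_real_derivative 0) (at x)"
  proof
    fix x
    have "((\<lambda>x. ell_F q (pi - x)) has_real_derivative 1 / sqrt (1 - q\<^sup>2 * (sin (pi - x))\<^sup>2) * (- 1)) (at x)"
      by (rule DERIV_chain2[OF DERIV_ell_F[OF q]]) (auto intro!: derivative_eq_intros)
    then show "((\<lambda>x. ell_F q (pi - x) + ell_F q x) has_real_derivative 0) (at x)"
      by (auto intro!: derivative_eq_intros DERIV_ell_F q)
  qed
  have "ell_F q pi = 2 * ell_K q"
    using DERIV_isconst_all[OF const, of 0 "pi / 2"] by (simp add: ell_K_def)
  then show ?thesis using amp_ell_F[OF q, of pi] by simp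
qed

lemma uniformizing_interval_amp:
  assumes "0 \<le> q" "q \<le> 1" "\<gamma> \<in> uniformizing_interval q"
  shows "0 \<le> \<gamma>" "0 \<le> amp q \<gamma>" "amp q \<gamma> \<le> pi"
proof -
  show 0: "0 \<le> \<gamma>" using assms by (auto simp: uniformizing_interval_def split: if_splits)
  then show "0 \<le> amp q \<gamma>" using amp_strict_mono[of q 0 \<gamma>] assms by fastforce
  show "amp q \<gamma> \<le> pi"
  proof (cases "q = 1")
    case True
    then show ?thesis using arctan_ubound[of "sinh \<gamma>"] pi_gt_zero
      by (simp add: amp_def del: pi_gt_zero)
  next
    case False
    then show ?thesis
      using assms amp_2K[of q] amp_strict_mono[of q \<gamma> "2 * ell_K q"]
      by (cases "\<gamma> = 2 * ell_K q") (auto simp: uniformizing_interval_def)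
  qed
qed

lemma sn_nonneg:
  "0 \<le> q \<Longrightarrow> q \<le> 1 \<Longrightarrow> \<gamma> \<in> uniformizing_interval q \<Longrightarrow> 0 \<le> jacobi_sn q \<gamma>"
  using uniformizing_interval_amp by (simp add: jacobi_sn_amp sin_ge_zero)

section \<open>Addition theorems\<close>

lemma addition_denominator:
  assumes "0 \<le> q" "q \<le> 1"
  shows "0 < 1 - q\<^sup>2 * (jacobi_sn q a)\<^sup>2 * (jacobi_sn q b)\<^sup>2"
proof -
  have "(jacobi_sn q b)\<^sup>2 \<le> 1" using sn_cn_square[of q b] by (smt (verit) zero_le_power2)
  then have "q\<^sup>2 * (jacobi_sn q a)\<^sup>2 * (jacobi_sn q b)\<^sup>2 \<le> q\<^sup>2 * (jacobi_sn q a)\<^sup>2 * 1"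
    by (intro mult_left_mono) auto
  then show ?thesis using modular_positive[OF assms, of a] by simp
qed

text \<open>
  Both addition theorems hold since the right hand side, as a function of \<open>a\<close> with \<open>a + b\<close> fixed,
  has derivative \<open>0\<close>, and takes the value of the left hand side at \<open>b = 0\<close>.
\<close>

lemma cn_add:
  assumes q: "0 \<le> q" "q \<le> 1"
  shows "jacobi_cn q (a + b) =
    (jacobi_cn q a * jacobi_cn q b - jacobi_sn q a * jacobi_sn q b * jacobi_dn q a * jacobi_dn q b) /
    (1 - q\<^sup>2 * (jacobi_sn q a)\<^sup>2 * (jacobi_sn q b)\<^sup>2)"
proof -
  define k where "k = a + b"
  let ?s = "jacobi_sn q" and ?c = "jacobi_cn q" and ?d = "jacobi_dn q"
  let ?N = "\<lambda>t. ?c t * ?c (k - t) - ?s t * ?s (k - t) * ?d t * ?d (k - t)"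
  let ?D = "\<lambda>t. 1 - q\<^sup>2 * (?s t)\<^sup>2 * (?s (k - t))\<^sup>2"
  have const: "\<forall>t. ((\<lambda>t. ?N t / ?D t) has_real_derivative 0) (at t)"
  proof
    fix t
    define s c d s' c' d' where defs: "s = ?s t" "c = ?c t" "d = ?d t"
      "s' = ?s (k - t)" "c' = ?c (k - t)" "d' = ?d (k - t)"
    have rel: "c\<^sup>2 = 1 - s\<^sup>2" "d\<^sup>2 = 1 - q\<^sup>2 * s\<^sup>2" "c'\<^sup>2 = 1 - s'\<^sup>2" "d'\<^sup>2 = 1 - q\<^sup>2 * s'\<^sup>2"
      using sn_cn_square[of q t] sn_cn_square[of q "k - t"] dn_square[OF q]
      by (auto simp: defs algebra_simps)
    have r: "((\<lambda>t. k - t) has_real_derivative -1) (at t)"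
      by (auto intro!: derivative_eq_intros)
    have chain: "((\<lambda>t. ?s (k - t)) has_real_derivative - (c' * d')) (at t)"
      "((\<lambda>t. ?c (k - t)) has_real_derivative s' * d') (at t)"
      "((\<lambda>t. ?d (k - t)) has_real_derivative q\<^sup>2 * s' * c') (at t)"
      using DERIV_chain2[OF DERIV_sn[OF q] r] DERIV_chain2[OF DERIV_cn[OF q] r]
        DERIV_chain2[OF DERIV_dn[OF q] r]
      by (auto simp: defs)
    have N: "(?N has_real_derivative - s * d * c' + s' * d' * c -
        (c * d * s' * d * d' - c' * d' * s * d * d' - q\<^sup>2 * s * c * s * s' * d' + q\<^sup>2 * s' * c' * s * s' * d)) (at t)"
      by (auto simp: defs algebra_simps intro!: derivative_eq_intros DERIV_sn DERIV_cn DERIV_dn q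
          chain[unfolded defs])
    have D: "(?D has_real_derivative - (q\<^sup>2 * (2 * s * c * d * s'\<^sup>2 - 2 * s' * c' * d' * s\<^sup>2))) (at t)"
      by (auto simp: defs algebra_simps power2_eq_square intro!: derivative_eq_intros DERIV_sn q
          chain[unfolded defs])
    have "(- s * d * c' + s' * d' * c -
        (c * d * s' * d * d' - c' * d' * s * d * d' - q\<^sup>2 * s * c * s * s' * d' + q\<^sup>2 * s' * c' * s * s' * d)) *
        (1 - q\<^sup>2 * s\<^sup>2 * s'\<^sup>2) =
        (c * c' - s * s' * d * d') * (- (q\<^sup>2 * (2 * s * c * d * s'\<^sup>2 - 2 * s' * c' * d' * s\<^sup>2)))"
      by (simp add: rel[THEN square_rewrites(1)] rel[THEN square_rewrites(2)]
          power2_eq_square algebra_simps)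
    then show "((\<lambda>t. ?N t / ?D t) has_real_derivative 0) (at t)"
      using addition_denominator[OF q, of t "k - t"]
      by (intro DERIV_cong[OF DERIV_divide[OF N D]]) (auto simp: defs)
  qed
  show ?thesis using DERIV_isconst_all[OF const, of a k] q by (simp add: k_def)
qed

lemma dn_add:
  assumes q: "0 \<le> q" "q \<le> 1"
  shows "jacobi_dn q (a + b) =
    (jacobi_dn q a * jacobi_dn q b - q\<^sup>2 * jacobi_sn q a * jacobi_sn q b * jacobi_cn q a * jacobi_cn q b) /
    (1 - q\<^sup>2 * (jacobi_sn q a)\<^sup>2 * (jacobi_sn q b)\<^sup>2)"
proof -
  define k where "k = a + b"
  let ?s = "jacobi_sn q" and ?c = "jacobi_cn q" and ?d = "jacobi_dn q"
  let ?N = "\<lambda>t. ?d t * ?d (k - t) - q\<^sup>2 * ?s t * ?s (k - t) * ?c t * ?c (k - t)"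
  let ?D = "\<lambda>t. 1 - q\<^sup>2 * (?s t)\<^sup>2 * (?s (k - t))\<^sup>2"
  have const: "\<forall>t. ((\<lambda>t. ?N t / ?D t) has_real_derivative 0) (at t)"
  proof
    fix t
    define s c d s' c' d' where defs: "s = ?s t" "c = ?c t" "d = ?d t"
      "s' = ?s (k - t)" "c' = ?c (k - t)" "d' = ?d (k - t)"
    have rel: "c\<^sup>2 = 1 - s\<^sup>2" "d\<^sup>2 = 1 - q\<^sup>2 * s\<^sup>2" "c'\<^sup>2 = 1 - s'\<^sup>2" "d'\<^sup>2 = 1 - q\<^sup>2 * s'\<^sup>2"
      using sn_cn_square[of q t] sn_cn_square[of q "k - t"] dn_square[OF q]
      by (auto simp: defs algebra_simps)
    have r: "((\<lambda>t. k - t) has_real_derivative -1) (at t)"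
      by (auto intro!: derivative_eq_intros)
    have chain: "((\<lambda>t. ?s (k - t)) has_real_derivative - (c' * d')) (at t)"
      "((\<lambda>t. ?c (k - t)) has_real_derivative s' * d') (at t)"
      "((\<lambda>t. ?d (k - t)) has_real_derivative q\<^sup>2 * s' * c') (at t)"
      using DERIV_chain2[OF DERIV_sn[OF q] r] DERIV_chain2[OF DERIV_cn[OF q] r]
        DERIV_chain2[OF DERIV_dn[OF q] r]
      by (auto simp: defs)
    have N: "(?N has_real_derivative - q\<^sup>2 * s * c * d' + q\<^sup>2 * s' * c' * d -
        q\<^sup>2 * (c * d * s' * c * c' - c' * d' * s * c * c' - s * d * s * s' * c' + s' * d' * s * s' * c)) (at t)"
      by (auto simp: defs algebra_simps intro!: derivative_eq_intros DERIV_sn DERIV_cn DERIV_dn q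
          chain[unfolded defs])
    have D: "(?D has_real_derivative - (q\<^sup>2 * (2 * s * c * d * s'\<^sup>2 - 2 * s' * c' * d' * s\<^sup>2))) (at t)"
      by (auto simp: defs algebra_simps power2_eq_square intro!: derivative_eq_intros DERIV_sn q
          chain[unfolded defs])
    have "(- q\<^sup>2 * s * c * d' + q\<^sup>2 * s' * c' * d -
        q\<^sup>2 * (c * d * s' * c * c' - c' * d' * s * c * c' - s * d * s * s' * c' + s' * d' * s * s' * c)) *
        (1 - q\<^sup>2 * s\<^sup>2 * s'\<^sup>2) =
        (d * d' - q\<^sup>2 * s * s' * c * c') * (- (q\<^sup>2 * (2 * s * c * d * s'\<^sup>2 - 2 * s' * c' * d' * s\<^sup>2)))"
      by (simp add: rel[THEN square_rewrites(1)] rel[THEN square_rewrites(2)]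
          power2_eq_square algebra_simps)
    then show "((\<lambda>t. ?N t / ?D t) has_real_derivative 0) (at t)"
      using addition_denominator[OF q, of t "k - t"]
      by (intro DERIV_cong[OF DERIV_divide[OF N D]]) (auto simp: defs)
  qed
  show ?thesis using DERIV_isconst_all[OF const, of a k] q by (simp add: k_def)
qed

section \<open>The angle sum in terms of Jacobi functions\<close>

text \<open>
  An explicit form of the function \<open>g\<close>. The sum \<open>g (a + b) + g (a - b)\<close> splits into a part from the
  amplitudes and a part from the arcsines, which are the two angles that make up the
  opening angle of a ring.
\<close>

definition g_fun :: "real \<Rightarrow> real \<Rightarrow> real" where
  "g_fun q x = (amp q x + arcsin (q * jacobi_sn q x)) / 2"

definition theta :: "real \<Rightarrow> real \<Rightarrow> real \<Rightarrow> real" where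
  "theta q a b = g_fun q (a + b) + g_fun q (a - b)"

definition amp_mean :: "real \<Rightarrow> real \<Rightarrow> real \<Rightarrow> real" where
  "amp_mean q a b = (amp q (a + b) + amp q (a - b)) / 2"

definition add_denom :: "real \<Rightarrow> real \<Rightarrow> real \<Rightarrow> real" where
  "add_denom q a b = 1 - q\<^sup>2 * (jacobi_sn q a)\<^sup>2 * (jacobi_sn q b)\<^sup>2"

lemma add_denom_pos: "0 \<le> q \<Longrightarrow> q \<le> 1 \<Longrightarrow> 0 < add_denom q a b"
  using addition_denominator by (simp add: add_denom_def)

lemma add_denom_commute: "add_denom q a b = add_denom q b a"
  by (simp add: add_denom_def)

lemma cn_add_plus_cn_diff:
  assumes q: "0 \<le> q" "q \<le> 1"
  shows "jacobi_cn q (a + b) + jacobi_cn q (a - b) = 2 * jacobi_cn q a * jacobi_cn q b / add_denom q a b"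
  using cn_add[OF q, of a b] cn_add[OF q, of a "- b"]
  by (simp add: jacobi_minus[OF q] add_denom_def add_divide_distrib[symmetric])

lemma dn_add_plus_dn_diff:
  assumes q: "0 \<le> q" "q \<le> 1"
  shows "jacobi_dn q (a + b) + jacobi_dn q (a - b) = 2 * jacobi_dn q a * jacobi_dn q b / add_denom q a b"
  using dn_add[OF q, of a b] dn_add[OF q, of a "- b"]
  by (simp add: jacobi_minus[OF q] add_denom_def add_divide_distrib[symmetric])

lemma jacobi_relations:
  assumes "0 \<le> q" "q \<le> 1"
  shows "(jacobi_cn q u)\<^sup>2 = 1 - (jacobi_sn q u)\<^sup>2" "(jacobi_dn q u)\<^sup>2 = 1 - q\<^sup>2 * (jacobi_sn q u)\<^sup>2"
  using sn_cn_square[of q u] dn_square[OF assms, of u] by auto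

lemma DERIV_amp_mean:
  assumes q: "0 \<le> q" "q \<le> 1"
  shows "((\<lambda>a. amp_mean q a b) has_real_derivative jacobi_dn q a * jacobi_dn q b / add_denom q a b) (at a)"
proof -
  have r: "((\<lambda>a. a + b) has_real_derivative 1) (at a)" "((\<lambda>a. a - b) has_real_derivative 1) (at a)"
    by (auto intro!: derivative_eq_intros)
  have "((\<lambda>a. (amp q (a + b) + amp q (a - b)) / 2) has_real_derivative
      (jacobi_dn q (a + b) * 1 + jacobi_dn q (a - b) * 1) / 2) (at a)"
    using DERIV_chain2[OF DERIV_amp[OF q] r(1)] DERIV_chain2[OF DERIV_amp[OF q] r(2)]
    by (intro DERIV_cdivide DERIV_add)
  then show ?thesis
    using dn_add_plus_dn_diff[OF q, of a b] by (simp add: amp_mean_def[abs_def])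
qed

lemma amp_mean_0: "0 \<le> q \<Longrightarrow> q \<le> 1 \<Longrightarrow> amp_mean q 0 b = 0"
  by (simp add: amp_mean_def amp_minus)

text \<open>
  A curve on the unit circle, differentiable and with a known angular velocity, is determined by its
  starting point.
\<close>

lemma unit_circle_lift:
  fixes u v h H :: "real \<Rightarrow> real"
  assumes u: "\<And>t. (u has_real_derivative - v t * h t) (at t)"
    and v: "\<And>t. (v has_real_derivative u t * h t) (at t)"
    and H: "\<And>t. (H has_real_derivative h t) (at t)"
    and init: "u 0 = cos (H 0)" "v 0 = sin (H 0)"
  shows "u t = cos (H t)" "v t = sin (H t)"
proof -
  let ?E = "\<lambda>t. (u t - cos (H t))\<^sup>2 + (v t - sin (H t))\<^sup>2"
  have const: "\<forall>t. (?E has_real_derivative 0) (at t)"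
  proof
    fix t
    have "(?E has_real_derivative
        2 * (u t - cos (H t)) * (- v t * h t - (- sin (H t) * h t)) +
        2 * (v t - sin (H t)) * (u t * h t - cos (H t) * h t)) (at t)"
      by (auto simp: algebra_simps intro!: derivative_eq_intros u v H)
    then show "(?E has_real_derivative 0) (at t)"
      by (rule DERIV_cong) (simp add: algebra_simps)
  qed
  have "?E t = 0"
    using DERIV_isconst_all[OF const, of t 0] init by simp
  then show "u t = cos (H t)" "v t = sin (H t)"
    by (simp_all add: sum_power2_eq_zero_iff)
qed

text \<open>
  The point \<open>cn a + i dn b sn a\<close> has modulus \<open>sqrt (add_denom q a b)\<close>, and as a function of \<open>a\<close> its
  argument has the derivative of \<open>amp_mean\<close>.
\<close>

lemma cos_sin_amp_mean:
  assumes q: "0 \<le> q" "q \<le> 1"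
  shows "jacobi_cn q a / sqrt (add_denom q a b) = cos (amp_mean q a b)" (is "?u a = _")
    and "jacobi_dn q b * jacobi_sn q a / sqrt (add_denom q a b) = sin (amp_mean q a b)" (is "?v a = _")
proof -
  define s' c' d' where defs': "s' = jacobi_sn q b" "c' = jacobi_cn q b" "d' = jacobi_dn q b"
  let ?D = "\<lambda>a. add_denom q a b"
  have deriv: "(?u has_real_derivative - ?v t * (jacobi_dn q t * d' / ?D t)) (at t) \<and>
    (?v has_real_derivative ?u t * (jacobi_dn q t * d' / ?D t)) (at t)" for t
  proof -
    define s c d r where defs: "s = jacobi_sn q t" "c = jacobi_cn q t" "d = jacobi_dn q t" "r = sqrt (?D t)"
    note D = add_denom_pos[OF q, of t b]
    have r: "r > 0" "r\<^sup>2 = 1 - q\<^sup>2 * s\<^sup>2 * s'\<^sup>2" "?D t = r\<^sup>2"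
      using D by (auto simp: defs add_denom_def defs')
    note rel = jacobi_relations[OF q, of t, folded defs] jacobi_relations[OF q, of b, folded defs']
    have "(?D has_real_derivative - (q\<^sup>2 * (2 * s * (c * d)) * s'\<^sup>2)) (at t)"
      unfolding add_denom_def[abs_def] by (auto simp: defs defs' intro!: derivative_eq_intros DERIV_sn q)
    then have R: "((\<lambda>a. sqrt (?D a)) has_real_derivative (inverse r / 2 * - (q\<^sup>2 * (2 * s * (c * d)) * s'\<^sup>2))) (at t)"
      unfolding defs(4) by (intro DERIV_chain2[where f = sqrt] DERIV_real_sqrt D)
    have u: "(?u has_real_derivative
        (- s * d * r - c * (inverse r / 2 * - (q\<^sup>2 * (2 * s * (c * d)) * s'\<^sup>2))) / (r * r)) (at t)"
      using DERIV_divide[OF DERIV_cn[OF q, of t] R] r(1) by (simp add: defs)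
    have v: "(?v has_real_derivative
        (d' * (c * d) * r - d' * s * (inverse r / 2 * - (q\<^sup>2 * (2 * s * (c * d)) * s'\<^sup>2))) / (r * r)) (at t)"
      using DERIV_divide[OF DERIV_cmult[OF DERIV_sn[OF q, of t], of d'] R] r(1)
      by (simp add: defs defs')
    have "(- s * d * r - c * (inverse r / 2 * - (q\<^sup>2 * (2 * s * (c * d)) * s'\<^sup>2))) / (r * r) =
        (- s * d * r\<^sup>2 + c * (q\<^sup>2 * s * (c * d) * s'\<^sup>2)) / r ^ 3"
      using r(1) by (simp add: field_simps power2_eq_square power3_eq_cube)
    also have "- s * d * r\<^sup>2 + c * (q\<^sup>2 * s * (c * d) * s'\<^sup>2) = - (d' * s * d * d')"
      unfolding r(2)
      by (simp add: rel[THEN square_rewrites(1)] rel[THEN square_rewrites(2)] power2_eq_square algebra_simps)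
    also have "\<dots> / r ^ 3 = - (d' * s / r) * (d * d' / r\<^sup>2)"
      using r(1) by (simp add: field_simps power2_eq_square power3_eq_cube)
    finally have u': "(- s * d * r - c * (inverse r / 2 * - (q\<^sup>2 * (2 * s * (c * d)) * s'\<^sup>2))) / (r * r) =
      - (d' * s / r) * (d * d' / r\<^sup>2)" .
    have "(d' * (c * d) * r - d' * s * (inverse r / 2 * - (q\<^sup>2 * (2 * s * (c * d)) * s'\<^sup>2))) / (r * r) =
        (d' * c * d * (r\<^sup>2 + q\<^sup>2 * s\<^sup>2 * s'\<^sup>2)) / r ^ 3"
      using r(1) by (simp add: field_simps power2_eq_square power3_eq_cube)
    also have "\<dots> = (c / r) * (d * d' / r\<^sup>2)"
    proof -
      have "r\<^sup>2 + q\<^sup>2 * s\<^sup>2 * s'\<^sup>2 = 1" using r(2) by simp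
      then show ?thesis using r(1) by (simp add: power2_eq_square power3_eq_cube ac_simps)
    qed
    finally have v': "(d' * (c * d) * r - d' * s * (inverse r / 2 * - (q\<^sup>2 * (2 * s * (c * d)) * s'\<^sup>2))) / (r * r) =
      (c / r) * (d * d' / r\<^sup>2)" .
    have "(sqrt (?D t))\<^sup>2 = ?D t" using D by simp
    then show ?thesis
      using DERIV_cong[OF u u'] DERIV_cong[OF v v'] by (simp only: defs defs')
  qed
  have init: "?u 0 = cos (amp_mean q 0 b)" "?v 0 = sin (amp_mean q 0 b)"
    using q by (auto simp: amp_mean_0 add_denom_def)
  show "?u a = cos (amp_mean q a b)" "?v a = sin (amp_mean q a b)"
    using unit_circle_lift[of ?u ?v "\<lambda>t. jacobi_dn q t * d' / ?D t" "\<lambda>a. amp_mean q a b" a]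
      deriv init DERIV_amp_mean[OF q, of b, folded defs'] by blast+
qed

text \<open>
  The derivative of \<open>arcsin (q sn x)\<close> is \<open>q cn x\<close>, so both sides have the same derivative in \<open>a\<close> by the
  formula for \<open>cn (a + b) + cn (a - b)\<close>; at \<open>a = 0\<close> both vanish.
\<close>

lemma arcsin_part:
  assumes q: "0 \<le> q" "q \<le> 1"
  shows "(arcsin (q * jacobi_sn q (a + b)) + arcsin (q * jacobi_sn q (a - b))) / 2 =
    arctan (q * jacobi_cn q b * jacobi_sn q a / jacobi_dn q a)"
proof -
  define c' where "c' = jacobi_cn q b"
  have bound: "\<bar>q * jacobi_sn q x\<bar> < 1" for x
  proof -
    have "(q * jacobi_sn q x)\<^sup>2 < 1"
      using modular_positive[OF q, of x] by (simp add: power_mult_distrib)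
    then show ?thesis by (simp add: abs_square_less_1)
  qed
  have asin: "((\<lambda>x. arcsin (q * jacobi_sn q x)) has_real_derivative q * jacobi_cn q x) (at x)" for x
  proof -
    have "((\<lambda>x. arcsin (q * jacobi_sn q x)) has_real_derivative
        inverse (sqrt (1 - (q * jacobi_sn q x)\<^sup>2)) * (q * (jacobi_cn q x * jacobi_dn q x))) (at x)"
      by (intro DERIV_chain2[OF DERIV_arcsin] DERIV_cmult DERIV_sn q)
        (use bound[of x] in \<open>simp_all add: abs_less_iff\<close>)
    moreover have "sqrt (1 - (q * jacobi_sn q x)\<^sup>2) = jacobi_dn q x"
      by (simp add: jacobi_dn_def power_mult_distrib)
    ultimately show ?thesis using dn_positive[OF q, of x] by (simp add: field_simps)
  qed
  let ?f = "\<lambda>a. (arcsin (q * jacobi_sn q (a + b)) + arcsin (q * jacobi_sn q (a - b))) / 2 -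
    arctan (q * c' * jacobi_sn q a / jacobi_dn q a)"
  have const: "\<forall>a. (?f has_real_derivative 0) (at a)"
  proof
    fix t
    define s c d where defs: "s = jacobi_sn q t" "c = jacobi_cn q t" "d = jacobi_dn q t"
    have d: "d > 0" using dn_positive[OF q, of t] by (simp add: defs)
    note rel = jacobi_relations[OF q, of t, folded defs] jacobi_relations(1)[OF q, of b, folded c'_def]
    have r: "((\<lambda>a. a + b) has_real_derivative 1) (at t)" "((\<lambda>a. a - b) has_real_derivative 1) (at t)"
      by (auto intro!: derivative_eq_intros)
    have 1: "((\<lambda>a. (arcsin (q * jacobi_sn q (a + b)) + arcsin (q * jacobi_sn q (a - b))) / 2) has_real_derivative
        (q * jacobi_cn q (t + b) * 1 + q * jacobi_cn q (t - b) * 1) / 2) (at t)"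
      using DERIV_chain2[OF asin r(1)] DERIV_chain2[OF asin r(2)] by (intro DERIV_cdivide DERIV_add)
    have "((\<lambda>a. q * c' * jacobi_sn q a / jacobi_dn q a) has_real_derivative
        (q * c' * (c * d) * d - q * c' * s * (- q\<^sup>2 * s * c)) / (d * d)) (at t)"
      using DERIV_divide[OF DERIV_cmult[OF DERIV_sn[OF q, of t], of "q * c'"] DERIV_dn[OF q, of t]] d
      by (simp add: defs)
    from DERIV_chain2[OF DERIV_arctan this]
    have 2: "((\<lambda>a. arctan (q * c' * jacobi_sn q a / jacobi_dn q a)) has_real_derivative
        inverse (1 + (q * c' * s / d)\<^sup>2) * ((q * c' * (c * d) * d - q * c' * s * (- q\<^sup>2 * s * c)) / (d * d))) (at t)"
      by (simp only: defs)
    have D: "d\<^sup>2 + q\<^sup>2 * c'\<^sup>2 * s\<^sup>2 = add_denom q t b"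
      unfolding rel by (simp add: add_denom_def defs c'_def jacobi_relations(1)[OF q] algebra_simps)
    have "(q * jacobi_cn q (t + b) * 1 + q * jacobi_cn q (t - b) * 1) / 2 = q * c * c' / add_denom q t b"
      using cn_add_plus_cn_diff[OF q, of t b] by (simp add: defs c'_def distrib_left[symmetric])
    moreover have "inverse (1 + (q * c' * s / d)\<^sup>2) * ((q * c' * (c * d) * d - q * c' * s * (- q\<^sup>2 * s * c)) / (d * d)) =
        q * c * c' / add_denom q t b"
    proof -
      have "(q * c' * (c * d) * d - q * c' * s * (- q\<^sup>2 * s * c)) / (d * d) = q * c * c' / d\<^sup>2"
        using rel(2) d by (simp add: divide_simps power2_eq_square) algebra
      moreover have "1 + (q * c' * s / d)\<^sup>2 = add_denom q t b / d\<^sup>2"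
        unfolding D[symmetric] using d by (simp add: field_simps power2_eq_square)
      ultimately show ?thesis using d add_denom_pos[OF q, of t b] by simp
    qed
    ultimately show "(?f has_real_derivative 0) (at t)"
      by (intro DERIV_cong[OF DERIV_diff[OF 1 2]]) simp
  qed
  have "?f a = ?f 0" using DERIV_isconst_all[OF const] by blast
  also have "?f 0 = 0"
    using q bound[of b] by (simp add: jacobi_minus arcsin_minus abs_less_iff)
  finally show ?thesis by (simp add: c'_def)
qed

lemma theta_split:
  assumes q: "0 \<le> q" "q \<le> 1"
  shows "theta q a b = amp_mean q a b + arctan (q * jacobi_cn q b * jacobi_sn q a / jacobi_dn q a)"
  using arcsin_part[OF q, of a b] by (simp add: theta_def g_fun_def amp_mean_def add_divide_distrib)

lemma sn_pos_interior:
  assumes q: "0 \<le> q" "q \<le> 1" and "b \<in> uniformizing_interval q" "0 < a" "a < b"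
  shows "0 < jacobi_sn q a"
  using amp_strict_mono[OF q, of 0 a] amp_strict_mono[OF q, of a b] uniformizing_interval_amp[OF q, of b] assms
  by (simp add: jacobi_sn_amp sin_gt_zero)

text \<open>For \<open>\<gamma>\<close> in the uniformizing interval the mean amplitude does not leave \<open>[0, \<pi>]\<close>: it is
  increasing, and its sine only vanishes together with \<open>sn \<gamma>\<close>.\<close>

lemma amp_mean_bounds:
  assumes q: "0 \<le> q" "q \<le> 1" and a: "a \<in> uniformizing_interval q"
  shows "0 \<le> amp_mean q a b" "amp_mean q a b \<le> pi"
proof -
  have mono: "amp_mean q x b < amp_mean q y b" if "x < y" for x y
    by (rule DERIV_pos_imp_increasing[OF that])
      (use DERIV_amp_mean[OF q] dn_positive[OF q] add_denom_pos[OF q] in \<open>blast intro: mult_pos_pos divide_pos_pos\<close>)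
  have a0: "0 \<le> a" using uniformizing_interval_amp[OF q a] by simp
  then show "0 \<le> amp_mean q a b"
    using mono[of 0 a] amp_mean_0[OF q, of b] by (cases "a = 0") auto
  show "amp_mean q a b \<le> pi"
  proof (rule ccontr)
    assume gt: "\<not> ?thesis"
    have "continuous_on {0..a} (\<lambda>a. amp_mean q a b)"
      by (intro continuous_at_imp_continuous_on ballI DERIV_isCont[OF DERIV_amp_mean[OF q]])
    then obtain x where x: "0 \<le> x" "x \<le> a" "amp_mean q x b = pi"
      using IVT'[of "\<lambda>a. amp_mean q a b" 0 pi a] gt a0 amp_mean_0[OF q, of b] by auto
    then have "0 < x" "x < a" using gt amp_mean_0[OF q, of b] by (auto simp: order_less_le)
    then have "0 < jacobi_sn q x" by (rule sn_pos_interior[OF q a])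
    moreover have "jacobi_dn q b * jacobi_sn q x / sqrt (add_denom q x b) = 0"
      using cos_sin_amp_mean(2)[OF q, of b x] x by simp
    ultimately show False
      using dn_positive[OF q, of b] add_denom_pos[OF q, of x b] by simp
  qed
qed

lemma cos_sin_arctan_part:
  assumes q: "0 \<le> q" "q \<le> 1"
  defines "B \<equiv> \<lambda>a b. arctan (q * jacobi_cn q b * jacobi_sn q a / jacobi_dn q a)"
  shows "cos (B a b) = jacobi_dn q a / sqrt (add_denom q a b)"
    "sin (B a b) = q * jacobi_cn q b * jacobi_sn q a / sqrt (add_denom q a b)"
proof -
  define x d r where "x = q * jacobi_cn q b * jacobi_sn q a" and "d = jacobi_dn q a"
    and "r = sqrt (add_denom q a b)"
  have d: "d > 0" using dn_positive[OF q] by (simp add: d_def)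
  have "d\<^sup>2 + x\<^sup>2 = add_denom q a b"
    unfolding d_def x_def power_mult_distrib jacobi_relations[OF q] add_denom_def
    by (simp add: algebra_simps)
  then have "1 + (x / d)\<^sup>2 = (r / d)\<^sup>2"
    using d add_denom_pos[OF q, of a b] by (simp add: power_divide r_def field_simps)
  then have "sqrt (1 + (x / d)\<^sup>2) = r / d"
    using d add_denom_pos[OF q, of a b] by (simp add: r_def)
  then have "cos (arctan (x / d)) = d / r" "sin (arctan (x / d)) = x / r"
    using d by (simp_all add: cos_arctan sin_arctan)
  then show "cos (B a b) = jacobi_dn q a / sqrt (add_denom q a b)"
    "sin (B a b) = q * jacobi_cn q b * jacobi_sn q a / sqrt (add_denom q a b)"
    by (simp_all add: B_def x_def d_def r_def)
qed

text \<open>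
  The factor in the numerator of \<open>sin theta\<close> besides \<open>sn a\<close>. Its positivity keeps the angle in \<open>(0, \<pi>)\<close>.
\<close>

definition weight :: "real \<Rightarrow> real \<Rightarrow> real \<Rightarrow> real" where
  "weight q a b = jacobi_dn q a * jacobi_dn q b + q * jacobi_cn q a * jacobi_cn q b"

lemma weight_commute: "weight q a b = weight q b a"
  by (simp add: weight_def mult.commute mult.left_commute)

lemma cn_le_dn:
  assumes q: "0 \<le> q" "q \<le> 1"
  shows "\<bar>jacobi_cn q a\<bar> \<le> jacobi_dn q a"
proof -
  have "(jacobi_cn q a)\<^sup>2 \<le> (jacobi_dn q a)\<^sup>2"
    unfolding jacobi_relations[OF q] using q by (simp add: mult_left_le_one_le power_le_one)
  then show ?thesis using dn_positive[OF q, of a] by (simp add: power2_le_iff_abs_le)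
qed

lemma q_cn_less_dn:
  assumes q: "0 \<le> q" "q < 1"
  shows "q * \<bar>jacobi_cn q a\<bar> < jacobi_dn q a"
proof (rule power2_less_imp_less)
  have "q\<^sup>2 < 1" using q by (simp add: power_less_one_iff)
  then show "(q * \<bar>jacobi_cn q a\<bar>)\<^sup>2 < (jacobi_dn q a)\<^sup>2"
    using q by (simp add: power_mult_distrib jacobi_relations algebra_simps)
qed (use dn_positive[of q a] q in simp)

text \<open>Since \<open>dn\<^sup>2 = q\<^sup>2 cn\<^sup>2 + (1 - q\<^sup>2)\<close>, the first summand dominates if \<open>q < 1\<close>; if \<open>q = 1\<close>, both
  summands are positive.\<close>

lemma weight_pos:
  assumes q: "0 \<le> q" "q \<le> 1"
  shows "0 < weight q a b"
proof (cases "q = 1")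
  case True
  then show ?thesis
    using dn_positive[of q a] dn_positive[of q b] by (simp add: weight_def jacobi_cn_def add_pos_pos)
next
  case False
  have "q * \<bar>jacobi_cn q a\<bar> * \<bar>jacobi_cn q b\<bar> \<le> q * \<bar>jacobi_cn q a\<bar> * jacobi_dn q b"
    using q cn_le_dn[OF q, of b] by (intro mult_left_mono) auto
  also have "\<dots> < jacobi_dn q a * jacobi_dn q b"
    using q_cn_less_dn[of q a] dn_positive[OF q] q False by (intro mult_strict_right_mono) auto
  finally have "\<bar>q * jacobi_cn q a * jacobi_cn q b\<bar> < jacobi_dn q a * jacobi_dn q b"
    using q by (simp add: abs_mult)
  then show ?thesis by (simp add: weight_def)
qed

lemma cos_theta:
  assumes q: "0 \<le> q" "q \<le> 1"
  shows "cos (theta q a b) = (jacobi_cn q a * jacobi_dn q a -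
    q * (jacobi_sn q a)\<^sup>2 * jacobi_cn q b * jacobi_dn q b) / add_denom q a b"
  unfolding theta_split[OF q] cos_add cos_sin_arctan_part[OF q] cos_sin_amp_mean[OF q, symmetric]
  using add_denom_pos[OF q, of a b] by (simp add: field_simps power2_eq_square)

lemma sin_theta:
  assumes q: "0 \<le> q" "q \<le> 1"
  shows "sin (theta q a b) = jacobi_sn q a * weight q a b / add_denom q a b"
  unfolding theta_split[OF q] sin_add cos_sin_arctan_part[OF q] cos_sin_amp_mean[OF q, symmetric]
  using add_denom_pos[OF q, of a b] by (simp add: field_simps weight_def)

text \<open>The values of the angle sum on the uniformizing interval; this fixes the branches of the
  arcus functions.\<close>

lemma theta_bounds:
  assumes q: "0 \<le> q" "q \<le> 1" and a: "a \<in> uniformizing_interval q"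
  shows "0 < jacobi_sn q a \<Longrightarrow> 0 < theta q a b \<and> theta q a b < pi"
    and "jacobi_sn q a = 0 \<Longrightarrow> theta q a b = (if jacobi_cn q a > 0 then 0 else pi)"
proof -
  let ?A = "amp_mean q a b" and ?B = "arctan (q * jacobi_cn q b * jacobi_sn q a / jacobi_dn q a)"
  note A = amp_mean_bounds[OF q a, of b]
  note B = arctan_lbound[of "q * jacobi_cn q b * jacobi_sn q a / jacobi_dn q a"]
    arctan_ubound[of "q * jacobi_cn q b * jacobi_sn q a / jacobi_dn q a"]
  note D = add_denom_pos[OF q, of a b]
  note theta = theta_split[OF q, of a b]
  {
    assume "0 < jacobi_sn q a"
    then have *: "sin (theta q a b) > 0"
      unfolding sin_theta[OF q] using weight_pos[OF q, of a b] D by simp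
    have "- pi < theta q a b" "theta q a b < 2 * pi"
      unfolding theta using A B by linarith+
    then show "0 < theta q a b \<and> theta q a b < pi"
      using * sin_ge_zero[of "- theta q a b"] sin_le_zero[of "theta q a b"]
      by (smt (verit) sin_minus)
  next
    assume s: "jacobi_sn q a = 0"
    then have c: "(jacobi_cn q a)\<^sup>2 = 1" "add_denom q a b = 1"
      using jacobi_relations[OF q, of a] by (auto simp: add_denom_def)
    have "cos ?A = jacobi_cn q a"
      using cos_sin_amp_mean(1)[OF q, of a b] c by simp
    moreover have "jacobi_cn q a = 1 \<or> jacobi_cn q a = - 1"
      using c(1) by (simp add: power2_eq_1_iff)
    ultimately have "?A = (if jacobi_cn q a > 0 then 0 else pi)"
      using A cos_inj_pi[of ?A 0] cos_inj_pi[of ?A pi] by auto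
    then show "theta q a b = (if jacobi_cn q a > 0 then 0 else pi)"
      unfolding theta by (simp add: s)
  }
qed

text \<open>
  The two summands are the angles \<open>\<phi>\<close> and \<open>\<psi>\<close> of a ring \<open>a\<close> towards a ring \<open>b\<close>. The mean amplitude lies in
  \<open>[0, \<pi>]\<close>, which is not the range of \<open>arctan\<close>; the correction is \<open>\<pi>\<close> exactly for clockwise rings.
\<close>

lemma theta_arctan:
  assumes q: "0 \<le> q" "q \<le> 1" and a: "a \<in> uniformizing_interval q" and "jacobi_cn q a \<noteq> 0"
  shows "theta q a b = arctan (jacobi_dn q b * jacobi_sn q a / jacobi_cn q a) +
    arctan (q * jacobi_cn q b * jacobi_sn q a / jacobi_dn q a) + (if jacobi_cn q a > 0 then 0 else pi)"
proof -
  let ?A = "amp_mean q a b"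
  note A = amp_mean_bounds[OF q a, of b]
  note D = add_denom_pos[OF q, of a b]
  have cA: "cos ?A = jacobi_cn q a / sqrt (add_denom q a b)"
    and tan: "tan ?A = jacobi_dn q b * jacobi_sn q a / jacobi_cn q a"
    using D by (simp_all add: tan_def cos_sin_amp_mean[OF q, symmetric])
  have "?A = arctan (tan ?A) + (if jacobi_cn q a > 0 then 0 else pi)"
  proof (cases "jacobi_cn q a > 0")
    case True
    then have "cos ?A > 0" using cA D by simp
    then have "?A < pi / 2"
      using A cos_monotone_0_pi_le[of "pi / 2" ?A] by (cases "?A < pi / 2") auto
    then show ?thesis using True A by (simp add: arctan_tan)
  next
    case False
    then have "jacobi_cn q a < 0" using assms by simp
    then have "cos ?A < 0" using cA D by (simp add: divide_neg_pos)
    then have "?A > pi / 2"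
      using A cos_ge_zero[of ?A] by (cases "?A > pi / 2") auto
    then have "arctan (tan (?A - pi)) = ?A - pi" using A by (intro arctan_tan) auto
    moreover have "tan (?A - pi) = tan ?A" by (simp add: tan_def sin_diff cos_diff)
    ultimately show ?thesis using False by simp
  qed
  then show ?thesis unfolding theta_split[OF q] tan by simp
qed

section \<open>The complex sine and the function g\<close>

text \<open>
  The addition theorem for \<open>x + i y\<close>, with the functions of the imaginary argument expressed by the
  complementary modulus. In this form, holomorphy in the strip amounts to the Cauchy-Riemann
  equations for real functions, and no complex elliptic integral is involved.
\<close>

definition comp_mod :: "real \<Rightarrow> real" where
  "comp_mod q = sqrt (1 - q\<^sup>2)"

definition sn_denom :: "real \<Rightarrow> complex \<Rightarrow> real" where
  "sn_denom q z = (jacobi_cn (comp_mod q) (Im z))\<^sup>2 +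
     q\<^sup>2 * (jacobi_sn q (Re z))\<^sup>2 * (jacobi_sn (comp_mod q) (Im z))\<^sup>2"

definition sn_ext :: "real \<Rightarrow> complex \<Rightarrow> complex" where
  "sn_ext q z = Complex
     (jacobi_sn q (Re z) * jacobi_dn (comp_mod q) (Im z) / sn_denom q z)
     (jacobi_cn q (Re z) * jacobi_dn q (Re z) * (jacobi_sn (comp_mod q) (Im z) * jacobi_cn (comp_mod q) (Im z)) /
        sn_denom q z)"

lemma comp_mod_bounds:
  assumes "0 < q" "q \<le> 1"
  shows "0 \<le> comp_mod q" "comp_mod q < 1" "comp_mod q \<le> 1" "(comp_mod q)\<^sup>2 = 1 - q\<^sup>2"
proof -
  have "0 < q\<^sup>2" "q\<^sup>2 \<le> 1" using assms by (auto simp: power_le_one)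
  then show "0 \<le> comp_mod q" "comp_mod q < 1" "comp_mod q \<le> 1" "(comp_mod q)\<^sup>2 = 1 - q\<^sup>2"
    unfolding comp_mod_def by simp_all
qed

lemma cn_pos_below_K:
  assumes k: "0 \<le> k" "k < 1" and "\<bar>y\<bar> < ell_K k"
  shows "0 < jacobi_cn k y"
proof -
  have "amp k y < pi / 2" "- (pi / 2) < amp k y"
    using amp_strict_mono[of k y "ell_K k"] amp_strict_mono[of k "- ell_K k" y] assms
    by (auto simp: amp_K amp_minus abs_less_iff)
  then show ?thesis by (simp add: jacobi_cn_amp cos_gt_zero_pi)
qed

lemma ell_K_pos: "0 \<le> k \<Longrightarrow> k < 1 \<Longrightarrow> 0 < ell_K k"
  using ell_F_expands[of k 0 "pi / 2"] pi_gt_zero by (simp add: ell_K_def del: pi_gt_zero)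

lemma ell_K'_comp_mod: "ell_K' q = ell_K (comp_mod q)"
  by (simp add: ell_K'_def comp_mod_def)

lemma sn_denom_pos:
  assumes q: "0 < q" "q \<le> 1" and z: "\<bar>Im z\<bar> < ell_K' q"
  shows "0 < sn_denom q z"
proof -
  have "0 < jacobi_cn (comp_mod q) (Im z)"
    using cn_pos_below_K comp_mod_bounds[OF q] z by (simp add: ell_K'_comp_mod)
  then show ?thesis by (simp add: sn_denom_def add_pos_nonneg)
qed

lemma has_field_derivative_from_Cauchy_Riemann:
  assumes u: "(u has_derivative (\<lambda>h. a * Re h + b * Im h)) (at z)"
    and v: "(v has_derivative (\<lambda>h. - b * Re h + a * Im h)) (at z)"
  shows "((\<lambda>z. Complex (u z) (v z)) has_field_derivative Complex a (- b)) (at z)"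
proof -
  have "((\<lambda>z. of_real (u z) + \<i> * of_real (v z)) has_derivative
      (\<lambda>h. of_real (a * Re h + b * Im h) + \<i> * of_real (- b * Re h + a * Im h))) (at z)"
    by (intro derivative_intros u v)
  moreover have "(\<lambda>h. of_real (a * Re h + b * Im h) + \<i> * of_real (- b * Re h + a * Im h)) = (*) (Complex a (- b))"
    by (auto simp: complex_eq_iff fun_eq_iff)
  moreover have "(\<lambda>z. of_real (u z) + \<i> * of_real (v z)) = (\<lambda>z. Complex (u z) (v z))"
    by (auto simp: complex_eq_iff fun_eq_iff)
  ultimately show ?thesis by (simp add: has_field_derivative_def)
qed

lemma sn_ext_differentiable:
  assumes q: "0 < q" "q \<le> 1" and z: "\<bar>Im z\<bar> < ell_K' q"
  shows "sn_ext q field_differentiable (at z)"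
proof -
  define k where "k = comp_mod q"
  have q': "0 \<le> q" "q \<le> 1" using q by auto
  have k: "0 \<le> k" "k \<le> 1" and k2: "k\<^sup>2 = 1 - q\<^sup>2" using comp_mod_bounds[OF q] by (auto simp: k_def)
  define s c d where defs: "s = jacobi_sn q (Re z)" "c = jacobi_cn q (Re z)" "d = jacobi_dn q (Re z)"
  define s' c' d' where defs': "s' = jacobi_sn k (Im z)" "c' = jacobi_cn k (Im z)" "d' = jacobi_dn k (Im z)"
  note rel = jacobi_relations[OF q', of "Re z", folded defs] jacobi_relations[OF k, of "Im z", folded defs']
  define E where "E = sn_denom q z"
  have E: "E > 0" "E = c'\<^sup>2 + q\<^sup>2 * s\<^sup>2 * s'\<^sup>2"
    using sn_denom_pos[OF q z] by (auto simp: E_def sn_denom_def defs defs' k_def)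
  have re: "((\<lambda>z. f (Re z)) has_derivative (\<lambda>h. D * Re h)) (at z)"
    if "(f has_real_derivative D) (at (Re z))" for f D
    using has_derivative_compose[OF has_derivative_Re[OF has_derivative_ident] that[unfolded has_field_derivative_def]] by simp
  have im: "((\<lambda>z. f (Im z)) has_derivative (\<lambda>h. D * Im h)) (at z)"
    if "(f has_real_derivative D) (at (Im z))" for f D
    using has_derivative_compose[OF has_derivative_Im[OF has_derivative_ident] that[unfolded has_field_derivative_def]] by simp
  note ds = re[OF DERIV_sn[OF q'], folded defs] and dc = re[OF DERIV_cn[OF q'], folded defs]
    and dd = re[OF DERIV_dn[OF q'], folded defs]
    and ds' = im[OF DERIV_sn[OF k], folded defs'] and dc' = im[OF DERIV_cn[OF k], folded defs']
    and dd' = im[OF DERIV_dn[OF k], folded defs']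
  define a1 a2 where "a1 = 2 * q\<^sup>2 * s * c * d * s'\<^sup>2" and "a2 = - 2 * s' * c' * d' * d\<^sup>2"
  have dE: "(sn_denom q has_derivative (\<lambda>h. a1 * Re h + a2 * Im h)) (at z)"
  proof -
    have "(sn_denom q has_derivative (\<lambda>h. 2 * c' * (- s' * d' * Im h) +
        (q\<^sup>2 * (2 * s * (c * d * Re h)) * s'\<^sup>2 + q\<^sup>2 * s\<^sup>2 * (2 * s' * (c' * d' * Im h))))) (at z)"
      unfolding sn_denom_def[abs_def] k_def[symmetric]
      by (auto simp: defs[symmetric] defs'[symmetric] fun_eq_iff algebra_simps intro!: derivative_eq_intros ds ds' dc')
    moreover have "2 * c' * (- s' * d' * Im h) +
        (q\<^sup>2 * (2 * s * (c * d * Re h)) * s'\<^sup>2 + q\<^sup>2 * s\<^sup>2 * (2 * s' * (c' * d' * Im h))) = a1 * Re h + a2 * Im h" for h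
      unfolding a1_def a2_def rel(2) by (simp add: algebra_simps)
    ultimately show ?thesis by simp
  qed
  define n1 n2 where "n1 = c * d * d'" and "n2 = - k\<^sup>2 * s * s' * c'"
  have dN: "((\<lambda>z. jacobi_sn q (Re z) * jacobi_dn k (Im z)) has_derivative (\<lambda>h. n1 * Re h + n2 * Im h)) (at z)"
    unfolding n1_def n2_def
    by (auto simp: defs[symmetric] defs'[symmetric] fun_eq_iff algebra_simps intro!: derivative_eq_intros ds dd')
  define m1 m2 where "m1 = - (s * d\<^sup>2 + q\<^sup>2 * s * c\<^sup>2) * s' * c'" and "m2 = c * d * d' * (c'\<^sup>2 - s'\<^sup>2)"
  have dM: "((\<lambda>z. jacobi_cn q (Re z) * jacobi_dn q (Re z) * (jacobi_sn k (Im z) * jacobi_cn k (Im z))) has_derivative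
      (\<lambda>h. m1 * Re h + m2 * Im h)) (at z)"
    unfolding m1_def m2_def
    by (auto simp: defs[symmetric] defs'[symmetric] fun_eq_iff algebra_simps power2_eq_square
        intro!: derivative_eq_intros dc dd ds' dc')
  let ?N = "s * d'" and ?M = "c * d * (s' * c')"
  have dU: "((\<lambda>z. jacobi_sn q (Re z) * jacobi_dn k (Im z) / sn_denom q z) has_derivative
      (\<lambda>h. ((n1 * Re h + n2 * Im h) * E - ?N * (a1 * Re h + a2 * Im h)) / (E * E))) (at z)"
    using has_derivative_divide'[OF dN dE] E(1) by (simp add: E_def defs defs')
  have dV: "((\<lambda>z. jacobi_cn q (Re z) * jacobi_dn q (Re z) * (jacobi_sn k (Im z) * jacobi_cn k (Im z)) / sn_denom q z) has_derivative
      (\<lambda>h. ((m1 * Re h + m2 * Im h) * E - ?M * (a1 * Re h + a2 * Im h)) / (E * E))) (at z)"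
    using has_derivative_divide'[OF dM dE] E(1) by (simp add: E_def defs defs')
  define A B where "A = (n1 * E - ?N * a1) / (E * E)" and "B = (n2 * E - ?N * a2) / (E * E)"
  have CR1: "m2 * E - ?M * a2 = n1 * E - ?N * a1"
    unfolding m2_def n1_def a1_def a2_def E(2)
    by (simp add: rel[THEN square_rewrites(1)] rel[THEN square_rewrites(2)]
        k2[THEN square_rewrites(1)] k2[THEN square_rewrites(2)] power2_eq_square algebra_simps)
  have CR2: "m1 * E - ?M * a1 = - (n2 * E - ?N * a2)"
    unfolding m1_def n2_def a1_def a2_def E(2)
    by (simp add: rel[THEN square_rewrites(1)] rel[THEN square_rewrites(2)]
        k2[THEN square_rewrites(1)] k2[THEN square_rewrites(2)] power2_eq_square algebra_simps)
  have div: "(x * r + y * i) / w = x / w * r + y / w * i" for x y r i w :: real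
    by (simp add: add_divide_distrib)
  have "((n1 * Re h + n2 * Im h) * E - ?N * (a1 * Re h + a2 * Im h)) / (E * E) = A * Re h + B * Im h" for h
    unfolding A_def B_def by (simp add: algebra_simps add_divide_distrib diff_divide_distrib)
  moreover have "((m1 * Re h + m2 * Im h) * E - ?M * (a1 * Re h + a2 * Im h)) / (E * E) = - B * Re h + A * Im h" for h
  proof -
    have "(m1 * Re h + m2 * Im h) * E - ?M * (a1 * Re h + a2 * Im h) =
        (m1 * E - ?M * a1) * Re h + (m2 * E - ?M * a2) * Im h"
      by (simp add: algebra_simps)
    then show ?thesis unfolding CR1 CR2 A_def B_def by (simp only: div minus_divide_left)
  qed
  ultimately have "(sn_ext q has_field_derivative Complex A (- B)) (at z)"
    unfolding sn_ext_def[abs_def] k_def[symmetric]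
    using dU dV by (intro has_field_derivative_from_Cauchy_Riemann) simp_all
  then show ?thesis by (auto simp: field_differentiable_def)
qed

lemma sn_ext_real: "0 < q \<Longrightarrow> q \<le> 1 \<Longrightarrow> sn_ext q (of_real x) = of_real (jacobi_sn q x)"
  by (simp add: sn_ext_def sn_denom_def complex_eq_iff comp_mod_bounds)

text \<open>
  Holomorphic functions on the strip that agree on the real axis are equal, so \<open>complex_sn\<close> is
  this extension.
\<close>

lemma complex_sn_eq:
  assumes q: "0 < q" "q \<le> 1" and z: "\<bar>Im z\<bar> < ell_K' q"
  shows "complex_sn q z = sn_ext q z"
proof -
  define S where "S = {z. \<bar>Im z\<bar> < ell_K' q}"
  have K: "0 < ell_K' q" using ell_K_pos comp_mod_bounds[OF q] by (simp add: ell_K'_comp_mod)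
  have S_eq: "S = {z. Im z < ell_K' q} \<inter> {z. - ell_K' q < Im z}" by (auto simp: S_def)
  have S: "open S" "connected S"
    unfolding S_eq
    by (auto intro!: open_Int open_halfspace_Im_lt open_halfspace_Im_gt convex_connected convex_Int
        convex_halfspace_Im_lt convex_halfspace_Im_gt)
  have ext: "sn_ext q holomorphic_on S"
    using sn_ext_differentiable[OF q] by (auto simp: holomorphic_on_def S_def intro: field_differentiable_at_within)
  then have "\<exists>f. f holomorphic_on S \<and> (\<forall>x::real. f (of_real x) = of_real (jacobi_sn q x))"
    using sn_ext_real[OF q] by blast
  then have "complex_sn q holomorphic_on S \<and> (\<forall>x::real. complex_sn q (of_real x) = of_real (jacobi_sn q x))"
    unfolding complex_sn_def S_def by (rule someI_ex)
  then have sn: "complex_sn q holomorphic_on S" "\<And>x. complex_sn q (of_real x) = of_real (jacobi_sn q x)"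
    by blast+
  have "complex_sn q z - sn_ext q z = 0"
  proof (rule analytic_continuation[of "\<lambda>z. complex_sn q z - sn_ext q z" S "range of_real" 0])
    show "(0::complex) islimpt range of_real"
      unfolding islimpt_approachable
    proof (intro allI impI)
      fix e :: real assume "0 < e"
      then show "\<exists>x'\<in>range of_real. x' \<noteq> (0::complex) \<and> dist x' 0 < e"
        by (intro bexI[of _ "of_real (e / 2)"] rangeI) auto
    qed
  qed (use K S ext sn sn_ext_real[OF q] z in \<open>auto simp: S_def intro!: holomorphic_intros\<close>)
  then show ?thesis by simp
qed

text \<open>At \<open>K / 2\<close> the addition theorem turns \<open>cn K = 0\<close> into an equation for the squares.\<close>

lemma jacobi_half_K:
  assumes k: "0 \<le> k" "k < 1" and "0 < p" "p\<^sup>2 = 1 - k\<^sup>2"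
  defines "h \<equiv> ell_K k / 2"
  shows "jacobi_dn k h = sqrt p" "jacobi_sn k h = 1 / sqrt (1 + p)" "jacobi_cn k h = sqrt p / sqrt (1 + p)"
proof -
  have k': "0 \<le> k" "k \<le> 1" using k by auto
  define s c d where defs: "s = jacobi_sn k h" "c = jacobi_cn k h" "d = jacobi_dn k h"
  note rel = jacobi_relations[OF k', of h, folded defs]
  have h: "0 < h" "h < ell_K k" using ell_K_pos[OF k] by (auto simp: h_def)
  have "0 < amp k h" "amp k h < pi / 2"
    using amp_strict_mono[OF k', of 0 h] amp_strict_mono[OF k', of h "ell_K k"] h amp_K[OF k] k by auto
  then have pos: "0 < s" "0 < c" "0 < d"
    using dn_positive[OF k', of h] by (auto simp: defs jacobi_sn_amp jacobi_cn_amp sin_gt_zero cos_gt_zero_pi)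
  have "jacobi_cn k (h + h) = 0"
  proof -
    have "h + h = ell_K k" by (simp add: h_def)
    then show ?thesis by (simp only: jacobi_cn_amp amp_K[OF k] cos_pi_half)
  qed
  then have "c * c - s * s * d * d = 0"
    unfolding cn_add[OF k', of h h] defs[symmetric] using addition_denominator[OF k', of h h, folded defs] by auto
  then have e: "1 - s\<^sup>2 = s\<^sup>2 * d\<^sup>2" using rel(1) by (simp add: power2_eq_square algebra_simps)
  have sd: "s\<^sup>2 * (1 + d\<^sup>2) = 1" using e by (simp add: algebra_simps)
  have "(d\<^sup>2)\<^sup>2 = p\<^sup>2"
  proof -
    have "(1 - d\<^sup>2) * (1 + d\<^sup>2) = k\<^sup>2 * (s\<^sup>2 * (1 + d\<^sup>2))" using rel(2) by simp
    then show ?thesis unfolding sd assms(4) by (simp add: algebra_simps power2_eq_square)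
  qed
  then have dp: "d\<^sup>2 = p" by (rule power2_eq_imp_eq) (use \<open>0 < p\<close> in auto)
  then show "jacobi_dn k h = sqrt p" using pos by (simp add: defs[symmetric] real_sqrt_unique)
  have "s\<^sup>2 = 1 / (1 + p)" using sd \<open>0 < p\<close> unfolding dp by (simp add: field_simps)
  then have "sqrt (s\<^sup>2) = sqrt (1 / (1 + p))" by simp
  then have s: "s = 1 / sqrt (1 + p)" using pos by (simp add: real_sqrt_divide)
  then show "jacobi_sn k h = 1 / sqrt (1 + p)" by (simp add: defs)
  have "c\<^sup>2 = p / (1 + p)" using e rel(1) \<open>s\<^sup>2 = 1 / (1 + p)\<close> dp by simp
  then have "sqrt (c\<^sup>2) = sqrt (p / (1 + p))" by simp
  then have "c = sqrt p / sqrt (1 + p)" using pos by (simp add: real_sqrt_divide)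
  then show "jacobi_cn k h = sqrt p / sqrt (1 + p)" by (simp add: defs)
qed

text \<open>The value of \<open>sn\<close> on the middle line of the upper half of the strip has constant modulus; its
  argument is found by comparison with \<open>theta u u = g_fun (2 u)\<close>.\<close>

lemma complex_sn_middle:
  assumes q: "0 < q" "q \<le> 1"
  shows "complex_sn q (Complex (x / 2) (ell_K' q / 2)) = of_real (1 / sqrt q) * cis (pi / 2 - g_fun q x)"
proof -
  define k where "k = comp_mod q"
  have q': "0 \<le> q" "q \<le> 1" using q by auto
  have k: "0 \<le> k" "k < 1" "q\<^sup>2 = 1 - k\<^sup>2" using comp_mod_bounds[OF q] by (auto simp: k_def)
  define u where "u = x / 2"
  define s c d where defs: "s = jacobi_sn q u" "c = jacobi_cn q u" "d = jacobi_dn q u"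
  note rel = jacobi_relations[OF q', of u, folded defs]
  note half = jacobi_half_K[OF k(1,2) q(1) k(3)]
  have q0: "sqrt q * sqrt q = q" "sqrt q > 0" "sqrt (1 + q) * sqrt (1 + q) = 1 + q" "sqrt (1 + q) > 0" using q by auto
  have f: "0 < 1 + q * s\<^sup>2" using q by (simp add: add_pos_nonneg)
  have D: "add_denom q u u = (1 - q * s\<^sup>2) * (1 + q * s\<^sup>2)"
    by (simp add: add_denom_def defs algebra_simps power2_eq_square)
  then have f': "1 - q * s\<^sup>2 \<noteq> 0" using add_denom_pos[OF q', of u u] by auto
  have g: "theta q u u = g_fun q x" using q' by (simp add: theta_def g_fun_def u_def)
  have "cos (g_fun q x) = (c * d * (1 - q * s\<^sup>2)) / ((1 - q * s\<^sup>2) * (1 + q * s\<^sup>2))"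
    using cos_theta[OF q', of u u] unfolding g D defs[symmetric] by (simp add: algebra_simps)
  then have cos: "cos (g_fun q x) = c * d / (1 + q * s\<^sup>2)" using f' by simp
  have "sin (g_fun q x) = (s * (1 + q) * (1 - q * s\<^sup>2)) / ((1 - q * s\<^sup>2) * (1 + q * s\<^sup>2))"
  proof -
    have "s * weight q u u = s * (1 + q) * (1 - q * s\<^sup>2)"
      unfolding weight_def defs[symmetric]
      by (simp add: rel[THEN square_rewrites(1)] rel[THEN square_rewrites(2)] power2_eq_square algebra_simps)
    then show ?thesis using sin_theta[OF q', of u u] unfolding g D defs[symmetric] by (simp only: mult.assoc)
  qed
  then have sin: "sin (g_fun q x) = s * (1 + q) / (1 + q * s\<^sup>2)" using f' by simp
  have "\<bar>Im (Complex (x / 2) (ell_K' q / 2))\<bar> < ell_K' q"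
    using ell_K_pos[OF k(1,2)] by (simp add: ell_K'_comp_mod k_def)
  then have "complex_sn q (Complex (x / 2) (ell_K' q / 2)) = sn_ext q (Complex (x / 2) (ell_K' q / 2))"
    by (rule complex_sn_eq[OF q])
  also have "\<dots> = of_real (1 / sqrt q) * cis (pi / 2 - g_fun q x)"
  proof -
    have E: "sn_denom q (Complex (x / 2) (ell_K' q / 2)) = q * (1 + q * s\<^sup>2) / (1 + q)"
    proof -
      have "sn_denom q (Complex (x / 2) (ell_K' q / 2)) = q / (1 + q) + q\<^sup>2 * s\<^sup>2 * (1 / (1 + q))"
        using q by (simp add: sn_denom_def ell_K'_comp_mod k_def[symmetric] half u_def[symmetric]
            defs[symmetric] power_divide)
      also have "\<dots> = (q + q\<^sup>2 * s\<^sup>2) / (1 + q)" by (simp add: add_divide_distrib)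
      also have "q + q\<^sup>2 * s\<^sup>2 = q * (1 + q * s\<^sup>2)" by (simp add: algebra_simps power2_eq_square)
      finally show ?thesis .
    qed
    have 1: "s * sqrt q / (q * (1 + q * s\<^sup>2) / (1 + q)) = 1 / sqrt q * (s * (1 + q) / (1 + q * s\<^sup>2))"
      using q f q0 by (simp add: divide_simps)
    have 2: "c * d * (1 / sqrt (1 + q) * (sqrt q / sqrt (1 + q))) / (q * (1 + q * s\<^sup>2) / (1 + q)) =
        1 / sqrt q * (c * d / (1 + q * s\<^sup>2))"
      using q f q0 by (simp add: divide_simps)
    show ?thesis
      unfolding sn_ext_def E
      using 1 2
      by (simp add: complex_eq_iff cos_diff sin_diff sin cos ell_K'_comp_mod k_def[symmetric] half
          u_def[symmetric] defs[symmetric])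
  qed
  finally show ?thesis .
qed

lemma continuous_g_fun:
  assumes q: "0 \<le> q" "q \<le> 1"
  shows "continuous_on UNIV (g_fun q)"
proof -
  have "\<bar>q * jacobi_sn q x\<bar> \<le> 1" for x
  proof -
    have "(q * jacobi_sn q x)\<^sup>2 \<le> 1"
      using modular_positive[OF q, of x] by (simp add: power_mult_distrib)
    then show ?thesis by (simp add: abs_square_le_1)
  qed
  moreover have "continuous_on UNIV (amp q)" "continuous_on UNIV (jacobi_sn q)"
    by (intro continuous_at_imp_continuous_on ballI DERIV_isCont[OF DERIV_amp[OF q]] DERIV_isCont[OF DERIV_sn[OF q]])+
  ultimately show ?thesis
    unfolding g_fun_def[abs_def] by (intro continuous_intros) (auto simp: abs_le_iff)
qed

text \<open>
  Two continuous branches of the same argument differ by a continuous function whose values are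
  multiples of \<open>2\<pi>\<close>, which is constant; the branches agree at \<open>0\<close>.
\<close>

theorem ring_g_explicit:
  assumes q: "0 < q" "q \<le> 1"
  shows "ring_g q = g_fun q"
proof -
  have q': "0 \<le> q" "q \<le> 1" using q by auto
  define w where "w x = complex_sn q (Complex (x / 2) (ell_K' q / 2))" for x
  have w: "w x = of_real (1 / sqrt q) * cis (pi / 2 - g_fun q x)" for x
    by (simp add: w_def complex_sn_middle[OF q])
  have nw: "norm (w x) = 1 / sqrt q" for x using q by (simp add: w norm_mult norm_divide)
  show ?thesis
    unfolding ring_g_def w_def[symmetric] Let_def
  proof (rule the_equality)
    show "continuous_on UNIV (g_fun q) \<and> g_fun q 0 = 0 \<and>
        (\<forall>x. w x = of_real (norm (w x)) * cis (pi / 2 - g_fun q x))"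
      unfolding nw unfolding w using continuous_g_fun[OF q'] q' by (simp add: g_fun_def)
  next
    fix g assume g: "continuous_on UNIV g \<and> g 0 = 0 \<and> (\<forall>x. w x = of_real (norm (w x)) * cis (pi / 2 - g x))"
    define h where "h x = (g x - g_fun q x) / (2 * pi)" for x
    have int: "\<exists>n::int. h x = of_int n" for x
    proof -
      have "w x = of_real (norm (w x)) * cis (pi / 2 - g x)" using g by blast
      then have "cis (pi / 2 - g x) = cis (pi / 2 - g_fun q x)"
        unfolding nw unfolding w using q by simp
      then have "sin (g x) = sin (g_fun q x) \<and> cos (g x) = cos (g_fun q x)"
        by (auto simp: complex_eq_iff cos_diff sin_diff)
      then obtain n :: int where "g x = g_fun q x + 2 * pi * n" using sin_cos_eq_iff by metis
      then have "h x = of_int n" by (simp add: h_def)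
      then show ?thesis ..
    qed
    have "h constant_on UNIV"
    proof (rule continuous_discrete_range_constant)
      show "continuous_on UNIV h"
        unfolding h_def[abs_def] using g continuous_g_fun[OF q'] by (intro continuous_intros) auto
      fix x
      have "1 \<le> norm (h y - h x)" if "h y \<noteq> h x" for y
      proof -
        obtain m n :: int where "h x = m" "h y = n" using int by metis
        then show ?thesis using that by (simp add: flip: of_int_diff of_int_abs)
      qed
      then show "\<exists>e>0. \<forall>y. y \<in> UNIV \<and> h y \<noteq> h x \<longrightarrow> e \<le> norm (h y - h x)"
        by (intro exI[of _ 1]) auto
    qed auto
    then obtain y where y: "\<And>x. h x = y" by (auto simp: constant_on_def)
    have "h 0 = 0" using g q' by (simp add: h_def g_fun_def)
    then have "h x = 0" for x using y[of x] y[of 0] by simp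
    then show "g = g_fun q" by (simp add: h_def fun_eq_iff)
  qed
qed

section \<open>Radii and opening angles\<close>

lemma uniformizes_signs:
  assumes q: "0 < q" "q \<le> 1" and X: "uniformizes q \<gamma> X"
  shows "rad X > 0 \<longleftrightarrow> jacobi_cn q \<gamma> > 0" "rad X < 0 \<longleftrightarrow> jacobi_cn q \<gamma> < 0"
proof -
  have q': "0 \<le> q" using q by simp
  have s: "0 \<le> jacobi_sn q \<gamma>" using X sn_nonneg[OF q' q(2)] by (simp add: uniformizes_def)
  have "(rad X > 0 \<longleftrightarrow> jacobi_cn q \<gamma> > 0) \<and> (rad X < 0 \<longleftrightarrow> jacobi_cn q \<gamma> < 0)"
  proof (cases "jacobi_sn q \<gamma> = 0")
    case True
    then have "jacobi_cn q \<gamma> \<noteq> 0" using sn_cn_square[of q \<gamma>] by auto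
    then show ?thesis using X True by (auto simp: uniformizes_def)
  next
    case False
    then obtain r where r: "rad X = ereal r" "sinh r = jacobi_cn q \<gamma> / jacobi_sn q \<gamma>"
      using X by (auto simp: uniformizes_def)
    have "(0 < r \<longleftrightarrow> 0 < sinh r) \<and> (r < 0 \<longleftrightarrow> sinh r < 0)" by simp
    moreover have "0 < jacobi_sn q \<gamma>" using s False by simp
    ultimately show ?thesis unfolding r by (simp add: zero_less_divide_iff divide_less_0_iff)
  qed
  then show "rad X > 0 \<longleftrightarrow> jacobi_cn q \<gamma> > 0" "rad X < 0 \<longleftrightarrow> jacobi_cn q \<gamma> < 0" by auto
qed

lemma uniformizes_tanh:
  assumes q: "0 < q" "q \<le> 1" and X: "uniformizes q \<gamma> X"
  shows "tanh_ereal (Rad X) = jacobi_dn q \<gamma>" "tanh_ereal (rad X) = jacobi_cn q \<gamma>"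
proof -
  have q': "0 \<le> q" using q by simp
  have s: "0 \<le> jacobi_sn q \<gamma>" using X sn_nonneg[OF q' q(2)] by (simp add: uniformizes_def)
  show "tanh_ereal (Rad X) = jacobi_dn q \<gamma>"
    using X by (auto simp: uniformizes_def tanh_ereal_def jacobi_dn_def split: if_splits)
  show "tanh_ereal (rad X) = jacobi_cn q \<gamma>"
  proof (cases "jacobi_sn q \<gamma> = 0")
    case True
    then have "jacobi_cn q \<gamma> = 1 \<or> jacobi_cn q \<gamma> = - 1"
      using sn_cn_square[of q \<gamma>] by (simp add: power2_eq_1_iff)
    then show ?thesis using X True by (auto simp: uniformizes_def tanh_ereal_def)
  next
    case False
    then obtain r where r: "rad X = ereal r" "sinh r = jacobi_cn q \<gamma> / jacobi_sn q \<gamma>"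
      using X by (auto simp: uniformizes_def)
    have "(cosh r)\<^sup>2 = (1 / jacobi_sn q \<gamma>)\<^sup>2"
      using False sn_cn_square[of q \<gamma>] by (simp add: cosh_square_eq r(2) power_divide field_simps)
    then have "cosh r = 1 / jacobi_sn q \<gamma>"
      using s by (simp add: power2_eq_iff_nonneg)
    then show ?thesis using False r by (simp add: tanh_ereal_def tanh_def)
  qed
qed

text \<open>
  Substitution of \<open>tanh R' = dn \<gamma>'\<close>, \<open>sinh r = cn \<gamma> / sn \<gamma>\<close>, \<open>tanh r' = cn \<gamma>'\<close> and \<open>sinh R = dn \<gamma> / (q sn \<gamma>)\<close>.
  The case \<open>r = 0\<close> is excluded, where \<open>\<phi>\<close> is not defined.
\<close>

lemma opening_angle_uniformized:
  assumes q: "0 < q" "q \<le> 1" and X: "uniformizes q \<gamma> X" and Y: "uniformizes q \<gamma>' Y"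
    and c: "jacobi_cn q \<gamma> \<noteq> 0"
  shows "opening_angle X Y = theta q \<gamma> \<gamma>' - (if jacobi_cn q \<gamma> > 0 then 0 else pi)"
proof -
  have q': "0 \<le> q" using q by simp
  have a: "\<gamma> \<in> uniformizing_interval q" using X by (simp add: uniformizes_def)
  note th = theta_arctan[OF q' q(2) a c, of \<gamma>'] and tanh = uniformizes_tanh[OF q Y]
  have d: "jacobi_dn q \<gamma> > 0" using dn_positive[OF q' q(2)] .
  show ?thesis
  proof (cases "jacobi_sn q \<gamma> = 0")
    case True
    then have "\<bar>rad X\<bar> = \<infinity>" "Rad X = \<infinity>" using X by (auto simp: uniformizes_def)
    then show ?thesis using True unfolding th by (simp add: opening_angle_def radius_angle_def)
  next
    case False
    then obtain r R where rR: "rad X = ereal r" "Rad X = ereal R" "cosh R = 1 / (q * jacobi_sn q \<gamma>)"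
      "tanh R = jacobi_dn q \<gamma>" "sinh r = jacobi_cn q \<gamma> / jacobi_sn q \<gamma>"
      using X by (auto simp: uniformizes_def)
    have "sinh R = tanh R * cosh R" by (simp add: tanh_def)
    then have "sinh R = jacobi_dn q \<gamma> / (q * jacobi_sn q \<gamma>)" by (simp add: rR)
    then show ?thesis
      unfolding th using False d q
      by (simp add: opening_angle_def radius_angle_def rR tanh mult_ac)
  qed
qed

text \<open>The boundary formula holds for each neighbour separately.\<close>

lemma theta_sum_cone_angle:
  assumes q: "0 < q" "q \<le> 1" and X: "\<And>v. v \<in> vertices_G S \<Longrightarrow> uniformizes q (\<gamma> v) (X v)"
    and v: "v \<in> vertices_G S"
  shows "rad (X v) > 0 \<Longrightarrow> (\<Sum>w\<in>neighbours S v. theta q (\<gamma> v) (\<gamma> w)) = cone_angle S X v"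
    and "rad (X v) < 0 \<Longrightarrow> (\<Sum>w\<in>neighbours S v. theta q (\<gamma> v) (\<gamma> w)) =
      cone_angle S X v + pi * real (card (neighbours S v))"
proof -
  have nb: "w \<in> vertices_G S" if "w \<in> neighbours S v" for w using that by (simp add: neighbours_def)
  note sgn = uniformizes_signs[OF q X[OF v]]
  {
    assume "rad (X v) > 0"
    then show "(\<Sum>w\<in>neighbours S v. theta q (\<gamma> v) (\<gamma> w)) = cone_angle S X v"
      unfolding cone_angle_def using sgn opening_angle_uniformized[OF q X[OF v] X[OF nb]]
      by (intro sum.cong) auto
  next
    assume r: "rad (X v) < 0"
    have "(\<Sum>w\<in>neighbours S v. theta q (\<gamma> v) (\<gamma> w)) = (\<Sum>w\<in>neighbours S v. opening_angle (X v) (X w) + pi)"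
      using sgn r opening_angle_uniformized[OF q X[OF v] X[OF nb]] by (intro sum.cong) auto
    then show "(\<Sum>w\<in>neighbours S v. theta q (\<gamma> v) (\<gamma> w)) =
      cone_angle S X v + pi * real (card (neighbours S v))"
      by (simp add: cone_angle_def sum.distrib)
  }
qed

section \<open>Local systems on simply connected square complexes\<close>

text \<open>
  Transport maps \<open>c a b\<close> between corners of a common square that compose within each square have no
  holonomy on a simply connected complex. A path is replaced by the lattice vertices closest to
  sufficiently many of its points; a fine enough grid on a homotopy is replaced by a grid of
  lattice vertices, each mesh of which lies in a single square.
\<close>

definition lattice_point :: "vertex \<Rightarrow> real \<times> real" where
  "lattice_point a = (of_int (fst a), of_int (snd a))"

definition nearest_vertex :: "real \<times> real \<Rightarrow> vertex" where
  "nearest_vertex z = (round (fst z), round (snd z))"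

definition square_of :: "vertex \<Rightarrow> (real \<times> real) set" where
  "square_of s = {of_int (fst s) .. of_int (fst s) + 1} \<times> {of_int (snd s) .. of_int (snd s) + 1}"

lemma cells_squares: "cells S = (\<Union>s\<in>S. square_of s)"
  by (simp add: cells_def square_of_def case_prod_beta)

lemma convex_square_of: "convex (square_of s)"
  unfolding square_of_def by (intro convex_Times) auto

lemma corners_iff: "a \<in> corners s \<longleftrightarrow> fst a \<in> {fst s, fst s + 1} \<and> snd a \<in> {snd s, snd s + 1}"
  by (cases s; cases a) (auto simp: corners_def)

lemma corner_in_square: "a \<in> corners s \<Longrightarrow> lattice_point a \<in> square_of s"
  by (auto simp: corners_iff lattice_point_def square_of_def)

lemma nearest_vertex_lattice_point [simp]: "nearest_vertex (lattice_point a) = a"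
  by (simp add: nearest_vertex_def lattice_point_def)

lemma nearest_vertex_corner:
  assumes z: "z \<in> square_of s" and d: "dist z w < 1 / 2"
  shows "nearest_vertex w \<in> corners s"
proof -
  have int: "n \<in> {m, m + 1}" if "of_int m \<le> x" "x \<le> of_int m + 1" "\<bar>x - of_int n\<bar> < 1" for m n :: int and x :: real
  proof -
    have "of_int m - 1 < (of_int n :: real)" "(of_int n :: real) < of_int m + 2" using that by linarith+
    then have "m - 1 < n" "n < m + 2" by linarith+
    then show ?thesis by auto
  qed
  have "\<bar>fst z - fst w\<bar> < 1 / 2" "\<bar>snd z - snd w\<bar> < 1 / 2"
    using d dist_fst_le[of z w] dist_snd_le[of z w] by (auto simp: dist_real_def)
  moreover have "\<bar>fst w - of_int (round (fst w))\<bar> \<le> 1 / 2" "\<bar>snd w - of_int (round (snd w))\<bar> \<le> 1 / 2"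
    using of_int_round_abs_le[of "fst w"] of_int_round_abs_le[of "snd w"] by (auto simp: abs_minus_commute)
  ultimately have "\<bar>fst z - of_int (round (fst w))\<bar> < 1" "\<bar>snd z - of_int (round (snd w))\<bar> < 1"
    by linarith+
  then show ?thesis
    using z by (auto simp: corners_iff nearest_vertex_def square_of_def
        dest!: int[of "fst s" "fst z" "round (fst w)"] int[of "snd s" "snd z" "round (snd w)"])
qed

text \<open>Transport along the vertices closest to \<open>p (0/n), \<dots>, p (i/n)\<close>.\<close>

primrec transport :: "(vertex \<Rightarrow> vertex \<Rightarrow> 'f \<Rightarrow> 'f) \<Rightarrow> (real \<Rightarrow> real \<times> real) \<Rightarrow> nat \<Rightarrow> nat \<Rightarrow> 'f \<Rightarrow> 'f" where
  "transport c p n 0 t = t"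
| "transport c p n (Suc i) t =
     c (nearest_vertex (p (real i / real n))) (nearest_vertex (p (real (Suc i) / real n))) (transport c p n i t)"

definition sampled :: "(real \<Rightarrow> real \<times> real) \<Rightarrow> nat \<Rightarrow> bool" where
  "sampled p n \<longleftrightarrow> (\<forall>x\<in>{0..1}. \<forall>y\<in>{0..1}. \<bar>x - y\<bar> \<le> 1 / real n \<longrightarrow> dist (p x) (p y) < 1 / 2)"

lemma uniform_scale:
  fixes f :: "'a::metric_space \<Rightarrow> 'b::metric_space"
  assumes "continuous_on A f" "compact A"
  obtains N where "N > 0" "\<And>n x y. n \<ge> N \<Longrightarrow> x \<in> A \<Longrightarrow> y \<in> A \<Longrightarrow> dist x y \<le> 2 / real n \<Longrightarrow> dist (f x) (f y) < 1 / 2"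
proof -
  obtain d where d: "d > 0" "\<And>x y. x \<in> A \<Longrightarrow> y \<in> A \<Longrightarrow> dist x y < d \<Longrightarrow> dist (f x) (f y) < 1 / 2"
    using compact_uniformly_continuous[OF assms] unfolding uniformly_continuous_on_def
    by (metis dist_commute half_gt_zero_iff zero_less_one)
  obtain N where N: "real N > 2 / d" using reals_Archimedean2 by blast
  have N0: "N > 0" using N d by (cases "N = 0") auto
  show thesis
  proof (rule that[OF N0])
    fix n x y assume "n \<ge> N" "x \<in> A" "y \<in> A" "dist x y \<le> 2 / real n"
    moreover have "2 / real n < d"
    proof -
      have "2 / d < real n" using N \<open>n \<ge> N\<close> by linarith
      then show ?thesis using d N0 \<open>n \<ge> N\<close> by (simp add: field_simps)
    qed
    ultimately show "dist (f x) (f y) < 1 / 2" using d by auto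
  qed
qed

lemma eventually_fine:
  assumes "path p"
  obtains N where "N > 0" "\<And>n. n \<ge> N \<Longrightarrow> sampled p n"
proof -
  obtain N where N: "N > 0" "\<And>n x y. n \<ge> N \<Longrightarrow> x \<in> {0..1} \<Longrightarrow> y \<in> {0..1} \<Longrightarrow> dist x y \<le> 2 / real n \<Longrightarrow> dist (p x) (p y) < 1 / 2"
    using uniform_scale[of "{0..1}" p] assms unfolding path_def by (metis compact_Icc)
  have "sampled p n" if "n \<ge> N" for n
    unfolding sampled_def
  proof (intro ballI impI)
    fix x y :: real assume "x \<in> {0..1}" "y \<in> {0..1}" "\<bar>x - y\<bar> \<le> 1 / real n"
    moreover have "1 / real n \<le> 2 / real n" by (simp add: divide_right_mono)
    ultimately show "dist (p x) (p y) < 1 / 2" using N(2)[OF that, of x y] by (simp add: dist_real_def)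
  qed
  then show thesis using that N(1) by blast
qed

text \<open>
  The fibre consists of the elements with \<open>Q\<close>, and \<open>c a b\<close> is the transport from the fibre at \<open>a\<close> to the
  fibre at \<open>b\<close>.
\<close>

locale local_system =
  fixes S :: "vertex set" and c :: "vertex \<Rightarrow> vertex \<Rightarrow> 'f \<Rightarrow> 'f" and Q :: "'f \<Rightarrow> bool"
  assumes transport_refl: "\<And>s a t. s \<in> S \<Longrightarrow> a \<in> corners s \<Longrightarrow> Q t \<Longrightarrow> c a a t = t"
    and transport_comp: "\<And>s a b d t. s \<in> S \<Longrightarrow> a \<in> corners s \<Longrightarrow> b \<in> corners s \<Longrightarrow> d \<in> corners s \<Longrightarrow>
      Q t \<Longrightarrow> c b d (c a b t) = c a d t"
    and transport_inv: "\<And>s a b t. s \<in> S \<Longrightarrow> a \<in> corners s \<Longrightarrow> b \<in> corners s \<Longrightarrow> Q t \<Longrightarrow> Q (c a b t)"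
begin

lemma close_corners:
  assumes "z \<in> cells S"
  obtains s where "s \<in> S" "\<And>w. dist z w < 1 / 2 \<Longrightarrow> nearest_vertex w \<in> corners s"
  using assms nearest_vertex_corner unfolding cells_squares by blast

lemma fine_step:
  assumes "sampled p n" "path_image p \<subseteq> cells S" "i < n"
  obtains s where "s \<in> S" "nearest_vertex (p (real i / real n)) \<in> corners s"
    "nearest_vertex (p (real (Suc i) / real n)) \<in> corners s"
    "\<And>x. \<bar>x - real i / real n\<bar> \<le> 1 / real n \<Longrightarrow> x \<in> {0..1} \<Longrightarrow> nearest_vertex (p x) \<in> corners s"
proof -
  have i: "real i / real n \<in> {0..1}" "real (Suc i) / real n \<in> {0..1}" using assms(3) by auto
  then have "p (real i / real n) \<in> cells S" using assms(2) by (auto simp: path_image_def)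
  then obtain s where s: "s \<in> S" "\<And>w. dist (p (real i / real n)) w < 1 / 2 \<Longrightarrow> nearest_vertex w \<in> corners s"
    using close_corners by blast
  have "nearest_vertex (p x) \<in> corners s" if "\<bar>x - real i / real n\<bar> \<le> 1 / real n" "x \<in> {0..1}" for x
    using assms(1) i that s(2) unfolding sampled_def by (metis abs_minus_commute)
  moreover have "\<bar>real (Suc i) / real n - real i / real n\<bar> \<le> 1 / real n"
    by (simp add: diff_divide_distrib[symmetric])
  ultimately show thesis using that[OF s(1)] i by (metis abs_zero diff_self zero_le_divide_1_iff of_nat_0_le_iff)
qed

lemma transport_Q:
  assumes "sampled p n" "path_image p \<subseteq> cells S" "Q t"
  shows "i \<le> n \<Longrightarrow> Q (transport c p n i t)"
proof (induction i)
  case (Suc i)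
  then show ?case using fine_step[OF assms(1,2), of i] transport_inv by (metis Suc_leD Suc_le_lessD transport.simps(2))
qed (use assms in simp)

lemma transport_refine:
  assumes "sampled p n" "path_image p \<subseteq> cells S" "Q t"
  shows "i \<le> n \<Longrightarrow> transport c p (2 * n) (2 * i) t = transport c p n i t"
proof (induction i)
  case (Suc i)
  then have i: "i < n" by simp
  let ?a = "nearest_vertex (p (real i / real n))" and ?b = "nearest_vertex (p (real (Suc i) / real n))"
    and ?m = "nearest_vertex (p (real (2 * i + 1) / real (2 * n)))"
  obtain s where s: "s \<in> S" "?a \<in> corners s" "?b \<in> corners s"
    "\<And>x. \<bar>x - real i / real n\<bar> \<le> 1 / real n \<Longrightarrow> x \<in> {0..1} \<Longrightarrow> nearest_vertex (p x) \<in> corners s"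
    using fine_step[OF assms(1,2) i] by blast
  have m: "real (2 * i + 1) / real (2 * n) - real i / real n = 1 / (2 * real n)"
    using i by (simp add: field_simps)
  have "?m \<in> corners s"
  proof (rule s(4))
    show "\<bar>real (2 * i + 1) / real (2 * n) - real i / real n\<bar> \<le> 1 / real n"
      unfolding m using i by (simp add: field_simps)
    show "real (2 * i + 1) / real (2 * n) \<in> {0..1}" using i by auto
  qed
  moreover have "real (2 * i) / real (2 * n) = real i / real n" "real (Suc (Suc (2 * i))) / real (2 * n) = real (Suc i) / real n"
    using i by (auto simp: field_simps)
  ultimately show ?case
    using Suc s transport_comp[of s ?a ?m ?b] transport_Q[OF assms, of i] i
    by (simp add: algebra_simps)
qed simp

text \<open>
  A fine grid on the homotopy has meshes whose four vertices lie in one square. Going across the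
  meshes between two adjacent rows shows that the rows have the same transport; at the
  ends nothing changes since the homotopy fixes the endpoints.
\<close>

lemma transport_homotopic:
  assumes H: "homotopic_paths (cells S) p p'" and t: "Q t"
  obtains N where "N > 0" "\<And>n. n \<ge> N \<Longrightarrow> transport c p n n t = transport c p' n n t"
proof -
  obtain h :: "real \<times> real \<Rightarrow> real \<times> real" where h': "continuous_on ({0..1} \<times> {0..1}) h" "h \<in> ({0..1} \<times> {0..1}) \<rightarrow> cells S"
    "\<forall>x\<in>{0..1}. h (0, x) = p x" "\<forall>x\<in>{0..1}. h (1, x) = p' x"
    "\<forall>u\<in>{0..1}. pathstart (h \<circ> Pair u) = pathstart p \<and> pathfinish (h \<circ> Pair u) = pathfinish p"
    using H unfolding homotopic_paths by blast
  note h = h'(1,2) h'(3,4,5)[rule_format]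
  obtain N where N: "N > 0" "\<And>n x y. n \<ge> N \<Longrightarrow> x \<in> {0..1} \<times> {0..1} \<Longrightarrow> y \<in> {0..1} \<times> {0..1} \<Longrightarrow>
      dist x y \<le> 2 / real n \<Longrightarrow> dist (h x) (h y) < 1 / 2"
    using uniform_scale[OF h(1)] compact_Times[OF compact_Icc compact_Icc] by metis
  show thesis
  proof (rule that[OF N(1)])
    fix n assume n: "n \<ge> N"
    then have n0: "n > 0" using N by simp
    define a where "a i j = nearest_vertex (h (real j / real n, real i / real n))" for i j
    define row where "row j = (\<lambda>x. h (real j / real n, x))" for j
    have mesh: "\<exists>s\<in>S. a i j \<in> corners s \<and> a (Suc i) j \<in> corners s \<and> a i (Suc j) \<in> corners s \<and> a (Suc i) (Suc j) \<in> corners s"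
      if "i < n" "j < n" for i j
    proof -
      let ?z = "(real j / real n, real i / real n)"
      have in01: "real k / real n \<in> {0..1}" if "k \<le> n" for k
        using that n0 by (auto simp: divide_le_eq)
      then have "h ?z \<in> cells S" using h(2) that by (auto simp: Pi_iff)
      then obtain s where s: "s \<in> S" "\<And>w. dist (h ?z) w < 1 / 2 \<Longrightarrow> nearest_vertex w \<in> corners s"
        using close_corners by blast
      have "a i' j' \<in> corners s" if "i' = i \<or> i' = Suc i" "j' = j \<or> j' = Suc j" for i' j'
      proof -
        have "\<bar>real j / real n - real j' / real n\<bar> \<le> 1 / real n" "\<bar>real i / real n - real i' / real n\<bar> \<le> 1 / real n"
          using that by (auto simp: diff_divide_distrib[symmetric])
        then have "dist ?z (real j' / real n, real i' / real n) \<le> 2 / real n"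
          unfolding dist_Pair_Pair dist_real_def
          using sqrt_sum_squares_le_sum_abs[of "\<bar>real j / real n - real j' / real n\<bar>" "\<bar>real i / real n - real i' / real n\<bar>"]
          by simp
        moreover have "real j' / real n \<in> {0..1}" "real i' / real n \<in> {0..1}"
          using in01 that \<open>i < n\<close> \<open>j < n\<close> by auto
        ultimately show ?thesis
          unfolding a_def using s(2) N(2)[OF n, of ?z] in01 \<open>i < n\<close> \<open>j < n\<close> by simp
      qed
      then show ?thesis using s(1) by auto
    qed
    have row_step: "transport c (row j) n (Suc i) u = c (a i j) (a (Suc i) j) (transport c (row j) n i u)" for i j u
      by (simp add: row_def a_def)
    have rowQ: "Q (transport c (row j) n i u)" if "Q u" "i \<le> n" and j: "j < n" for i j u
      using that(2)
    proof (induction i)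
      case (Suc i)
      then obtain s where "s \<in> S" "a i j \<in> corners s" "a (Suc i) j \<in> corners s" using mesh[of i j] j by auto
      then show ?case unfolding row_step using Suc transport_inv by simp
    qed (use that in simp)
    have ends: "a 0 j = a 0 0" "a n j = a n 0" if "j \<le> n" for j
    proof -
      have "real j / real n \<in> {0..1}" using that n0 by (auto simp: divide_le_eq)
      then show "a 0 j = a 0 0" "a n j = a n 0"
        using h(5)[of "real j / real n"] h(5)[of 0] n0 by (auto simp: a_def pathstart_def pathfinish_def)
    qed
    have c0: "c (a i 0) (a i 0) u = u" if "i = 0 \<or> i = n" "Q u" for u i
    proof -
      have "\<exists>s\<in>S. a i 0 \<in> corners s"
        using mesh[of 0 0] mesh[of "n - 1" 0] n0 that by (auto simp del: of_nat_Suc)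
      then show ?thesis using transport_refl that by blast
    qed
    have rows: "transport c (row j) n n t = transport c (row (Suc j)) n n t" if j: "j < n" for j
    proof -
      have "c (a i j) (a i (Suc j)) (transport c (row j) n i t) = transport c (row (Suc j)) n i t" if "i \<le> n" for i
        using that
      proof (induction i)
        case 0
        then show ?case using c0 t ends[of j] ends[of "Suc j"] j by simp
      next
        case (Suc i)
        then obtain s where s: "s \<in> S" "a i j \<in> corners s" "a (Suc i) j \<in> corners s"
            "a i (Suc j) \<in> corners s" "a (Suc i) (Suc j) \<in> corners s"
          using mesh[of i j] j by auto
        have Qi: "Q (transport c (row j) n i t)" using rowQ t Suc j by simp
        have "c (a (Suc i) j) (a (Suc i) (Suc j)) (transport c (row j) n (Suc i) t) =
            c (a i j) (a (Suc i) (Suc j)) (transport c (row j) n i t)"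
          unfolding row_step using transport_comp s Qi by blast
        also have "\<dots> = c (a i (Suc j)) (a (Suc i) (Suc j)) (c (a i j) (a i (Suc j)) (transport c (row j) n i t))"
          using transport_comp s Qi by metis
        also have "\<dots> = transport c (row (Suc j)) n (Suc i) t" unfolding row_step using Suc by simp
        finally show ?case .
      qed
      from this[of n] show ?thesis
        using c0[of n] rowQ[OF t, of n j] ends[of j] ends[of "Suc j"] j by simp
    qed
    have all: "transport c (row 0) n n t = transport c (row j) n n t" if "j \<le> n" for j
      using that by (induction j) (use rows in auto)
    have cong: "transport c f n i u = transport c g n i u" if "\<And>x. x \<in> {0..1} \<Longrightarrow> f x = g x" "i \<le> n" for f g i u
      using that(2) by (induction i) (use that(1) in auto)
    have "transport c p n n t = transport c (row 0) n n t"
      by (rule cong) (auto simp: row_def h)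
    also have "\<dots> = transport c (row n) n n t" using all by simp
    also have "\<dots> = transport c p' n n t"
      by (rule cong) (use n0 in \<open>auto simp: row_def h\<close>)
    finally show "transport c p n n t = transport c p' n n t" .
  qed
qed

lemma transport_square:
  assumes "s \<in> S" "\<And>x. x \<in> {0..1} \<Longrightarrow> p x \<in> square_of s" "Q t" "n > 0"
  shows "i \<le> n \<Longrightarrow> transport c p n i t = c (nearest_vertex (p 0)) (nearest_vertex (p (real i / real n))) t"
proof (induction i)
  case 0
  have "nearest_vertex (p 0) \<in> corners s" using assms nearest_vertex_corner[of "p 0" s "p 0"] by auto
  then show ?case using transport_refl assms by simp
next
  case (Suc i)
  have "nearest_vertex (p (real k / real n)) \<in> corners s" if "k \<le> n" for k
    using assms(2)[of "real k / real n"] nearest_vertex_corner[of "p (real k / real n)" s "p (real k / real n)"] that assms(4)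
    by (auto simp: divide_le_eq)
  from this[of 0] this[of i] this[of "Suc i"] show ?case
    using Suc transport_comp[OF assms(1)] assms(3) by simp
qed

lemma transport_join:
  assumes "n > 0"
  shows "i \<le> n \<Longrightarrow> transport c (p +++ p') (2 * n) i t = transport c p n i t"
    and "pathfinish p = pathstart p' \<Longrightarrow> i \<le> n \<Longrightarrow>
      transport c (p +++ p') (2 * n) (n + i) t = transport c p' n i (transport c p n n t)"
proof -
  have first: "(p +++ p') (real i / real (2 * n)) = p (real i / real n)" if "i \<le> n" for i
    using that assms by (simp add: joinpaths_def)
  show A: "transport c (p +++ p') (2 * n) i t = transport c p n i t" if "i \<le> n" for i
    using that by (induction i) (use first in \<open>auto simp del: of_nat_Suc of_nat_mult\<close>)
  assume eq: "pathfinish p = pathstart p'"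
  have second: "(p +++ p') (real (n + i) / real (2 * n)) = p' (real i / real n)" for i
    using assms eq by (cases "i = 0") (auto simp: joinpaths_def field_simps pathfinish_def pathstart_def)
  show "transport c (p +++ p') (2 * n) (n + i) t = transport c p' n i (transport c p n n t)" if "i \<le> n"
    using that
  proof (induction i)
    case 0
    then show ?case using A[of n] by simp
  next
    case (Suc i)
    then show ?case using second[of i] second[of "Suc i"] by (simp del: of_nat_Suc of_nat_mult of_nat_add)
  qed
qed

text \<open>
  The transport along sufficiently fine grids. Powers of two are used since halving the
  steps of a fine grid does not change the transport, and since the two halves of a joined path
  then have grids of the same kind.
\<close>

definition path_value :: "(real \<Rightarrow> real \<times> real) \<Rightarrow> 'f \<Rightarrow> 'f \<Rightarrow> bool" where
  "path_value p t u \<longleftrightarrow> (\<exists>N. \<forall>k\<ge>N. transport c p (2 ^ k) (2 ^ k) t = u)"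

lemma path_value_unique: "path_value p t u \<Longrightarrow> path_value p t u' \<Longrightarrow> u = u'"
  unfolding path_value_def by (metis nat_le_linear)

lemma path_value_exists:
  assumes p: "path p" "path_image p \<subseteq> cells S" and t: "Q t"
  shows "\<exists>u. path_value p t u \<and> Q u"
proof -
  obtain N where N: "N > 0" "\<And>n. n \<ge> N \<Longrightarrow> sampled p n" using eventually_fine[OF p(1)] by blast
  have le: "N \<le> 2 ^ k" if "N \<le> k" for k using that less_exp[of k] by linarith
  have "transport c p (2 ^ k) (2 ^ k) t = transport c p (2 ^ N) (2 ^ N) t" if "k \<ge> N" for k
    using that
  proof (induction k rule: dec_induct)
    case (step k)
    then show ?case using transport_refine[OF N(2) p(2) t, of "2 ^ k" "2 ^ k"] le by simp
  qed simp
  moreover have "Q (transport c p (2 ^ N) (2 ^ N) t)"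
    using transport_Q[OF N(2) p(2) t, of "2 ^ N" "2 ^ N"] le by simp
  ultimately show ?thesis unfolding path_value_def by blast
qed

lemma path_value_homotopic:
  assumes "homotopic_paths (cells S) p p'" "path_value p t u" "Q t"
  shows "path_value p' t u"
proof -
  obtain N where N: "N > 0" "\<And>n. n \<ge> N \<Longrightarrow> transport c p n n t = transport c p' n n t"
    using transport_homotopic[OF assms(1,3)] by blast
  obtain M where M: "\<And>k. k \<ge> M \<Longrightarrow> transport c p (2 ^ k) (2 ^ k) t = u"
    using assms(2) unfolding path_value_def by blast
  have "transport c p' (2 ^ k) (2 ^ k) t = u" if "k \<ge> max N M" for k
    using N(2)[of "2 ^ k"] M[of k] that less_exp[of k] by (metis le_trans less_imp_le_nat max.bounded_iff)
  then show ?thesis unfolding path_value_def by blast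
qed

lemma path_value_edge:
  assumes "s \<in> S" "a \<in> corners s" "b \<in> corners s" "path_value p t u" "pathfinish p = lattice_point a" "Q u"
  shows "path_value (p +++ linepath (lattice_point a) (lattice_point b)) t (c a b u)"
proof -
  let ?l = "linepath (lattice_point a) (lattice_point b)"
  obtain M where M: "\<And>k. k \<ge> M \<Longrightarrow> transport c p (2 ^ k) (2 ^ k) t = u"
    using assms(4) unfolding path_value_def by blast
  have sq: "?l x \<in> square_of s" if "x \<in> {0..1}" for x
  proof -
    have "?l x \<in> closed_segment (lattice_point a) (lattice_point b)"
      using that by (metis linepath_in_path)
    then show ?thesis using closed_segment_subset[OF _ _ convex_square_of] corner_in_square assms by blast
  qed
  have "transport c (p +++ ?l) (2 ^ Suc k) (2 ^ Suc k) t = c a b u" if "k \<ge> M" for k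
    using transport_join(2)[where n = "2 ^ k" and i = "2 ^ k" and p = p and p' = ?l and t = t] M[OF that] assms(5)
      transport_square[OF assms(1) sq assms(6), where n = "2 ^ k" and i = "2 ^ k"]
    by (simp add: mult_2 linepath_0' linepath_1')
  then have "transport c (p +++ ?l) (2 ^ k) (2 ^ k) t = c a b u" if "k \<ge> Suc M" for k
    using that by (metis Suc_le_D Suc_le_mono)
  then show ?thesis unfolding path_value_def by blast
qed

text \<open>
  The value at a vertex is the transport of \<open>t\<close> along any path from a base point. Any two paths
  with the same endpoints are homotopic, so the choice does not matter, and appending the edge from \<open>a\<close>
  to \<open>b\<close> gives the compatibility.
\<close>

theorem global_section:
  assumes sc: "simply_connected (cells S)" and t: "Q t"
  shows "\<exists>T. \<forall>s\<in>S. \<forall>a\<in>corners s. Q (T a) \<and> (\<forall>b\<in>corners s. T b = c a b (T a))"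
proof (cases "S = {}")
  case False
  then obtain s0 where s0: "s0 \<in> S" by blast
  define z0 where "z0 = lattice_point s0"
  have lp: "lattice_point a \<in> cells S" if "s \<in> S" "a \<in> corners s" for s a
    using corner_in_square[OF that(2)] that(1) unfolding cells_squares by blast
  have z0: "z0 \<in> cells S" using lp[OF s0, of s0] by (simp add: z0_def corners_iff)
  have pc: "path_connected (cells S)"
    and hom: "\<And>p p'. path p \<Longrightarrow> path_image p \<subseteq> cells S \<Longrightarrow> path p' \<Longrightarrow> path_image p' \<subseteq> cells S \<Longrightarrow>
      pathstart p' = pathstart p \<Longrightarrow> pathfinish p' = pathfinish p \<Longrightarrow> homotopic_paths (cells S) p p'"
    using sc unfolding simply_connected_eq_homotopic_paths by blast+
  define good where "good a p \<longleftrightarrow> path p \<and> path_image p \<subseteq> cells S \<and> pathstart p = z0 \<and> pathfinish p = lattice_point a" for a p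
  define T where "T a = (THE u. \<forall>p. good a p \<longrightarrow> path_value p t u)" for a
  have T: "(\<forall>p. good a p \<longrightarrow> path_value p t (T a)) \<and> Q (T a) \<and> (\<exists>p. good a p)"
    if "s \<in> S" "a \<in> corners s" for s a
  proof -
    have "lattice_point a \<in> cells S" by (rule lp[OF that])
    then obtain p where p: "good a p"
      using pc z0 unfolding path_connected_def good_def by metis
    obtain u where u: "path_value p t u" "Q u" using path_value_exists[OF _ _ t] p unfolding good_def by blast
    have all: "path_value p' t u" if "good a p'" for p'
    proof (rule path_value_homotopic[OF _ u(1) t])
      show "homotopic_paths (cells S) p p'" using p that unfolding good_def by (intro hom) auto
    qed
    have "T a = u"
      unfolding T_def
    proof (rule the_equality)
      show "\<forall>p. good a p \<longrightarrow> path_value p t u" using all by blast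
      show "u' = u" if "\<forall>p. good a p \<longrightarrow> path_value p t u'" for u'
        using that p u path_value_unique by blast
    qed
    then show ?thesis using all u p by blast
  qed
  have "T b = c a b (T a)" if s: "s \<in> S" "a \<in> corners s" "b \<in> corners s" for s a b
  proof -
    let ?l = "linepath (lattice_point a) (lattice_point b)"
    obtain p where p: "good a p" using T s by blast
    have pa: "path_value p t (T a)" "Q (T a)" using T s p by blast+
    have "closed_segment (lattice_point a) (lattice_point b) \<subseteq> square_of s"
      using closed_segment_subset[OF _ _ convex_square_of] corner_in_square s by blast
    then have "closed_segment (lattice_point a) (lattice_point b) \<subseteq> cells S"
      using s unfolding cells_squares by blast
    then have "good b (p +++ ?l)"
      using p unfolding good_def by (auto simp: path_image_join)
    moreover have "path_value (p +++ ?l) t (c a b (T a))"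
      using path_value_edge[OF s pa(1)] p pa(2) by (simp add: good_def)
    ultimately show ?thesis using T[OF s(1,3)] path_value_unique by blast
  qed
  then show ?thesis using T by blast
qed simp

end

(* The symbol $ stands for the components of vectors, not for coefficients of power series. *)
no_notation fps_nth (infixl \<open>$\<close> 75)

section \<open>The hyperboloid model\<close>

text \<open>
  Points and circles become vectors of Minkowski space. A ring corresponds to one vector \<open>C\<close>, time-like
  for finite and light-like for infinite radii, scaled so that its outer circle is
  \<open>mink C x = -1\<close>; then \<open>cosh r = q cosh R\<close> says that its inner circle is \<open>mink C x = -q\<close>.
  Horocycles have the same equations, so infinite radii fit in.
\<close>

definition mink :: "real^3 \<Rightarrow> real^3 \<Rightarrow> real" where
  "mink x y = x $ 1 * y $ 1 + x $ 2 * y $ 2 - x $ 3 * y $ 3"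

definition det3 :: "real^3 \<Rightarrow> real^3 \<Rightarrow> real^3 \<Rightarrow> real" where
  "det3 x y z = x $ 1 * (y $ 2 * z $ 3 - y $ 3 * z $ 2) - x $ 2 * (y $ 1 * z $ 3 - y $ 3 * z $ 1)
     + x $ 3 * (y $ 1 * z $ 2 - y $ 2 * z $ 1)"

abbreviation vec3 :: "real \<Rightarrow> real \<Rightarrow> real \<Rightarrow> real^3" where
  "vec3 a b c \<equiv> vector [a, b, c]"

abbreviation origin :: "real^3" where
  "origin \<equiv> vec3 0 0 1"

text \<open>
  Points of the disc are mapped to the hyperboloid by \<open>hpt\<close>. It is a rescaling of \<open>cone_vec\<close>, which also
  makes sense for ideal points, where it is light-like.
\<close>

definition cone_vec :: "complex \<Rightarrow> real^3" where
  "cone_vec a = vec3 (2 * Re a) (2 * Im a) (1 + (norm a)\<^sup>2)"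

definition hpt :: "complex \<Rightarrow> real^3" where
  "hpt z = (1 / (1 - (norm z)\<^sup>2)) *\<^sub>R cone_vec z"

lemma vec3_eq_iff: "x = y \<longleftrightarrow> x $ 1 = y $ 1 \<and> x $ 2 = y $ 2 \<and> x $ 3 = (y $ 3 :: real)" for x y :: "real^3"
  by (simp add: vec_eq_iff forall_3)

lemma mink_commute: "mink x y = mink y x"
  by (simp add: mink_def mult.commute)

lemma mink_linear [simp]:
  "mink (x + y) z = mink x z + mink y z" "mink z (x + y) = mink z x + mink z y"
  "mink (x - y) z = mink x z - mink y z" "mink z (x - y) = mink z x - mink z y"
  "mink (k *\<^sub>R x) z = k * mink x z" "mink z (k *\<^sub>R x) = k * mink z x"
  "mink (- x) z = - mink x z" "mink z (- x) = - mink z x"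
  by (simp_all add: mink_def algebra_simps)

lemma det3_linear [simp]:
  "det3 (k *\<^sub>R x) y z = k * det3 x y z" "det3 x (k *\<^sub>R y) z = k * det3 x y z" "det3 x y (k *\<^sub>R z) = k * det3 x y z"
  by (simp_all add: det3_def algebra_simps)

lemma det3_cyclic: "det3 x y z = det3 y z x"
  by (simp add: det3_def algebra_simps)

lemma det3_swap: "det3 x y z = - det3 x z y"
  by (simp add: det3_def algebra_simps)

subsection \<open>Lorentz transformations\<close>

definition future :: "real^3 \<Rightarrow> bool" where
  "future x \<longleftrightarrow> mink x x \<le> 0 \<and> x $ 3 > 0"

text \<open>
  The proper orthochronous Lorentz group: for an orthogonal matrix, invariance of \<open>det3\<close>
  means determinant \<open>1\<close>.
\<close>

definition lorentz :: "real^3^3 \<Rightarrow> bool" where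
  "lorentz A \<longleftrightarrow> (\<forall>x y. mink (A *v x) (A *v y) = mink x y) \<and>
     (\<forall>x y z. det3 (A *v x) (A *v y) (A *v z) = det3 x y z) \<and> (\<forall>x. future x \<longrightarrow> future (A *v x))"

lemma lorentz_mult: "lorentz A \<Longrightarrow> lorentz B \<Longrightarrow> lorentz (A ** B)"
  by (simp add: lorentz_def flip: matrix_vector_mul_assoc)

lemma lorentz_id: "lorentz (mat 1)"
  by (simp add: lorentz_def)

text \<open>
  By the reversed Cauchy-Schwarz inequality, vectors in opposite cones have a non-negative product.
\<close>

lemma future_pairing:
  assumes p: "mink p p < 0" "p $ 3 > 0" and y: "mink y y \<le> 0" "mink p y < 0"
  shows "y $ 3 > 0"
proof (rule ccontr)
  assume "\<not> y $ 3 > 0"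
  define P Y where "P = norm (Complex (p $ 1) (p $ 2))" and "Y = norm (Complex (y $ 1) (y $ 2))"
  have "P\<^sup>2 = (p $ 1)\<^sup>2 + (p $ 2)\<^sup>2" "Y\<^sup>2 = (y $ 1)\<^sup>2 + (y $ 2)\<^sup>2"
    by (simp_all add: P_def Y_def cmod_power2)
  then have "P\<^sup>2 < (p $ 3)\<^sup>2" "Y\<^sup>2 \<le> (y $ 3)\<^sup>2"
    using p y by (auto simp: mink_def power2_eq_square)
  then have "P \<le> p $ 3" "Y \<le> - (y $ 3)"
    using p \<open>\<not> y $ 3 > 0\<close> power2_le_imp_le[of P "p $ 3"] power2_le_imp_le[of Y "- (y $ 3)"] by simp_all
  then have "P * Y \<le> p $ 3 * - (y $ 3)"
    by (intro mult_mono) (use p in \<open>auto simp: P_def Y_def\<close>)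
  moreover have "\<bar>p $ 1 * y $ 1 + p $ 2 * y $ 2\<bar> \<le> P * Y"
    using abs_Re_le_cmod[of "cnj (Complex (p $ 1) (p $ 2)) * Complex (y $ 1) (y $ 2)"]
    by (simp add: norm_mult P_def Y_def)
  ultimately show False using y(2) by (simp add: mink_def)
qed

lemma lorentzI:
  assumes "\<And>x y. mink (A *v x) (A *v y) = mink x y"
    and "\<And>x y z. det3 (A *v x) (A *v y) (A *v z) = det3 x y z"
    and "(A *v origin) $ 3 > 0"
  shows "lorentz A"
proof -
  have "future (A *v x)" if "future x" for x
  proof -
    have "mink origin origin < 0" "mink x x \<le> 0" "mink origin x < 0"
      using that by (auto simp: mink_def future_def)
    then show ?thesis
      using future_pairing[of "A *v origin" "A *v x"] assms(1,3) by (simp add: future_def)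
  qed
  then show ?thesis using assms by (simp add: lorentz_def)
qed

lemma lorentz_inverse:
  assumes "lorentz A"
  obtains B where "lorentz B" "A ** B = mat 1" "B ** A = mat 1"
proof -
  have "x = 0" if "A *v x = 0" for x
  proof -
    have "mink x y = 0" for y
      using assms that unfolding lorentz_def by (metis mink_linear(5) mult_zero_left scaleR_zero_left)
    from this[of "axis 1 1"] this[of "axis 2 1"] this[of "axis 3 1"] show ?thesis
      by (simp add: mink_def vec3_eq_iff axis_def)
  qed
  then obtain B where B: "B ** A = mat 1"
    using matrix_left_invertible_ker by blast
  then have B': "A ** B = mat 1" using matrix_left_right_inverse by blast
  have AB: "A *v (B *v x) = x" for x by (simp add: matrix_vector_mul_assoc B')
  have 1: "mink (B *v x) (B *v y) = mink x y" for x y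
    using assms AB unfolding lorentz_def by metis
  have 2: "det3 (B *v x) (B *v y) (B *v z) = det3 x y z" for x y z
    using assms AB unfolding lorentz_def by metis
  have "(B *v origin) $ 3 > 0"
  proof -
    have o: "mink origin origin = - 1" by (simp add: mink_def)
    then have bb: "mink (B *v origin) (B *v origin) = - 1" using 1 by simp
    then have "(B *v origin) $ 3 \<noteq> 0" by (auto simp: mink_def) (smt (verit) zero_le_square)
    moreover have "\<not> (B *v origin) $ 3 < 0"
    proof
      assume "(B *v origin) $ 3 < 0"
      then have "future (- (B *v origin))" using bb by (simp add: future_def)
      then have "future (A *v (- (B *v origin)))" using assms by (simp add: lorentz_def)
      moreover have "A *v (- (B *v origin)) = - origin"
        using AB linear_neg[OF matrix_vector_mul_linear, of A] by simp
      ultimately show False by (simp add: future_def)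
    qed
    ultimately show ?thesis by linarith
  qed
  then have "lorentz B" using lorentzI 1 2 by blast
  then show thesis using that B B' by blast
qed

lemma det3_matrix:
  fixes A :: "real^3^3"
  shows "det3 (A *v x) (A *v y) (A *v z) = det A * det3 x y z"
proof -
  have rows: "det3 x y z = det (vector [x, y, z])" for x y z
    by (simp add: det3_def det_3 algebra_simps)
  have "vector [A *v x, A *v y, A *v z] = (vector [x, y, z] :: real^3^3) ** transpose A"
    by (simp add: vec_eq_iff forall_3 matrix_vector_mult_def matrix_matrix_mult_def transpose_def sum_3 mult.commute)
  then show ?thesis unfolding rows by (simp add: det_mul)
qed

subsection \<open>Points\<close>

lemma cone_vec_nth [simp]: "cone_vec a $ 1 = 2 * Re a" "cone_vec a $ 2 = 2 * Im a" "cone_vec a $ 3 = 1 + (norm a)\<^sup>2"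
  by (simp_all add: cone_vec_def)

lemma mink_cone_vec: "mink (cone_vec a) (cone_vec b) = 4 * (Re a * Re b + Im a * Im b) - (1 + (norm a)\<^sup>2) * (1 + (norm b)\<^sup>2)"
  by (simp add: mink_def algebra_simps)

lemma disc_pos: "z \<in> hyp_plane \<Longrightarrow> 0 < 1 - (norm z)\<^sup>2"
  by (simp add: hyp_plane_def abs_square_less_1)

lemma hpt_unit:
  assumes "z \<in> hyp_plane"
  shows "mink (hpt z) (hpt z) = - 1" "hpt z $ 3 > 0"
proof -
  define m where "m = 1 - (norm z)\<^sup>2"
  have "mink (cone_vec z) (cone_vec z) = - (m * m)"
    unfolding mink_cone_vec cmod_power2 m_def by (simp add: power2_eq_square algebra_simps)
  moreover have "hpt z = (1 / m) *\<^sub>R cone_vec z" by (simp add: hpt_def m_def)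
  moreover have "m > 0" using disc_pos[OF assms] by (simp add: m_def)
  ultimately show "mink (hpt z) (hpt z) = - 1" by simp
  show "hpt z $ 3 > 0" using disc_pos[OF assms] by (simp add: hpt_def add_pos_nonneg)
qed

lemma future_causal_center:
  assumes "future x"
  obtains a k where "k > 0" "norm a \<le> 1" "x = k *\<^sub>R cone_vec a" "mink x x < 0 \<Longrightarrow> norm a < 1" "mink x x = 0 \<Longrightarrow> norm a = 1"
proof -
  define h where "h = sqrt (- mink x x)"
  have x3: "x $ 3 > 0" and h: "h \<ge> 0" "h\<^sup>2 = - mink x x"
    using assms by (auto simp: future_def h_def)
  define w where "w = x $ 3 + h"
  have w: "w > 0" using x3 h by (simp add: w_def)
  define a where "a = Complex (x $ 1 / w) (x $ 2 / w)"
  have n: "(norm a)\<^sup>2 = ((x $ 3)\<^sup>2 - h\<^sup>2) / w\<^sup>2"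
  proof -
    have "(norm a)\<^sup>2 = ((x $ 1)\<^sup>2 + (x $ 2)\<^sup>2) / w\<^sup>2"
      by (simp add: a_def cmod_power2 power_divide add_divide_distrib)
    then show ?thesis using h(2) by (simp add: mink_def power2_eq_square)
  qed
  also have "(x $ 3)\<^sup>2 - h\<^sup>2 = (x $ 3 - h) * w" by (simp add: w_def algebra_simps power2_eq_square)
  finally have n: "(norm a)\<^sup>2 = (x $ 3 - h) / w" using w by (simp add: power2_eq_square)
  have n1: "1 + (norm a)\<^sup>2 = 2 * x $ 3 / w" "1 - (norm a)\<^sup>2 = 2 * h / w"
    unfolding n using w by (simp_all add: w_def field_simps)
  show thesis
  proof (rule that[of "w / 2" a])
    show "x = (w / 2) *\<^sub>R cone_vec a"
      using w n1(1) by (simp add: vec3_eq_iff a_def)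
    have "0 \<le> 1 - (norm a)\<^sup>2" using n1(2) w h by simp
    then show "norm a \<le> 1" by (simp add: abs_square_le_1)
    show "norm a < 1" if "mink x x < 0"
    proof -
      have "h > 0" using that by (simp add: h_def)
      then have "0 < 1 - (norm a)\<^sup>2" using n1(2) w by simp
      then show ?thesis by (simp add: abs_square_less_1)
    qed
    show "norm a = 1" if "mink x x = 0"
    proof -
      have "(norm a)\<^sup>2 = 1" using n1(2) that by (simp add: h_def)
      then show ?thesis using norm_ge_zero[of a] by (simp only: power2_eq_1_iff) linarith
    qed
  qed (use w in auto)
qed

lemma hpt_surj:
  assumes "mink p p = - 1" "p $ 3 > 0"
  obtains z where "z \<in> hyp_plane" "hpt z = p"
proof -
  have "future p" using assms by (simp add: future_def)
  then obtain a k where a: "k > 0" "p = k *\<^sub>R cone_vec a" "norm a < 1"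
    by (rule future_causal_center) (use assms(1) in auto)
  then have z: "a \<in> hyp_plane" by (simp add: hyp_plane_def)
  have "p = (k * (1 - (norm a)\<^sup>2)) *\<^sub>R hpt a" using disc_pos[OF z] by (simp add: hpt_def a)
  then have "(k * (1 - (norm a)\<^sup>2))\<^sup>2 = 1"
    using assms(1) hpt_unit(1)[OF z] by (simp add: power2_eq_square)
  then have "k * (1 - (norm a)\<^sup>2) = 1"
    using disc_pos[OF z] a(1) by (simp add: power2_eq_1_iff) (smt (verit) mult_pos_pos)
  then show thesis using that[OF z] \<open>p = _ *\<^sub>R hpt a\<close> by simp
qed

lemma hpt_inj:
  assumes "z \<in> hyp_plane" "w \<in> hyp_plane" "hpt z = hpt w"
  shows "z = w"
proof -
  have *: "1 + hpt z $ 3 = 2 / (1 - (norm z)\<^sup>2)" if "z \<in> hyp_plane" for z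
    using disc_pos[OF that] by (simp add: hpt_def field_simps)
  have "1 - (norm z)\<^sup>2 = 1 - (norm w)\<^sup>2"
    using *[OF assms(1)] *[OF assms(2)] disc_pos[OF assms(1)] disc_pos[OF assms(2)] assms(3) by simp
  then show ?thesis
    using assms(3) disc_pos[OF assms(1)] unfolding hpt_def vec3_eq_iff by (simp add: complex_eq_iff)
qed

lemma mink_hpt_dist:
  assumes "a \<in> hyp_plane" "z \<in> hyp_plane"
  shows "- mink (hpt a) (hpt z) = 1 + 2 * (norm (a - z))\<^sup>2 / ((1 - (norm a)\<^sup>2) * (1 - (norm z)\<^sup>2))"
proof -
  define m n where "m = 1 - (norm a)\<^sup>2" and "n = 1 - (norm z)\<^sup>2"
  have "mink (cone_vec a) (cone_vec z) = - (m * n + 2 * (norm (a - z))\<^sup>2)"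
    unfolding mink_cone_vec cmod_power2 m_def n_def by (simp add: power2_eq_square algebra_simps)
  moreover have "hpt a = (1 / m) *\<^sub>R cone_vec a" "hpt z = (1 / n) *\<^sub>R cone_vec z"
    by (simp_all add: hpt_def m_def n_def)
  moreover have "m > 0" "n > 0" using disc_pos assms by (auto simp: m_def n_def)
  ultimately show ?thesis
    unfolding m_def[symmetric] n_def[symmetric] by (simp add: field_simps)
qed

lemma hyp_dist_eq_iff:
  assumes "a \<in> hyp_plane" "z \<in> hyp_plane" "\<rho> \<ge> 0"
  shows "hyp_dist a z = \<rho> \<longleftrightarrow> mink (hpt a) (hpt z) = - cosh \<rho>"
proof -
  have d: "hyp_dist a z = arcosh (- mink (hpt a) (hpt z))"
    using mink_hpt_dist[OF assms(1,2)] by (simp add: hyp_dist_def)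
  have "1 \<le> - mink (hpt a) (hpt z)"
    using mink_hpt_dist[OF assms(1,2)] disc_pos[OF assms(1)] disc_pos[OF assms(2)] by simp
  then have "cosh (arcosh (- mink (hpt a) (hpt z))) = - mink (hpt a) (hpt z)" by (rule cosh_arcosh_real)
  then show ?thesis unfolding d using assms(3) by (auto simp: arcosh_cosh_real)
qed

subsection \<open>Directions and angles\<close>

text \<open>
  Clearing the denominators \<open>1 - cnj z * a\<close> and \<open>1 - cnj z * b\<close> only changes the product by a positive
  factor. This gives a polynomial, which can be compared with the hyperboloid model.
\<close>

lemma hyp_dir_product:
  fixes z a b :: complex
  defines "W \<equiv> cnj (a - z) * (1 - cnj z * a) * ((b - z) * cnj (1 - cnj z * b))"
  assumes z: "z \<in> hyp_plane" and a: "norm a \<le> 1" and b: "norm b \<le> 1"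
  obtains \<kappa> where "\<kappa> > 0" "cnj (hyp_dir z a) * hyp_dir z b = of_real \<kappa> * W"
proof -
  have nz: "1 - cnj z * a \<noteq> 0" if "norm a \<le> 1" for a
  proof
    assume "1 - cnj z * a = 0"
    then have "norm (cnj z * a) = 1" by (metis eq_iff_diff_eq_0 norm_one)
    moreover have "norm (cnj z * a) \<le> norm z"
      using that by (simp add: norm_mult mult_left_le)
    ultimately show False using z by (simp add: hyp_plane_def)
  qed
  define N where "N = (norm (1 - cnj z * a))\<^sup>2 * (norm (1 - cnj z * b))\<^sup>2"
  have N: "N > 0" using nz[OF a] nz[OF b] by (simp add: N_def)
  have "cnj (hyp_dir z a) * hyp_dir z b = W / of_real N"
  proof -
    have *: "cnj (x / u) * (y / v) = cnj x * u * (y * cnj v) / of_real ((norm u)\<^sup>2 * (norm v)\<^sup>2)"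
      if "u \<noteq> 0" "v \<noteq> 0" for x y u v :: complex
      unfolding of_real_mult complex_norm_square using that by (simp add: field_simps)
    show ?thesis unfolding hyp_dir_def *[OF nz[OF a] nz[OF b]] W_def N_def ..
  qed
  then show thesis using that[of "1 / N"] N by simp
qed

text \<open>
  The projections of \<open>C\<close> and \<open>C'\<close> to the tangent plane at \<open>hpt z\<close> point to the two centres. The real and
  the imaginary part are their scalar product and their signed area.
\<close>

lemma hyp_dir_mink:
  assumes z: "z \<in> hyp_plane" and "k > 0" "norm a \<le> 1" "C = k *\<^sub>R cone_vec a"
    and "k' > 0" "norm b \<le> 1" "C' = k' *\<^sub>R cone_vec b"
  obtains \<kappa> where "\<kappa> > 0"
    "Re (cnj (hyp_dir z a) * hyp_dir z b) = \<kappa> * (mink C C' + mink C (hpt z) * mink C' (hpt z))"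
    "Im (cnj (hyp_dir z a) * hyp_dir z b) = \<kappa> * det3 C C' (hpt z)"
proof -
  define W where "W = cnj (a - z) * (1 - cnj z * a) * ((b - z) * cnj (1 - cnj z * b))"
  obtain \<kappa> where \<kappa>: "\<kappa> > 0" "cnj (hyp_dir z a) * hyp_dir z b = of_real \<kappa> * W"
    using hyp_dir_product[OF z assms(3,6)] by (auto simp: W_def)
  define m where "m = 1 - (norm z)\<^sup>2"
  have m: "m > 0" using disc_pos[OF z] by (simp add: m_def)
  have hpt: "hpt z = (1 / m) *\<^sub>R cone_vec z" by (simp add: hpt_def m_def)
  obtain a1 a2 b1 b2 z1 z2 where ab: "a = Complex a1 a2" "b = Complex b1 b2" "z = Complex z1 z2"
    by (metis complex_surj)
  have 1: "mink (cone_vec a) (cone_vec b) * m\<^sup>2 + mink (cone_vec a) (cone_vec z) * mink (cone_vec b) (cone_vec z) = 4 * Re W"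
    unfolding mink_cone_vec m_def W_def cmod_power2 ab by (simp add: power2_eq_square algebra_simps)
  have 2: "det3 (cone_vec a) (cone_vec b) (cone_vec z) * m = 4 * Im W"
    unfolding det3_def cone_vec_nth m_def W_def cmod_power2 ab by (simp add: power2_eq_square algebra_simps)
  have "mink C C' + mink C (hpt z) * mink C' (hpt z) = k * k' / m\<^sup>2 * (4 * Re W)"
    unfolding 1[symmetric] assms(4,7) hpt using m by (simp add: field_simps power2_eq_square)
  moreover have "det3 C C' (hpt z) = k * k' / m\<^sup>2 * (4 * Im W)"
    unfolding 2[symmetric] assms(4,7) hpt using m by (simp add: field_simps power2_eq_square)
  ultimately have W: "Re W = m\<^sup>2 / (4 * k * k') * (mink C C' + mink C (hpt z) * mink C' (hpt z))"
    "Im W = m\<^sup>2 / (4 * k * k') * det3 C C' (hpt z)"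
    using m \<open>k > 0\<close> \<open>k' > 0\<close> by simp_all
  show thesis
  proof (rule that)
    show "0 < \<kappa> * (m\<^sup>2 / (4 * k * k'))" using \<kappa>(1) m \<open>k > 0\<close> \<open>k' > 0\<close> by simp
  qed (simp_all only: \<kappa>(2) W Re_complex_of_real Im_complex_of_real times_complex.sel mult.assoc mult_zero_left
      diff_0_right add_0_right)
qed

subsection \<open>Isometries of the disc\<close>

text \<open>
  The translation along the geodesic through the centre of the disc that moves the centre to \<open>b\<close>.
\<close>

definition translation :: "complex \<Rightarrow> real^3^3" where
  "translation b = (1 / (1 - (norm b)\<^sup>2)) *\<^sub>R vector [
     vec3 (1 + (Re b)\<^sup>2 - (Im b)\<^sup>2) (2 * Re b * Im b) (2 * Re b),
     vec3 (2 * Re b * Im b) (1 - (Re b)\<^sup>2 + (Im b)\<^sup>2) (2 * Im b),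
     vec3 (2 * Re b) (2 * Im b) (1 + (norm b)\<^sup>2)]"

definition rotation :: "real \<Rightarrow> real^3^3" where
  "rotation t = vector [vec3 (cos t) (- sin t) 0, vec3 (sin t) (cos t) 0, vec3 0 0 1]"

lemma translation_mult:
  "translation b *v x = (1 / (1 - (norm b)\<^sup>2)) *\<^sub>R vec3
     ((1 + (Re b)\<^sup>2 - (Im b)\<^sup>2) * x $ 1 + 2 * Re b * Im b * x $ 2 + 2 * Re b * x $ 3)
     (2 * Re b * Im b * x $ 1 + (1 - (Re b)\<^sup>2 + (Im b)\<^sup>2) * x $ 2 + 2 * Im b * x $ 3)
     (2 * Re b * x $ 1 + 2 * Im b * x $ 2 + (1 + (norm b)\<^sup>2) * x $ 3)"
  unfolding translation_def scaleR_matrix_vector_assoc[symmetric]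
  by (rule arg_cong[where f = "\<lambda>x. k *\<^sub>R x" for k]) (simp add: vec3_eq_iff matrix_vector_mult_def sum_3)

lemma rotation_mult:
  "rotation t *v x = vec3 (cos t * x $ 1 - sin t * x $ 2) (sin t * x $ 1 + cos t * x $ 2) (x $ 3)"
  by (simp add: rotation_def vec3_eq_iff matrix_vector_mult_def sum_3)

lemma det_scale3: "det (k *\<^sub>R A :: real^3^3) = k ^ 3 * det A"
  by (simp add: det_3 power3_eq_cube algebra_simps)

lemma lorentz_translation:
  assumes "b \<in> hyp_plane"
  shows "lorentz (translation b)"
proof (rule lorentzI)
  define m where "m = 1 - (norm b)\<^sup>2"
  have m: "m > 0" using disc_pos[OF assms] by (simp add: m_def)
  have n: "(norm b)\<^sup>2 = (Re b)\<^sup>2 + (Im b)\<^sup>2" by (simp add: cmod_power2)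
  define p q where "p = Re b" and "q = Im b"
  have mm: "m = 1 - p * p - q * q"
    unfolding m_def n p_def q_def by (simp add: power2_eq_square)
  note t = translation_mult[of b, folded m_def p_def q_def, unfolded n, folded p_def q_def]
  show "mink (translation b *v x) (translation b *v y) = mink x y" for x y
  proof -
    have "mink (m *\<^sub>R (translation b *v x)) (m *\<^sub>R (translation b *v y)) = m * m * mink x y"
      using m unfolding t by (simp add: mink_def mm power2_eq_square algebra_simps)
    then show ?thesis using m by simp
  qed
  have "m * m * m * det (translation b) = m * m * m"
  proof -
    have "det (vector [vec3 (1 + p\<^sup>2 - q\<^sup>2) (2 * p * q) (2 * p), vec3 (2 * p * q) (1 - p\<^sup>2 + q\<^sup>2) (2 * q),
        vec3 (2 * p) (2 * q) (1 + (p\<^sup>2 + q\<^sup>2))] :: real^3^3) = m * m * m"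
      unfolding det_3 by (simp add: mm power2_eq_square algebra_simps)
    moreover have "translation b = (1 / m) *\<^sub>R vector [vec3 (1 + p\<^sup>2 - q\<^sup>2) (2 * p * q) (2 * p),
        vec3 (2 * p * q) (1 - p\<^sup>2 + q\<^sup>2) (2 * q), vec3 (2 * p) (2 * q) (1 + (p\<^sup>2 + q\<^sup>2))]"
      unfolding translation_def m_def n p_def q_def ..
    ultimately show ?thesis using m by (simp add: det_scale3 power3_eq_cube)
  qed
  then have "det (translation b) = 1" using m by simp
  then show "det3 (translation b *v x) (translation b *v y) (translation b *v z) = det3 x y z" for x y z
    by (simp add: det3_matrix)
  show "(translation b *v origin) $ 3 > 0"
    using m unfolding translation_mult m_def[symmetric] by (simp add: add_pos_nonneg)
qed

lemma translation_origin: "translation b *v origin = hpt b"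
  unfolding translation_mult hpt_def cone_vec_def by simp

lemma lorentz_fixing_origin:
  assumes B: "lorentz B" "B *v origin = origin"
  obtains t where "B = rotation t"
proof -
  let ?e1 = "vec3 1 0 0" and ?e2 = "vec3 0 1 0"
  define u v where "u = B *v ?e1" and "v = B *v ?e2"
  have pres: "mink (B *v x) (B *v y) = mink x y" "det3 (B *v x) (B *v y) (B *v z) = det3 x y z" for x y z
    using B(1) by (auto simp: lorentz_def)
  have "mink u origin = 0" "mink v origin = 0" "mink u u = 1" "mink v v = 1" "mink u v = 0" "det3 u v origin = 1"
    using pres(1)[of ?e1 origin] pres(1)[of ?e2 origin] pres(1)[of ?e1 ?e1] pres(1)[of ?e2 ?e2]
      pres(1)[of ?e1 ?e2] pres(2)[of ?e1 ?e2 origin]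
    unfolding u_def v_def B(2) by (auto simp: mink_def det3_def)
  then have uv: "u $ 3 = 0" "v $ 3 = 0" "u $ 1 * u $ 1 + u $ 2 * u $ 2 = 1"
    "u $ 1 * v $ 1 + u $ 2 * v $ 2 = 0" "u $ 1 * v $ 2 - u $ 2 * v $ 1 = 1"
    by (auto simp: mink_def det3_def)
  have v: "v $ 1 = - (u $ 2)" "v $ 2 = u $ 1" using uv(3-5) by algebra+
  obtain t where t: "u $ 1 = cos t" "u $ 2 = sin t"
    using sincos_total_2pi_le[of "u $ 1" "u $ 2"] uv(3) by (auto simp: power2_eq_square)
  have "B *v x = rotation t *v x" for x
  proof -
    have "x = x $ 1 *\<^sub>R ?e1 + x $ 2 *\<^sub>R ?e2 + x $ 3 *\<^sub>R origin" by (simp add: vec3_eq_iff)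
    then have "B *v x = B *v (x $ 1 *\<^sub>R ?e1 + x $ 2 *\<^sub>R ?e2 + x $ 3 *\<^sub>R origin)" by (rule arg_cong)
    also have "\<dots> = x $ 1 *\<^sub>R u + x $ 2 *\<^sub>R v + x $ 3 *\<^sub>R origin"
      by (simp add: matrix_vector_right_distrib u_def v_def B(2) linear_scale[OF matrix_vector_mul_linear[of B]])
    finally show ?thesis by (simp add: rotation_mult vec3_eq_iff uv v t)
  qed
  then have "B = rotation t" by (simp add: matrix_eq)
  then show thesis using that by blast
qed

text \<open>
  After a translation that moves the image of the centre back, only a rotation about the centre remains.
  So the matrix acts on the disc as a rotation followed by a translation, a Moebius transformation.
\<close>

lemma lorentz_isometry:
  assumes A: "lorentz A"
  obtains f where "hyp_isometry f" "\<And>z. z \<in> hyp_plane \<Longrightarrow> f z \<in> hyp_plane" "\<And>z. z \<in> hyp_plane \<Longrightarrow> hpt (f z) = A *v hpt z"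
proof -
  have "mink origin origin = - 1" "future origin" by (auto simp: mink_def future_def)
  then have "mink (A *v origin) (A *v origin) = - 1" "(A *v origin) $ 3 > 0"
    using A by (auto simp: lorentz_def future_def)
  then obtain b where b: "b \<in> hyp_plane" "hpt b = A *v origin" using hpt_surj by blast
  obtain L where L: "lorentz L" "translation b ** L = mat 1" "L ** translation b = mat 1"
    using lorentz_inverse[OF lorentz_translation[OF b(1)]] by blast
  have "L *v (A *v origin) = L *v (translation b *v origin)" by (simp only: b(2) translation_origin)
  then have "(L ** A) *v origin = origin" by (simp add: matrix_vector_mul_assoc L(3))
  then obtain t where t: "L ** A = rotation t"
    using lorentz_fixing_origin lorentz_mult[OF L(1) A] by blast
  have A_eq: "A = translation b ** rotation t"
    unfolding t[symmetric] matrix_mul_assoc L(2) by simp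
  define u where "u = cis t"
  have u: "norm u = 1" "u * cnj u = 1" by (auto simp: u_def cis_cnj cis_mult)
  define f where "f z = (u * z + b) / (1 + cnj b * (u * z))" for z
  have f: "f z \<in> hyp_plane \<and> hpt (f z) = A *v hpt z" if z: "z \<in> hyp_plane" for z
  proof -
    define w where "w = u * z"
    have w: "norm w = norm z" using u by (simp add: w_def norm_mult)
    have rot: "rotation t *v hpt z = hpt w"
      by (simp add: rotation_mult hpt_def vec3_eq_iff w) (simp add: w_def u_def algebra_simps diff_divide_distrib add_divide_distrib)
    define d where "d = 1 + cnj b * w"
    have "norm (cnj b * w) < 1"
      using b(1) z w mult_strict_mono[of "norm b" 1 "norm z" 1] by (simp add: norm_mult hyp_plane_def)
    then have d: "d \<noteq> 0" unfolding d_def by (metis add_eq_0_iff norm_minus_cancel norm_one order_less_irrefl)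
    have fz: "f z = (w + b) / d" by (simp add: f_def d_def w_def)
    define m n k where "m = 1 - (norm b)\<^sup>2" and "n = 1 - (norm z)\<^sup>2" and "k = (norm d)\<^sup>2"
    have pos: "m > 0" "n > 0" "k > 0" using disc_pos[OF b(1)] disc_pos[OF z] d by (auto simp: m_def n_def k_def)
    have key: "k - (norm (w + b))\<^sup>2 = m * n"
      unfolding k_def m_def n_def w[symmetric] d_def cmod_power2 by (simp add: power2_eq_square algebra_simps)
    have nf: "(norm (f z))\<^sup>2 = (norm (w + b))\<^sup>2 / k" by (simp add: fz norm_divide power_divide k_def)
    have one: "1 - (norm (f z))\<^sup>2 = m * n / k" unfolding nf key[symmetric] using pos by (simp add: field_simps)
    then have "0 < 1 - (norm (f z))\<^sup>2" using pos by simp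
    then have disc: "f z \<in> hyp_plane" by (simp add: hyp_plane_def abs_square_less_1)
    have fz': "f z = ((w + b) * cnj d) / of_real k"
      unfolding fz k_def complex_norm_square using d by (simp add: field_simps)
    have re: "Re (f z) = Re ((w + b) * cnj d) / k" "Im (f z) = Im ((w + b) * cnj d) / k"
      unfolding fz' by simp_all
    have "hpt (f z) = (1 / (m * n)) *\<^sub>R vec3 (2 * Re ((w + b) * cnj d)) (2 * Im ((w + b) * cnj d)) (k + (norm (w + b))\<^sup>2)"
      unfolding hpt_def one using pos by (simp add: vec3_eq_iff re nf field_simps)
    also have "\<dots> = translation b *v hpt w"
    proof -
      have "translation b *v cone_vec w = (1 / m) *\<^sub>R vec3 (2 * Re ((w + b) * cnj d)) (2 * Im ((w + b) * cnj d)) (k + (norm (w + b))\<^sup>2)"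
        unfolding translation_mult m_def[symmetric]
        unfolding cone_vec_nth k_def d_def cmod_power2
        by (intro arg_cong[where f = "\<lambda>x. (1 / m) *\<^sub>R x"]) (simp add: vec3_eq_iff power2_eq_square algebra_simps)
      moreover have "hpt w = (1 / n) *\<^sub>R cone_vec w" by (simp add: hpt_def n_def w)
      ultimately show ?thesis by (simp add: linear_scale[OF matrix_vector_mul_linear] mult.commute)
    qed
    also have "\<dots> = A *v hpt z" by (simp add: A_eq rot flip: matrix_vector_mul_assoc)
    finally show ?thesis using disc by blast
  qed
  have "hyp_isometry f"
  proof -
    have "f = (\<lambda>z. u * (z - (- (cnj u * b))) / (1 - cnj (- (cnj u * b)) * z))"
    proof
      fix z
      have "u * (cnj u * b) = b" by (simp add: u(2) flip: mult.assoc)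
      then show "f z = u * (z - (- (cnj u * b))) / (1 - cnj (- (cnj u * b)) * z)"
        by (simp add: f_def distrib_left mult_ac)
    qed
    moreover have "norm (- (cnj u * b)) < 1" using u(1) b(1) by (simp add: norm_mult hyp_plane_def)
    ultimately show ?thesis unfolding hyp_isometry_def using u(1) by blast
  qed
  then show thesis using that f by blast
qed

section \<open>Frames and the transition across a square\<close>

text \<open>
  A unit space-like vector \<open>v\<close> orthogonal to a point \<open>w\<close> is completed to a positively oriented
  orthonormal frame; the first column is the Lorentzian cross product.
\<close>

definition mcross :: "real^3 \<Rightarrow> real^3 \<Rightarrow> real^3" where
  "mcross v w = vec3 (v $ 2 * w $ 3 - v $ 3 * w $ 2) (v $ 3 * w $ 1 - v $ 1 * w $ 3) (v $ 2 * w $ 1 - v $ 1 * w $ 2)"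

definition frame :: "real^3 \<Rightarrow> real^3 \<Rightarrow> real^3^3" where
  "frame v w = transpose (vector [mcross v w, v, w])"

lemma frame_mult: "frame v w *v x = x $ 1 *\<^sub>R mcross v w + x $ 2 *\<^sub>R v + x $ 3 *\<^sub>R w"
  by (simp add: frame_def matrix_vector_mult_def transpose_def vec3_eq_iff sum_3 mult.commute)

lemma mink_mcross: "mink (mcross v w) z = det3 z v w"
  by (simp add: mcross_def mink_def det3_def algebra_simps)

lemma mink_mcross_mcross:
  "mink (mcross v w) (mcross v w) = (mink v w)\<^sup>2 - mink v v * mink w w"
  by (simp add: mcross_def mink_def algebra_simps power2_eq_square)

lemma det3_frame_columns: "det3 (mcross v w) v w = (mink v w)\<^sup>2 - mink v v * mink w w"
  by (simp add: mcross_def mink_def det3_def algebra_simps power2_eq_square)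

lemma lorentz_frame:
  assumes "mink v v = 1" "mink w w = - 1" "mink v w = 0" "w $ 3 > 0"
  shows "lorentz (frame v w)"
proof (rule lorentzI)
  have u: "mink (mcross v w) (mcross v w) = 1" "mink (mcross v w) v = 0" "mink (mcross v w) w = 0"
    using assms by (simp_all add: mink_mcross_mcross) (simp_all add: mink_mcross det3_def algebra_simps)
  show "mink (frame v w *v x) (frame v w *v y) = mink x y" for x y
    unfolding frame_mult using assms u
    by (simp add: mink_commute[of v "mcross v w"] mink_commute[of w "mcross v w"] mink_commute[of w v])
      (simp add: mink_def)
  have "det (frame v w) = det3 (mcross v w) v w"
    by (simp add: frame_def det_transpose) (simp add: det3_def det_3 algebra_simps)
  then have "det (frame v w) = 1" using assms by (simp add: det3_frame_columns)
  then show "det3 (frame v w *v x) (frame v w *v y) (frame v w *v z) = det3 x y z" for x y z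
    by (simp add: det3_matrix)
  show "(frame v w *v origin) $ 3 > 0" using assms by (simp add: frame_mult)
qed

lemma mink_eqI: "(\<And>z. mink x z = mink y z) \<Longrightarrow> x = y"
proof -
  assume "\<And>z. mink x z = mink y z"
  from this[of "vec3 1 0 0"] this[of "vec3 0 1 0"] this[of origin] show ?thesis
    by (simp add: mink_def vec3_eq_iff)
qed

lemma lorentz_mcross:
  assumes A: "lorentz A"
  shows "A *v mcross v w = mcross (A *v v) (A *v w)"
proof -
  obtain B where B: "A ** B = mat 1" using lorentz_inverse[OF A] by blast
  have "mink (A *v mcross v w) z = mink (mcross (A *v v) (A *v w)) z" for z
  proof -
    have z: "z = A *v (B *v z)" by (simp add: matrix_vector_mul_assoc B)
    have "mink (A *v mcross v w) (A *v (B *v z)) = det3 (B *v z) v w"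
      using A by (simp add: lorentz_def mink_mcross)
    also have "\<dots> = det3 (A *v (B *v z)) (A *v v) (A *v w)" using A by (simp add: lorentz_def)
    finally show ?thesis using z by (simp add: mink_mcross)
  qed
  then show ?thesis by (rule mink_eqI)
qed

lemma lorentz_frame_mult:
  assumes "lorentz A"
  shows "A ** frame v w = frame (A *v v) (A *v w)"
proof -
  have "(A ** frame v w) *v x = frame (A *v v) (A *v w) *v x" for x
    unfolding matrix_vector_mul_assoc[symmetric] frame_mult
    by (simp add: matrix_vector_right_distrib linear_scale[OF matrix_vector_mul_linear[of A]] lorentz_mcross[OF assms])
  then show ?thesis by (simp add: matrix_eq)
qed

lemma frame_columns: "frame v w *v vec3 0 1 0 = v" "frame v w *v origin = w"
  by (simp_all add: frame_mult)

lemma lorentz_eqI: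
  assumes "lorentz A" "lorentz B" "A *v vec3 0 1 0 = B *v vec3 0 1 0" "A *v origin = B *v origin"
  shows "A = B"
proof -
  have "frame (vec3 0 1 0) origin = mat 1"
    by (simp add: frame_def mcross_def vec_eq_iff forall_3 transpose_def mat_def)
  then show ?thesis
    using lorentz_frame_mult[OF assms(1), of "vec3 0 1 0" origin] lorentz_frame_mult[OF assms(2), of "vec3 0 1 0" origin] assms(3,4)
    by simp
qed

text \<open>
  At a vertex \<open>x\<close> of \<open>G\<^sup>*\<close> with a frame whose second vector points north, the ring vectors of the
  neighbours have fixed coordinates: those of \<open>v\<close> for \<open>x = v + (\<sigma>, 0)\<close> and for \<open>x = v + (0, \<tau>)\<close>.
  A negative radius simply puts the centre on the other side of \<open>x\<close>.
\<close>

definition pos_h :: "real \<Rightarrow> real \<Rightarrow> real \<Rightarrow> real^3" where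
  "pos_h q \<sigma> a = vec3 (- \<sigma> * q * jacobi_cn q a) 0 q"

definition pos_v :: "real \<Rightarrow> real \<Rightarrow> real \<Rightarrow> real^3" where
  "pos_v q \<tau> a = vec3 0 (- \<tau> * jacobi_dn q a) 1"

text \<open>
  Consider a square with corners \<open>v\<close>, \<open>x = v + (\<sigma>, 0)\<close>, \<open>y = v + (0, \<tau>)\<close>, \<open>w = v + (\<sigma>, \<tau>)\<close>, and variables \<open>a\<close> at \<open>v\<close>
  and \<open>b\<close> at \<open>w\<close>. The transition matrix has the frame of \<open>y\<close>, in coordinates with respect to the frame
  of \<open>x\<close>, as its columns. The point \<open>y\<close> is found by solving the incidence conditions, see \<open>square_rigid\<close>,
  and the north vector at \<open>y\<close> is then fixed by the position of \<open>v\<close> south or north of \<open>y\<close>.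
\<close>

definition step_north :: "real \<Rightarrow> real \<Rightarrow> real \<Rightarrow> real \<Rightarrow> real \<Rightarrow> real^3" where
  "step_north q \<sigma> \<tau> a b = vec3 (- \<sigma> * \<tau> * cos (theta q b a)) (weight q a b / (q * add_denom q a b))
     (\<tau> * jacobi_dn q b * weight q a b / (q * add_denom q a b))"

definition step_point :: "real \<Rightarrow> real \<Rightarrow> real \<Rightarrow> real \<Rightarrow> real \<Rightarrow> real^3" where
  "step_point q \<sigma> \<tau> a b = vec3 (- \<sigma> * jacobi_cn q b * weight q a b / add_denom q a b)
     (\<tau> * jacobi_dn q a * weight q a b / (q * add_denom q a b))
     (((q * jacobi_cn q a)\<^sup>2 + (jacobi_dn q b)\<^sup>2 + q * jacobi_cn q a * jacobi_cn q b * jacobi_dn q a * jacobi_dn q b) /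
       (q * add_denom q a b))"

definition transition :: "real \<Rightarrow> real \<Rightarrow> real \<Rightarrow> real \<Rightarrow> real \<Rightarrow> real^3^3" where
  "transition q \<sigma> \<tau> a b = frame (step_north q \<sigma> \<tau> a b) (step_point q \<sigma> \<tau> a b)"

text \<open>
  All of the following are polynomial identities in the values of \<open>sn\<close>, \<open>cn\<close>, \<open>dn\<close> at \<open>a\<close> and \<open>b\<close>, modulo the
  quadratic relations between them and \<open>\<sigma>\<^sup>2 = \<tau>\<^sup>2 = 1\<close>.
\<close>

context
  fixes q \<sigma> \<tau> a b s c d s' c' d' D P :: real
  assumes q: "0 < q" "q \<le> 1" and signs: "\<sigma>\<^sup>2 = 1" "\<tau>\<^sup>2 = 1"
  defines "s \<equiv> jacobi_sn q a" and "c \<equiv> jacobi_cn q a" and "d \<equiv> jacobi_dn q a"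
    and "s' \<equiv> jacobi_sn q b" and "c' \<equiv> jacobi_cn q b" and "d' \<equiv> jacobi_dn q b"
    and "D \<equiv> add_denom q a b" and "P \<equiv> weight q a b"
begin

lemma modulus_nonneg: "0 \<le> q" using q by simp

lemma corner_relations: "c\<^sup>2 = 1 - s\<^sup>2" "d\<^sup>2 = 1 - q\<^sup>2 * s\<^sup>2" "c'\<^sup>2 = 1 - s'\<^sup>2" "d'\<^sup>2 = 1 - q\<^sup>2 * s'\<^sup>2"
  unfolding s_def c_def d_def s'_def c'_def d'_def using jacobi_relations[OF modulus_nonneg q(2)] by blast+

lemma corner_denom: "D > 0" "D = 1 - q\<^sup>2 * s\<^sup>2 * s'\<^sup>2" and corner_weight: "P > 0" "P = d * d' + q * c * c'"
  using add_denom_pos[OF modulus_nonneg q(2)] weight_pos[OF modulus_nonneg q(2)]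
  by (auto simp: D_def P_def s_def s'_def c_def c'_def d_def d'_def add_denom_def weight_def)

lemmas corner_rewrites = corner_relations[THEN square_rewrites(1)] corner_relations[THEN square_rewrites(2)]
  signs[THEN square_rewrites(1)] signs[THEN square_rewrites(2)]

lemma step_north_eq: "step_north q \<sigma> \<tau> a b = (1 / (q * D)) *\<^sub>R
    vec3 (- \<sigma> * \<tau> * q * (c' * d' - q * s'\<^sup>2 * c * d)) P (\<tau> * d' * P)"
  using q corner_denom(1) unfolding step_north_def cos_theta[OF modulus_nonneg q(2)]
  by (simp add: vec3_eq_iff add_denom_commute[of q b a] flip: c_def d_def s'_def c'_def d'_def D_def P_def)

lemma step_point_eq: "step_point q \<sigma> \<tau> a b = (1 / (q * D)) *\<^sub>R
    vec3 (- \<sigma> * q * c' * P) (\<tau> * d * P) (q\<^sup>2 * c\<^sup>2 + d'\<^sup>2 + q * c * c' * d * d')"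
  using q corner_denom(1) unfolding step_point_def
  by (simp add: vec3_eq_iff power_mult_distrib flip: c_def d_def s'_def c'_def d'_def D_def P_def)

lemma lorentz_transition: "lorentz (transition q \<sigma> \<tau> a b)"
  unfolding transition_def
proof (rule lorentz_frame)
  have qD: "(q * D) * (q * D) \<noteq> 0" using q corner_denom by simp
  have "q\<^sup>2 * (c' * d' - q * s'\<^sup>2 * c * d)\<^sup>2 + P\<^sup>2 - d'\<^sup>2 * P\<^sup>2 = (q * D) * (q * D)"
    unfolding corner_denom(2) corner_weight(2) by (simp add: corner_rewrites power2_eq_square algebra_simps)
  then have "mink (vec3 (- \<sigma> * \<tau> * q * (c' * d' - q * s'\<^sup>2 * c * d)) P (\<tau> * d' * P))
      (vec3 (- \<sigma> * \<tau> * q * (c' * d' - q * s'\<^sup>2 * c * d)) P (\<tau> * d' * P)) = (q * D) * (q * D)"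
    by (simp add: mink_def power2_eq_square signs[THEN square_rewrites(1)] signs[THEN square_rewrites(2)] mult_ac)
  then show "mink (step_north q \<sigma> \<tau> a b) (step_north q \<sigma> \<tau> a b) = 1"
    unfolding step_north_eq using qD by simp
  have "q\<^sup>2 * c'\<^sup>2 * P\<^sup>2 + d\<^sup>2 * P\<^sup>2 - (q\<^sup>2 * c\<^sup>2 + d'\<^sup>2 + q * c * c' * d * d')\<^sup>2 = - ((q * D) * (q * D))"
    unfolding corner_denom(2) corner_weight(2) by (simp add: corner_rewrites power2_eq_square algebra_simps)
  then have "mink (vec3 (- \<sigma> * q * c' * P) (\<tau> * d * P) (q\<^sup>2 * c\<^sup>2 + d'\<^sup>2 + q * c * c' * d * d'))
      (vec3 (- \<sigma> * q * c' * P) (\<tau> * d * P) (q\<^sup>2 * c\<^sup>2 + d'\<^sup>2 + q * c * c' * d * d')) = - ((q * D) * (q * D))"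
    by (simp add: mink_def power2_eq_square signs[THEN square_rewrites(1)] signs[THEN square_rewrites(2)] mult_ac)
  then show "mink (step_point q \<sigma> \<tau> a b) (step_point q \<sigma> \<tau> a b) = - 1"
    unfolding step_point_eq using qD by simp
  have "mink (vec3 (- \<sigma> * \<tau> * q * (c' * d' - q * s'\<^sup>2 * c * d)) P (\<tau> * d' * P))
      (vec3 (- \<sigma> * q * c' * P) (\<tau> * d * P) (q\<^sup>2 * c\<^sup>2 + d'\<^sup>2 + q * c * c' * d * d')) = 0"
    unfolding corner_weight(2) by (simp add: mink_def corner_rewrites power2_eq_square algebra_simps)
  then show "mink (step_north q \<sigma> \<tau> a b) (step_point q \<sigma> \<tau> a b) = 0"
    unfolding step_north_eq step_point_eq by simp
  have "(q\<^sup>2 * c\<^sup>2 + d'\<^sup>2 + q * c * c' * d * d') - q\<^sup>2 * D = d * d' * P"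
    unfolding corner_denom(2) corner_weight(2) by (simp add: corner_rewrites power2_eq_square algebra_simps)
  moreover have "q\<^sup>2 * D > 0" "d * d' * P > 0"
    using q corner_denom(1) corner_weight(1) dn_positive[OF modulus_nonneg q(2)] by (simp_all add: d_def d'_def)
  ultimately have "q\<^sup>2 * c\<^sup>2 + d'\<^sup>2 + q * c * c' * d * d' > 0" by linarith
  then show "step_point q \<sigma> \<tau> a b $ 3 > 0" unfolding step_point_eq using q corner_denom(1) by simp
qed

lemma transition_east: "mcross (step_north q \<sigma> \<tau> a b) (step_point q \<sigma> \<tau> a b) =
    (1 / (q * D)) *\<^sub>R vec3 (q * P) (- \<sigma> * \<tau> * q * (c * d - q * s\<^sup>2 * c' * d')) (- \<sigma> * q * c * P)"
proof -
  have lin: "mcross (k *\<^sub>R v) (k *\<^sub>R w) = (k * k) *\<^sub>R mcross v w" for k v w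
    by (simp add: mcross_def vec3_eq_iff algebra_simps)
  have "mcross (vec3 (- \<sigma> * \<tau> * q * (c' * d' - q * s'\<^sup>2 * c * d)) P (\<tau> * d' * P))
      (vec3 (- \<sigma> * q * c' * P) (\<tau> * d * P) (q\<^sup>2 * c\<^sup>2 + d'\<^sup>2 + q * c * c' * d * d')) =
    (q * D) *\<^sub>R vec3 (q * P) (- \<sigma> * \<tau> * q * (c * d - q * s\<^sup>2 * c' * d')) (- \<sigma> * q * c * P)"
    unfolding mcross_def corner_denom(2) corner_weight(2) by (simp add: vec3_eq_iff corner_rewrites power2_eq_square algebra_simps)
  then show ?thesis unfolding step_north_eq step_point_eq lin using q corner_denom(1) by simp
qed

text \<open>
  The neighbour \<open>v\<close> is the same vector, seen from \<open>y\<close> and from \<open>x\<close>.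
\<close>

lemma transition_pos_v: "transition q \<sigma> \<tau> a b *v pos_v q \<tau> a = pos_h q \<sigma> a"
proof -
  have 1: "- \<sigma> * q * c' * P + \<sigma> * d * q * (c' * d' - q * s'\<^sup>2 * c * d) = q * D * (- \<sigma> * q * c)"
    unfolding corner_denom(2) corner_weight(2) by (simp add: corner_rewrites power2_eq_square algebra_simps)
  have 2: "q\<^sup>2 * c\<^sup>2 + d'\<^sup>2 + q * c * c' * d * d' - d * d' * P = q * D * q"
    unfolding corner_denom(2) corner_weight(2) by (simp add: corner_rewrites power2_eq_square algebra_simps)
  define k where "k = 1 / (q * D)"
  have "transition q \<sigma> \<tau> a b *v pos_v q \<tau> a = k *\<^sub>R
    vec3 (- \<sigma> * q * c' * P + \<sigma> * d * q * (c' * d' - q * s'\<^sup>2 * c * d)) 0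
      (q\<^sup>2 * c\<^sup>2 + d'\<^sup>2 + q * c * c' * d * d' - d * d' * P)"
    unfolding transition_def frame_mult pos_v_def step_north_eq step_point_eq k_def[symmetric]
    by (simp add: vec3_eq_iff flip: d_def) (simp add: signs[THEN square_rewrites(1)] signs[THEN square_rewrites(2)] power2_eq_square algebra_simps)
  then show ?thesis unfolding 1 2 k_def using q corner_denom(1) by (simp add: pos_h_def vec3_eq_iff flip: c_def)
qed

end

text \<open>
  The coordinates with respect to an orthonormal frame are the products with its vectors.
\<close>

lemma frame_expansion:
  assumes A: "lorentz (frame v w)"
  shows "frame v w *v vec3 (mink (mcross v w) z) (mink v z) (- mink w z) = z"
proof -
  obtain B where B: "frame v w ** B = mat 1" using lorentz_inverse[OF A] by blast
  define x where "x = B *v z"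
  have z: "z = frame v w *v x" by (simp add: x_def matrix_vector_mul_assoc B)
  have pres: "mink (frame v w *v y) (frame v w *v x) = mink y x" for y using A by (simp add: lorentz_def)
  have "mink (mcross v w) z = x $ 1" "mink v z = x $ 2" "mink w z = - (x $ 3)"
    using pres[of "vec3 1 0 0"] pres[of "vec3 0 1 0"] pres[of origin] unfolding z
    by (simp_all add: frame_mult mink_def[of "vec3 _ _ _"])
  then have "vec3 (mink (mcross v w) z) (mink v z) (- mink w z) = x" by (simp add: vec3_eq_iff)
  then show ?thesis using z by simp
qed

text \<open>Seen from \<open>w\<close>, the square has the same shape with the roles of \<open>x\<close> and \<open>y\<close> exchanged: the rows of
  one transition matrix are the columns of the other, up to signs.\<close>

lemma transition_opposite:
  assumes q: "0 < q" "q \<le> 1" and signs: "\<sigma>\<^sup>2 = 1" "\<tau>\<^sup>2 = 1"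
  shows "transition q \<sigma> \<tau> a b ** transition q (- \<sigma>) (- \<tau>) b a = mat 1"
proof -
  have signs': "(- \<sigma>)\<^sup>2 = 1" "(- \<tau>)\<^sup>2 = 1" using signs by auto
  have q0: "0 \<le> q" using q by simp
  note rel = jacobi_relations[OF q0 q(2)]
  let ?N = "step_north q \<sigma> \<tau> a b" and ?Y = "step_point q \<sigma> \<tau> a b"
  have "transition q (- \<sigma>) (- \<tau>) b a *v z = vec3 (mink (mcross ?N ?Y) z) (mink ?N z) (- mink ?Y z)" for z
  proof -
    define k where "k = 1 / (q * add_denom q a b)"
    have k': "1 / (q * add_denom q b a) = k" by (simp add: k_def add_denom_commute)
    show ?thesis
      unfolding transition_def frame_mult transition_east[OF q signs] transition_east[OF q signs']
      unfolding step_north_eq[OF q signs] step_north_eq[OF q signs'] step_point_eq[OF q signs]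
        step_point_eq[OF q signs'] k_def[symmetric] k'
      unfolding rel weight_commute[of q b a]
      by (simp add: vec3_eq_iff mink_def[of "vec3 _ _ _"]) (simp add: algebra_simps)
  qed
  then have "transition q \<sigma> \<tau> a b *v (transition q (- \<sigma>) (- \<tau>) b a *v z) = z" for z
    using frame_expansion lorentz_transition[OF q signs, of a b] unfolding transition_def by simp
  then show ?thesis by (simp add: matrix_eq flip: matrix_vector_mul_assoc)
qed

text \<open>
  At a finite ring \<open>v\<close>, the frames of \<open>x\<close> and \<open>y\<close> are moved to the centre of \<open>v\<close> along the geodesics. The
  second vector then is orthogonal to the line through \<open>x\<close>, but parallel to the line through \<open>y\<close>. So
  the two frames agree if the lines meet at the angle \<open>\<pi>/2\<close>, and in general they differ by a rotation
  about the deviation of \<open>theta q a b\<close> from \<open>\<pi>/2\<close>.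
\<close>

definition center_h :: "real \<Rightarrow> real \<Rightarrow> real \<Rightarrow> real^3^3" where
  "center_h q \<sigma> a = frame (vec3 0 1 0) ((1 / (q * jacobi_sn q a)) *\<^sub>R pos_h q \<sigma> a)"

definition center_v :: "real \<Rightarrow> real \<Rightarrow> real \<Rightarrow> real^3^3" where
  "center_v q \<tau> a = frame ((1 / (q * jacobi_sn q a)) *\<^sub>R vec3 0 1 (- \<tau> * jacobi_dn q a))
     ((1 / (q * jacobi_sn q a)) *\<^sub>R pos_v q \<tau> a)"

lemma lorentz_rotation: "lorentz (rotation t)"
proof -
  have "rotation t = frame (vec3 (- sin t) (cos t) 0) origin"
    by (simp add: rotation_def frame_def mcross_def transpose_def vec_eq_iff forall_3)
  then show ?thesis
    using lorentz_frame[of "vec3 (- sin t) (cos t) 0" origin] by (simp add: mink_def flip: power2_eq_square)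
qed

lemma rotation_add: "rotation s ** rotation t = rotation (s + t)"
  by (simp add: rotation_def vec_eq_iff forall_3 matrix_matrix_mult_def sum_3 cos_add sin_add)

lemma lorentz_centers:
  assumes q: "0 < q" "q \<le> 1" and signs: "\<sigma>\<^sup>2 = 1" "\<tau>\<^sup>2 = 1" and s: "0 < jacobi_sn q a"
  shows "lorentz (center_h q \<sigma> a)" "lorentz (center_v q \<tau> a)"
proof -
  have q0: "0 \<le> q" using q by simp
  define s where "s = jacobi_sn q a"
  have s0: "s > 0" using s by (simp add: s_def)
  then have sp: "q * s > 0" using q by simp
  note rel = jacobi_relations[OF q0 q(2), of a, folded s_def]
  have h: "mink (pos_h q \<sigma> a) (pos_h q \<sigma> a) = - ((q * s) * (q * s))"
    by (simp add: pos_h_def mink_def signs[THEN square_rewrites(1)] signs[THEN square_rewrites(2)]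
        rel[THEN square_rewrites(1)] rel[THEN square_rewrites(2)] power2_eq_square algebra_simps)
  have v: "mink (pos_v q \<tau> a) (pos_v q \<tau> a) = - ((q * s) * (q * s))"
    "mink (vec3 0 1 (- \<tau> * jacobi_dn q a)) (vec3 0 1 (- \<tau> * jacobi_dn q a)) = (q * s) * (q * s)"
    by (simp_all add: pos_v_def mink_def signs[THEN square_rewrites(1)] signs[THEN square_rewrites(2)]
        rel[THEN square_rewrites(1)] rel[THEN square_rewrites(2)] power2_eq_square algebra_simps)
  show "lorentz (center_h q \<sigma> a)"
    unfolding center_h_def s_def[symmetric] using h sp q s0
    by (intro lorentz_frame) (simp_all add: mink_def[of "vec3 _ _ _"] pos_h_def)
  show "lorentz (center_v q \<tau> a)"
    unfolding center_v_def s_def[symmetric] using v sp q s0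
    by (intro lorentz_frame) (simp_all, simp_all add: mink_def pos_v_def)
qed

lemma transition_rotation:
  assumes q: "0 < q" "q \<le> 1" and signs: "\<sigma>\<^sup>2 = 1" "\<tau>\<^sup>2 = 1" and sn: "0 < jacobi_sn q a"
  shows "transition q \<sigma> \<tau> a b ** center_v q \<tau> a =
    center_h q \<sigma> a ** rotation (\<sigma> * \<tau> * (theta q a b - pi / 2))"
proof (rule lorentz_eqI)
  have q0: "0 \<le> q" using q by simp
  define s c d s' c' d' D P where defs: "s = jacobi_sn q a" "c = jacobi_cn q a" "d = jacobi_dn q a"
    "s' = jacobi_sn q b" "c' = jacobi_cn q b" "d' = jacobi_dn q b" "D = add_denom q a b" "P = weight q a b"
  note rel = jacobi_relations[OF q0 q(2), of a, folded defs] jacobi_relations[OF q0 q(2), of b, folded defs]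
  note D = corner_denom[OF q signs, of a b, folded defs] and P = corner_weight[OF q signs, of a b, folded defs]
  note sq = rel[THEN square_rewrites(1)] rel[THEN square_rewrites(2)]
    signs[THEN square_rewrites(1)] signs[THEN square_rewrites(2)]
  note L = lorentz_transition[OF q signs] lorentz_centers[OF q signs sn] lorentz_rotation
  show "lorentz (transition q \<sigma> \<tau> a b ** center_v q \<tau> a)"
    "lorentz (center_h q \<sigma> a ** rotation (\<sigma> * \<tau> * (theta q a b - pi / 2)))"
    by (intro lorentz_mult L)+
  have "(transition q \<sigma> \<tau> a b ** center_v q \<tau> a) *v origin = (1 / (q * s)) *\<^sub>R pos_h q \<sigma> a"
    unfolding matrix_vector_mul_assoc[symmetric] center_v_def frame_columns defs
    by (simp add: linear_scale[OF matrix_vector_mul_linear] transition_pos_v[OF q signs])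
  also have "\<dots> = (center_h q \<sigma> a ** rotation (\<sigma> * \<tau> * (theta q a b - pi / 2))) *v origin"
    unfolding matrix_vector_mul_assoc[symmetric] rotation_mult center_h_def by (simp add: frame_columns defs)
  finally show "(transition q \<sigma> \<tau> a b ** center_v q \<tau> a) *v origin =
      (center_h q \<sigma> a ** rotation (\<sigma> * \<tau> * (theta q a b - pi / 2))) *v origin" .
  let ?\<phi> = "\<sigma> * \<tau> * (theta q a b - pi / 2)"
  have "\<sigma> * \<tau> = 1 \<or> \<sigma> * \<tau> = - 1" using signs by (auto simp: power2_eq_1_iff)
  then have "sin ?\<phi> = - (\<sigma> * \<tau>) * cos (theta q a b)" "cos ?\<phi> = sin (theta q a b)"
    by (auto simp: sin_diff cos_diff)
  then have phi: "sin ?\<phi> = - (\<sigma> * \<tau>) * (c * d - q * s\<^sup>2 * c' * d') / D" "cos ?\<phi> = s * P / D"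
    unfolding cos_theta[OF q0 q(2)] sin_theta[OF q0 q(2)] by (simp_all add: defs)
  have s0: "s > 0" using sn by (simp add: defs)
  define k where "k = 1 / (q * D)"
  define m where "m = 1 / (q * s)"
  have 1: "- \<sigma> * \<tau> * q * (c' * d' - q * s'\<^sup>2 * c * d) + \<sigma> * \<tau> * q * d * c' * P = \<sigma> * \<tau> * q\<^sup>2 * (c * d - q * s\<^sup>2 * c' * d')"
    unfolding P(2) by (simp add: sq power2_eq_square algebra_simps)
  have 2: "P - d * d * P = q\<^sup>2 * s\<^sup>2 * P" by (simp add: sq power2_eq_square algebra_simps)
  have 3: "\<tau> * d' * P - \<tau> * d * (q\<^sup>2 * c\<^sup>2 + d'\<^sup>2 + q * c * c' * d * d') = - \<tau> * q\<^sup>2 * c * (c * d - q * s\<^sup>2 * c' * d')"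
    unfolding P(2) by (simp add: sq power2_eq_square algebra_simps)
  have "(transition q \<sigma> \<tau> a b ** center_v q \<tau> a) *v vec3 0 1 0 = (m * k) *\<^sub>R
      vec3 (- \<sigma> * \<tau> * q * (c' * d' - q * s'\<^sup>2 * c * d) + \<sigma> * \<tau> * q * d * c' * P) (P - d * d * P)
        (\<tau> * d' * P - \<tau> * d * (q\<^sup>2 * c\<^sup>2 + d'\<^sup>2 + q * c * c' * d * d'))"
    unfolding matrix_vector_mul_assoc[symmetric] center_v_def frame_columns transition_def frame_mult
      step_north_eq[OF q signs] step_point_eq[OF q signs] defs[symmetric] k_def[symmetric] m_def[symmetric]
    by (simp add: vec3_eq_iff) (simp add: signs[THEN square_rewrites(1)] signs[THEN square_rewrites(2)] algebra_simps)
  also have "\<dots> = - sin ?\<phi> *\<^sub>R mcross (vec3 0 1 0) (m *\<^sub>R pos_h q \<sigma> a) + cos ?\<phi> *\<^sub>R vec3 0 1 0"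
    unfolding 1 2 3 phi m_def k_def mcross_def pos_h_def defs(2)[symmetric] using q s0 D(1)
    by (simp add: vec3_eq_iff power2_eq_square signs[THEN square_rewrites(1)] signs[THEN square_rewrites(2)] mult_ac)
  also have "\<dots> = (center_h q \<sigma> a ** rotation ?\<phi>) *v vec3 0 1 0"
    unfolding matrix_vector_mul_assoc[symmetric] rotation_mult center_h_def frame_mult by (simp add: m_def defs)
  finally show "(transition q \<sigma> \<tau> a b ** center_v q \<tau> a) *v vec3 0 1 0 = (center_h q \<sigma> a ** rotation ?\<phi>) *v vec3 0 1 0" .
qed

text \<open>
  In a square, the frame of \<open>x\<close> determines the other two objects. In coordinates, the incidence
  conditions leave one sign for the position of \<open>v\<close> and a quadratic equation for \<open>y\<close>; the
  orientation at \<open>v\<close> decides about the sign, and the orientation at \<open>w\<close> about the root. For a point-like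
  inner circle, the respective choice does not exist.
\<close>

lemma square_rigid:
  assumes q: "0 < q" "q \<le> 1" and signs: "\<sigma>\<^sup>2 = 1" "\<tau>\<^sup>2 = 1"
    and F: "lorentz F" and px: "px = F *v origin" and Cw: "Cw = F *v pos_v q (- \<tau>) b"
    and Cv: "mink Cv Cv = - (q\<^sup>2 * (jacobi_sn q a)\<^sup>2)" "mink Cv px = - q" "mink Cv Cw = - q"
    and py: "mink py py = - 1" "py $ 3 > 0" "mink Cv py = - 1" "mink Cw py = - q"
    and or_v: "jacobi_cn q a > 0 \<Longrightarrow> \<sigma> * \<tau> * det3 Cv px py > 0" "jacobi_cn q a < 0 \<Longrightarrow> \<sigma> * \<tau> * det3 Cv px py < 0"
    and or_w: "jacobi_cn q b > 0 \<Longrightarrow> \<sigma> * \<tau> * det3 Cw py px > 0" "jacobi_cn q b < 0 \<Longrightarrow> \<sigma> * \<tau> * det3 Cw py px < 0"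
  shows "Cv = F *v pos_h q \<sigma> a" "py = F *v step_point q \<sigma> \<tau> a b"
proof -
  have q0: "0 \<le> q" using q by simp
  define s c d s' c' d' D P where defs: "s = jacobi_sn q a" "c = jacobi_cn q a" "d = jacobi_dn q a"
    "s' = jacobi_sn q b" "c' = jacobi_cn q b" "d' = jacobi_dn q b" "D = add_denom q a b" "P = weight q a b"
  note rel = jacobi_relations[OF q0 q(2), of a, folded defs] jacobi_relations[OF q0 q(2), of b, folded defs]
  note D = corner_denom[OF q signs, of a b, folded defs] and P = corner_weight[OF q signs, of a b, folded defs]
  note sq = rel[THEN square_rewrites(1)] rel[THEN square_rewrites(2)]
  have d': "d' > 0" using dn_positive[OF q0 q(2)] by (simp add: defs)
  have sg: "\<sigma> = 1 \<or> \<sigma> = - 1" "\<tau> = 1 \<or> \<tau> = - 1" using signs by (auto simp: power2_eq_1_iff)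
  obtain B where B: "lorentz B" "F ** B = mat 1" "B ** F = mat 1" using lorentz_inverse[OF F] by blast
  have FB: "F *v (B *v z) = z" and BF: "B *v (F *v z) = z" for z by (simp_all add: matrix_vector_mul_assoc B)
  have pres: "mink (B *v x) (B *v y) = mink x y" "det3 (B *v x) (B *v y) (B *v z) = det3 x y z" for x y z
    using B(1) by (auto simp: lorentz_def)
  define u y where "u = B *v Cv" and "y = B *v py"
  have bx: "B *v px = origin" "B *v Cw = vec3 0 (\<tau> * d') 1" unfolding px Cw BF by (simp_all add: pos_v_def defs)
  have m: "mink u origin = - q" "mink u (vec3 0 (\<tau> * d') 1) = - q" "mink u u = - (q\<^sup>2 * s\<^sup>2)"
    "mink y y = - 1" "mink u y = - 1" "mink (vec3 0 (\<tau> * d') 1) y = - q"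
    using Cv py unfolding u_def y_def bx[symmetric] pres by (simp_all add: defs)
  have u3: "u $ 3 = q" using m(1) by (simp add: mink_def)
  have u2: "u $ 2 = 0" using m(2) u3 d' sg by (auto simp: mink_def)
  have u1: "u $ 1 * u $ 1 = q\<^sup>2 * c\<^sup>2"
    using m(3) unfolding rel by (simp add: mink_def u2 u3 power2_eq_square algebra_simps)
  have yy: "y $ 1 * y $ 1 + y $ 2 * y $ 2 - y $ 3 * y $ 3 = - 1"
    and uy: "u $ 1 * y $ 1 - q * y $ 3 = - 1" and wy: "\<tau> * d' * y $ 2 - y $ 3 = - q"
    using m(4-6) by (simp_all add: mink_def u2 u3)
  have "future py" using py by (simp add: future_def)
  then have "future y" using B(1) by (simp add: lorentz_def y_def)
  then have "y $ 3 > 0" by (simp add: future_def)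
  moreover have "1 \<le> y $ 3 * y $ 3" using yy zero_le_square[of "y $ 1"] zero_le_square[of "y $ 2"] by linarith
  ultimately have y3: "1 \<le> y $ 3" by (smt (verit) mult_less_cancel_left2)
  have orv: "det3 Cv px py = - (u $ 1 * y $ 2)"
    using pres(2)[of Cv px py] unfolding bx u_def[symmetric] y_def[symmetric] by (simp add: det3_def u2)
  have orw: "det3 Cw py px = - (\<tau> * d' * y $ 1)"
    using pres(2)[of Cw py px] unfolding bx y_def[symmetric] by (simp add: det3_def)
  have y2: "\<tau> * y $ 2 = (y $ 3 - q) / d'" using wy d' by (simp add: field_simps)
  then have y2': "0 \<le> \<tau> * y $ 2" using y3 q d' by simp
  \<comment> \<open>The orientation at \<open>v\<close> selects the side of \<open>x\<close> on which the centre of \<open>v\<close> lies.\<close>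
  have u1': "u $ 1 = - \<sigma> * q * c"
  proof -
    have "u $ 1 = q * c \<or> u $ 1 = - (q * c)"
      using u1 by (simp add: power2_eq_square[symmetric] power_mult_distrib[symmetric] power2_eq_iff)
    moreover have "\<sigma> * \<tau> * det3 Cv px py = - (\<sigma> * u $ 1) * (\<tau> * y $ 2)" by (simp add: orv)
    then have "c > 0 \<Longrightarrow> - (\<sigma> * u $ 1) * (\<tau> * y $ 2) > 0" "c < 0 \<Longrightarrow> (\<sigma> * u $ 1) * (\<tau> * y $ 2) > 0"
      using or_v by (simp_all add: defs)
    moreover have "X > 0" if "X * Z > 0" "Z \<ge> 0" for X Z :: real
      using that by (auto simp: zero_less_mult_iff)
    ultimately have "u $ 1 = q * c \<or> u $ 1 = - (q * c)" "c > 0 \<Longrightarrow> - (\<sigma> * u $ 1) > 0" "c < 0 \<Longrightarrow> \<sigma> * u $ 1 > 0"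
      using y2' by blast+
    then show ?thesis
      using sg(1) q by (cases "c > 0"; cases "c < 0") (auto simp: zero_less_mult_iff mult_less_0_iff)
  qed
  then have u: "u = pos_h q \<sigma> a" by (simp add: vec3_eq_iff pos_h_def u2 u3 defs)
  then show "Cv = F *v pos_h q \<sigma> a" using FB[of Cv] by (simp add: u_def)
  \<comment> \<open>All coordinates of \<open>y\<close> are linear in \<open>t\<close>, so that \<open>mink y y = - 1\<close> is a quadratic equation. Its roots
    are rational in the Jacobi functions since the discriminant is a square.\<close>
  define t where "t = - \<sigma> * y $ 1"
  have y1: "y $ 1 = - \<sigma> * t" using sg(1) by (auto simp: t_def)
  have tY: "q * c * t = q * y $ 3 - 1" using uy unfolding u1' y1 using sg(1) by (auto simp: algebra_simps)
  have "t * t + ((y $ 3 - q) / d') * ((y $ 3 - q) / d') - y $ 3 * y $ 3 = - 1"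
    using yy sg unfolding y1 y2[symmetric] by auto
  then have "d' * d' * (t * t) + (y $ 3 - q) * (y $ 3 - q) - d' * d' * (y $ 3 * y $ 3) = - (d' * d')"
    using d' by (simp add: field_simps)
  then have "q * q * (d' * d' * (t * t) + (y $ 3 - q) * (y $ 3 - q) - d' * d' * (y $ 3 * y $ 3) + d' * d') = 0" by simp
  moreover have "q * q * (d' * d' * (t * t) + (y $ 3 - q) * (y $ 3 - q) - d' * d' * (y $ 3 * y $ 3) + d' * d') =
      q * q * (d' * d') * (t * t) + (q * y $ 3 - q * q) * (q * y $ 3 - q * q) - d' * d' * ((q * y $ 3) * (q * y $ 3)) + q * q * (d' * d')"
    by (simp add: algebra_simps)
  moreover have "q * y $ 3 = 1 + q * c * t" using tY by simp
  ultimately have quad: "q * q * (d' * d') * (t * t) + (1 + q * c * t - q * q) * (1 + q * c * t - q * q)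
      - d' * d' * ((1 + q * c * t) * (1 + q * c * t)) + q * q * (d' * d') = 0" by simp
  have "q * q * (d' * d') * (t * t) + (1 + q * c * t - q * q) * (1 + q * c * t - q * q)
      - d' * d' * ((1 + q * c * t) * (1 + q * c * t)) + q * q * (d' * d') =
      q * q * (D * (t * t) - 2 * q * c * c' * c' * t - (1 - q * q) * (c' * c'))"
    unfolding D(2) by (simp add: sq power2_eq_square algebra_simps)
  then have quad: "D * (t * t) - 2 * q * c * c' * c' * t - (1 - q * q) * (c' * c') = 0"
    using quad q by simp
  have "(D * t - c' * P) * (D * t - c' * (q * c * c' - d * d')) =
      D * (D * (t * t) - 2 * q * c * c' * c' * t) + c' * c' * (q * q * (c * c) * (c' * c') - d * d * (d' * d'))"
    unfolding P(2) by (simp add: algebra_simps)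
  also have "q * q * (c * c) * (c' * c') - d * d * (d' * d') = - ((1 - q * q) * D)"
    unfolding D(2) by (simp add: sq power2_eq_square algebra_simps)
  also have "D * (D * (t * t) - 2 * q * c * c' * c' * t) + c' * c' * (- ((1 - q * q) * D)) =
      D * (D * (t * t) - 2 * q * c * c' * c' * t - (1 - q * q) * (c' * c'))" by (simp add: algebra_simps)
  finally have roots: "D * t = c' * P \<or> D * t = c' * (q * c * c' - d * d')" unfolding quad by simp
  have "D * t = c' * P"
  proof (cases "c' = 0")
    case False
    \<comment> \<open>The roots have opposite signs (or one is \<open>0\<close>), and the orientation at \<open>w\<close> asks for the sign of \<open>c'\<close>.\<close>
    have "\<sigma> * \<tau> * det3 Cw py px = d' * t" unfolding orw t_def using sg(2) by auto
    then have pos: "c' > 0 \<Longrightarrow> t > 0" "c' < 0 \<Longrightarrow> t < 0"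
      using or_w d' by (auto simp: defs zero_less_mult_iff mult_less_0_iff)
    have "q * c * c' \<le> d * d'"
    proof -
      have "q * c * c' \<le> q * (\<bar>c\<bar> * \<bar>c'\<bar>)"
        using q abs_ge_self[of "c * c'"] by (simp add: abs_mult mult.assoc)
      also have "\<dots> \<le> 1 * (d * d')"
        using q cn_le_dn[OF q0 q(2), of a] cn_le_dn[OF q0 q(2), of b] dn_positive[OF q0 q(2), of a]
        by (intro mult_mono) (auto simp: defs)
      finally show ?thesis by simp
    qed
    then have "D * t * c' > c' * (q * c * c' - d * d') * c'"
    proof -
      have "D * t * c' > 0" using pos D(1) False by (cases "c' > 0") (auto simp: zero_less_mult_iff mult_less_0_iff)
      moreover have "c' * c' * (q * c * c' - d * d') \<le> 0"
        using \<open>q * c * c' \<le> d * d'\<close> by (intro mult_nonneg_nonpos) auto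
      ultimately show ?thesis by (simp add: mult_ac)
    qed
    then show ?thesis using roots by auto
  qed (use roots in simp)
  then have t: "t = c' * P / D" using D(1) by (simp add: field_simps)
  have "q * D * y $ 3 = q * q * c * c + d' * d' + q * c * c' * d * d'"
  proof -
    have "q * D * y $ 3 = D * (1 + q * c * t)" using tY by (simp add: algebra_simps)
    also have "\<dots> = D + q * c * (D * t)" by (simp add: algebra_simps)
    also have "\<dots> = D + q * c * (c' * P)" using \<open>D * t = c' * P\<close> by simp
    also have "\<dots> = q * q * c * c + d' * d' + q * c * c' * d * d'"
      unfolding D(2) P(2) by (simp add: sq power2_eq_square algebra_simps)
    finally show ?thesis .
  qed
  then have Y: "y $ 3 = (q * q * c * c + d' * d' + q * c * c' * d * d') / (q * D)" using q D(1) by (simp add: field_simps)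
  have "q * D * (y $ 3 - q) = d * d' * P"
    using \<open>q * D * y $ 3 = _\<close> unfolding right_diff_distrib D(2) P(2) by (simp add: sq power2_eq_square algebra_simps)
  then have "y $ 3 - q = d * d' * P / (q * D)" using q D(1) by (simp add: field_simps)
  then have "\<tau> * y $ 2 = d * P / (q * D)" using y2 d' by simp
  then have "y $ 2 = \<tau> * d * P / (q * D)" using sg(2) by auto
  then have "y = step_point q \<sigma> \<tau> a b"
    unfolding step_point_def by (simp add: vec3_eq_iff y1 t Y power2_eq_square mult_ac flip: defs)
  then show "py = F *v step_point q \<sigma> \<tau> a b" using FB[of py] by (simp add: y_def)
qed

section \<open>Squares, edges and neighbours\<close>

text \<open>
  A square is described from one of its corners \<open>v\<close> in \<open>G\<close>, by the directions \<open>\<sigma>\<close>, \<open>\<tau>\<close> (\<open>1\<close> or \<open>-1\<close>) of its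
  horizontal and its vertical edge at \<open>v\<close>. The four kinds of squares at a vertex are treated at once
  in this way.
\<close>

definition hx :: "vertex \<Rightarrow> int \<Rightarrow> vertex" where
  "hx v \<sigma> = (fst v + \<sigma>, snd v)"

definition vy :: "vertex \<Rightarrow> int \<Rightarrow> vertex" where
  "vy v \<tau> = (fst v, snd v + \<tau>)"

definition opp :: "vertex \<Rightarrow> int \<Rightarrow> int \<Rightarrow> vertex" where
  "opp v \<sigma> \<tau> = (fst v + \<sigma>, snd v + \<tau>)"

text \<open>
  The lower left corner of the square; the offset is \<open>0\<close> for direction \<open>1\<close> and \<open>-1\<close> for direction \<open>-1\<close>.
\<close>

definition square_of_corner :: "vertex \<Rightarrow> int \<Rightarrow> int \<Rightarrow> vertex" where
  "square_of_corner v \<sigma> \<tau> = (fst v + (\<sigma> - 1) div 2, snd v + (\<tau> - 1) div 2)"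

definition square_at :: "vertex set \<Rightarrow> vertex \<Rightarrow> int \<Rightarrow> int \<Rightarrow> bool" where
  "square_at S v \<sigma> \<tau> \<longleftrightarrow> (\<sigma> = 1 \<or> \<sigma> = -1) \<and> (\<tau> = 1 \<or> \<tau> = -1) \<and> even (fst v + snd v) \<and> square_of_corner v \<sigma> \<tau> \<in> S"

lemma square_at_signs: "square_at S v \<sigma> \<tau> \<Longrightarrow> \<sigma> = 1 \<or> \<sigma> = -1" "square_at S v \<sigma> \<tau> \<Longrightarrow> \<tau> = 1 \<or> \<tau> = -1"
  by (auto simp: square_at_def)

lemma square_at_corners:
  assumes "square_at S v \<sigma> \<tau>"
  shows "corners (square_of_corner v \<sigma> \<tau>) = {v, hx v \<sigma>, vy v \<tau>, opp v \<sigma> \<tau>}"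
proof -
  obtain m n where v: "v = (m, n)" by (cases v)
  have "corners (square_of_corner v \<sigma> \<tau>) = {m + (\<sigma> - 1) div 2, m + (\<sigma> - 1) div 2 + 1} \<times> {n + (\<tau> - 1) div 2, n + (\<tau> - 1) div 2 + 1}"
    by (simp add: corners_def square_of_corner_def v)
  also have "{m + (\<sigma> - 1) div 2, m + (\<sigma> - 1) div 2 + 1} = {m, m + \<sigma>}"
    using assms by (auto simp: square_at_def)
  also have "{n + (\<tau> - 1) div 2, n + (\<tau> - 1) div 2 + 1} = {n, n + \<tau>}"
    using assms by (auto simp: square_at_def)
  finally show ?thesis by (auto simp: v hx_def vy_def opp_def)
qed

lemma square_at_exists:
  assumes "s \<in> S" "v \<in> corners s" "even (fst v + snd v)"
  obtains \<sigma> \<tau> where "square_at S v \<sigma> \<tau>" "s = square_of_corner v \<sigma> \<tau>"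
proof -
  define \<sigma> \<tau> :: int where "\<sigma> = (if fst v = fst s then 1 else - 1)" and "\<tau> = (if snd v = snd s then 1 else - 1)"
  have s: "s = square_of_corner v \<sigma> \<tau>"
    using assms(2) by (auto simp: corners_iff square_of_corner_def \<sigma>_def \<tau>_def prod_eq_iff)
  have "\<sigma> = 1 \<or> \<sigma> = - 1" "\<tau> = 1 \<or> \<tau> = - 1" by (simp_all add: \<sigma>_def \<tau>_def)
  then have "square_at S v \<sigma> \<tau>" unfolding square_at_def s[symmetric] using assms(1,3) by blast
  then show thesis using that s by blast
qed

lemma square_at_opp: "square_at S v \<sigma> \<tau> \<Longrightarrow> square_at S (opp v \<sigma> \<tau>) (- \<sigma>) (- \<tau>)"
  by (auto simp: square_at_def square_of_corner_def opp_def)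

lemma opp_simps [simp]: "opp (opp v \<sigma> \<tau>) (- \<sigma>) (- \<tau>) = v" "hx (opp v \<sigma> \<tau>) (- \<sigma>) = vy v \<tau>" "vy (opp v \<sigma> \<tau>) (- \<tau>) = hx v \<sigma>"
  by (simp_all add: opp_def hx_def vy_def)

lemma vertices_G_iff: "v \<in> vertices_G S \<longleftrightarrow> even (fst v + snd v) \<and> (\<exists>s\<in>S. v \<in> corners s)"
  by (cases v) (auto simp: vertices_G_def)

lemma vertices_Gstar_iff: "v \<in> vertices_Gstar S \<longleftrightarrow> odd (fst v + snd v) \<and> (\<exists>s\<in>S. v \<in> corners s)"
  by (cases v) (auto simp: vertices_Gstar_def)

lemma square_at_vertices:
  assumes "square_at S v \<sigma> \<tau>"
  shows "v \<in> vertices_G S" "opp v \<sigma> \<tau> \<in> vertices_G S" "hx v \<sigma> \<in> vertices_Gstar S" "vy v \<tau> \<in> vertices_Gstar S"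
proof -
  have s: "square_of_corner v \<sigma> \<tau> \<in> S" and e: "even (fst v + snd v)" using assms by (auto simp: square_at_def)
  note c = square_at_corners[OF assms]
  have "odd (fst (hx v \<sigma>) + snd (hx v \<sigma>))" "odd (fst (vy v \<tau>) + snd (vy v \<tau>))" "even (fst (opp v \<sigma> \<tau>) + snd (opp v \<sigma> \<tau>))"
    using assms by (auto simp: square_at_def hx_def vy_def opp_def)
  then show "v \<in> vertices_G S" "opp v \<sigma> \<tau> \<in> vertices_G S" "hx v \<sigma> \<in> vertices_Gstar S" "vy v \<tau> \<in> vertices_Gstar S"
    using s e c unfolding vertices_G_iff vertices_Gstar_iff by blast+
qed

lemma vertices_G_square:
  assumes "v \<in> vertices_G S"
  obtains \<sigma> \<tau> where "square_at S v \<sigma> \<tau>"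
  using assms square_at_exists unfolding vertices_G_iff by blast

lemma edge_square:
  assumes "s \<in> S" "x \<in> corners s" "v \<in> corners s" "even (fst v + snd v)"
  shows "\<bar>fst x - fst v\<bar> = 1 \<Longrightarrow> snd x = snd v \<Longrightarrow> \<exists>\<sigma> \<tau>. square_at S v \<sigma> \<tau> \<and> x = hx v \<sigma>"
    and "fst x = fst v \<Longrightarrow> \<bar>snd x - snd v\<bar> = 1 \<Longrightarrow> \<exists>\<sigma> \<tau>. square_at S v \<sigma> \<tau> \<and> x = vy v \<tau>"
proof -
  obtain \<sigma> \<tau> where sq: "square_at S v \<sigma> \<tau>" "s = square_of_corner v \<sigma> \<tau>" using square_at_exists assms by blast
  have x: "x = v \<or> x = hx v \<sigma> \<or> x = vy v \<tau> \<or> x = opp v \<sigma> \<tau>" using assms(2) square_at_corners[OF sq(1)] sq(2) by simp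
  show "\<bar>fst x - fst v\<bar> = 1 \<Longrightarrow> snd x = snd v \<Longrightarrow> \<exists>\<sigma> \<tau>. square_at S v \<sigma> \<tau> \<and> x = hx v \<sigma>"
    using x sq(1) square_at_signs[OF sq(1)] by (auto simp: hx_def vy_def opp_def)
  show "fst x = fst v \<Longrightarrow> \<bar>snd x - snd v\<bar> = 1 \<Longrightarrow> \<exists>\<sigma> \<tau>. square_at S v \<sigma> \<tau> \<and> x = vy v \<tau>"
    using x sq(1) square_at_signs[OF sq(1)] by (auto simp: hx_def vy_def opp_def)
qed

lemma hor_edge_iff:
  assumes "odd (fst x + snd x)"
  shows "hor_edge S x v \<longleftrightarrow> (\<exists>\<sigma> \<tau>. square_at S v \<sigma> \<tau> \<and> x = hx v \<sigma>)"
proof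
  assume h: "hor_edge S x v"
  then have "even (fst v + snd v)" using assms by (auto simp: hor_edge_def abs_if split: if_splits) presburger+
  then show "\<exists>\<sigma> \<tau>. square_at S v \<sigma> \<tau> \<and> x = hx v \<sigma>" using h edge_square(1) unfolding hor_edge_def by blast
next
  assume "\<exists>\<sigma> \<tau>. square_at S v \<sigma> \<tau> \<and> x = hx v \<sigma>"
  then obtain \<sigma> \<tau> where sq: "square_at S v \<sigma> \<tau>" "x = hx v \<sigma>" by blast
  then show "hor_edge S x v"
    using square_at_corners[OF sq(1)] square_at_signs[OF sq(1)]
    unfolding hor_edge_def square_at_def by (auto simp: hx_def)
qed

lemma ver_edge_iff:
  assumes "odd (fst x + snd x)"
  shows "ver_edge S x v \<longleftrightarrow> (\<exists>\<sigma> \<tau>. square_at S v \<sigma> \<tau> \<and> x = vy v \<tau>)"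
proof
  assume h: "ver_edge S x v"
  then have "even (fst v + snd v)" using assms by (auto simp: ver_edge_def abs_if split: if_splits) presburger+
  then show "\<exists>\<sigma> \<tau>. square_at S v \<sigma> \<tau> \<and> x = vy v \<tau>" using h edge_square(2) unfolding ver_edge_def by blast
next
  assume "\<exists>\<sigma> \<tau>. square_at S v \<sigma> \<tau> \<and> x = vy v \<tau>"
  then obtain \<sigma> \<tau> where sq: "square_at S v \<sigma> \<tau>" "x = vy v \<tau>" by blast
  then show "ver_edge S x v"
    using square_at_corners[OF sq(1)] square_at_signs[OF sq(1)]
    unfolding ver_edge_def square_at_def by (auto simp: vy_def)
qed

lemma neighbours_iff:
  assumes "v \<in> vertices_G S"
  shows "w \<in> neighbours S v \<longleftrightarrow> (\<exists>\<sigma> \<tau>. square_at S v \<sigma> \<tau> \<and> w = opp v \<sigma> \<tau>)"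
proof
  assume w: "w \<in> neighbours S v"
  then obtain s where s: "s \<in> S" "v \<in> corners s" "w \<in> corners s" "\<bar>fst w - fst v\<bar> = 1" "\<bar>snd w - snd v\<bar> = 1"
    by (auto simp: neighbours_def)
  have "even (fst v + snd v)" using assms by (simp add: vertices_G_iff)
  then obtain \<sigma> \<tau> where sq: "square_at S v \<sigma> \<tau>" "s = square_of_corner v \<sigma> \<tau>" using square_at_exists s by blast
  have "w \<in> {v, hx v \<sigma>, vy v \<tau>, opp v \<sigma> \<tau>}" using s(3) square_at_corners[OF sq(1)] sq(2) by simp
  then have "w = opp v \<sigma> \<tau>" using s(4,5) by (auto simp: hx_def vy_def)
  then show "\<exists>\<sigma> \<tau>. square_at S v \<sigma> \<tau> \<and> w = opp v \<sigma> \<tau>" using sq by blast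
next
  assume "\<exists>\<sigma> \<tau>. square_at S v \<sigma> \<tau> \<and> w = opp v \<sigma> \<tau>"
  then obtain \<sigma> \<tau> where sq: "square_at S v \<sigma> \<tau>" "w = opp v \<sigma> \<tau>" by blast
  have "square_of_corner v \<sigma> \<tau> \<in> S" using sq by (simp add: square_at_def)
  then show "w \<in> neighbours S v"
    using square_at_corners[OF sq(1)] square_at_signs[OF sq(1)] square_at_vertices(2)[OF sq(1)] sq(2)
    unfolding neighbours_def by (auto simp: opp_def)
qed

lemma consecutive_iff:
  assumes "v \<in> vertices_G S"
  shows "p \<in> consecutive S v \<longleftrightarrow>
    (\<exists>\<sigma> \<tau>. square_at S v \<sigma> \<tau> \<and> p = (if \<sigma> * \<tau> = 1 then (hx v \<sigma>, vy v \<tau>) else (vy v \<tau>, hx v \<sigma>)))"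
proof -
  obtain m n where v: "v = (m, n)" by (cases v)
  have "even (m + n)" using assms by (simp add: vertices_G_iff v)
  then have sq: "square_at S v 1 1 \<longleftrightarrow> (m, n) \<in> S" "square_at S v (-1) 1 \<longleftrightarrow> (m - 1, n) \<in> S"
    "square_at S v (-1) (-1) \<longleftrightarrow> (m - 1, n - 1) \<in> S" "square_at S v 1 (-1) \<longleftrightarrow> (m, n - 1) \<in> S"
    by (auto simp: square_at_def square_of_corner_def v)
  have "(\<exists>\<sigma> \<tau>. square_at S v \<sigma> \<tau> \<and> p = (if \<sigma> * \<tau> = 1 then (hx v \<sigma>, vy v \<tau>) else (vy v \<tau>, hx v \<sigma>))) \<longleftrightarrow>
    (\<exists>\<sigma>\<in>{1, -1}. \<exists>\<tau>\<in>{1, -1}. square_at S v \<sigma> \<tau> \<and> p = (if \<sigma> * \<tau> = 1 then (hx v \<sigma>, vy v \<tau>) else (vy v \<tau>, hx v \<sigma>)))"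
    using square_at_signs[of S v] by blast
  also have "\<dots> \<longleftrightarrow> p \<in> consecutive S v"
    by (simp add: sq[unfolded v] consecutive_def v hx_def vy_def) blast
  finally show ?thesis by simp
qed

lemma vertices_Gstar_square:
  assumes "x \<in> vertices_Gstar S"
  shows "\<exists>v \<sigma> \<tau>. square_at S v \<sigma> \<tau> \<and> x = vy v \<tau>"
proof -
  obtain s where s: "s \<in> S" "x \<in> corners s" "odd (fst x + snd x)" using assms by (auto simp: vertices_Gstar_iff)
  define v where "v = (if fst x = fst s then fst s + 1 else fst s, snd x)"
  have v: "v \<in> corners s" "even (fst v + snd v)" "\<bar>fst x - fst v\<bar> = 1" "snd x = snd v"
    using s by (auto simp: v_def corners_iff)
  then obtain \<sigma> \<tau> where sq: "square_at S v \<sigma> \<tau>" "x = hx v \<sigma>" using edge_square(1)[OF s(1,2)] by blast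
  from square_at_opp[OF sq(1)] have "square_at S (opp v \<sigma> \<tau>) (- \<sigma>) (- \<tau>)" "x = vy (opp v \<sigma> \<tau>) (- \<tau>)" using sq(2) by auto
  then show "\<exists>v \<sigma> \<tau>. square_at S v \<sigma> \<tau> \<and> x = vy v \<tau>" by blast
qed

lemma internal_vertex_squares:
  assumes "internal_vertex S v" "\<sigma> = 1 \<or> \<sigma> = -1" "\<tau> = 1 \<or> \<tau> = -1"
  shows "square_at S v \<sigma> \<tau>"
proof (rule ccontr)
  assume no: "\<not> square_at S v \<sigma> \<tau>"
  have v: "v \<in> vertices_G S" "card (neighbours S v) = 4" using assms by (auto simp: internal_vertex_def)
  have "neighbours S v \<subseteq> {opp v 1 1, opp v 1 (-1), opp v (-1) 1, opp v (-1) (-1)} - {opp v \<sigma> \<tau>}"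
  proof
    fix w assume "w \<in> neighbours S v"
    then obtain \<sigma>' \<tau>' where w: "square_at S v \<sigma>' \<tau>'" "w = opp v \<sigma>' \<tau>'" using neighbours_iff[OF v(1)] by blast
    then have "w \<noteq> opp v \<sigma> \<tau>" using no by (auto simp: opp_def)
    then show "w \<in> {opp v 1 1, opp v 1 (-1), opp v (-1) 1, opp v (-1) (-1)} - {opp v \<sigma> \<tau>}"
      using w square_at_signs[OF w(1)] by auto
  qed
  then have "card (neighbours S v) \<le> card ({opp v 1 1, opp v 1 (-1), opp v (-1) 1, opp v (-1) (-1)} - {opp v \<sigma> \<tau>})"
    by (intro card_mono) auto
  also have "\<dots> = 3" using assms(2,3) by (auto simp: opp_def insert_Diff_if)
  finally show False using v(2) by simp
qed

lemma internal_vertex_sum: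
  assumes "internal_vertex S v"
  shows "(\<Sum>w\<in>neighbours S v. f w) = f (opp v 1 1) + f (opp v (-1) 1) + f (opp v (-1) (-1)) + (f (opp v 1 (-1)) :: real)"
proof -
  have v: "v \<in> vertices_G S" using assms by (auto simp: internal_vertex_def)
  have "neighbours S v = {opp v 1 1, opp v (-1) 1, opp v (-1) (-1), opp v 1 (-1)}"
    unfolding set_eq_iff neighbours_iff[OF v]
    using internal_vertex_squares[OF assms] square_at_signs by (auto; metis)
  then show ?thesis by (simp add: opp_def)
qed

lemma all_squares_internal:
  assumes "v \<in> vertices_G S" "square_at S v 1 1" "square_at S v (-1) 1" "square_at S v (-1) (-1)" "square_at S v 1 (-1)"
  shows "internal_vertex S v"
proof -
  have "neighbours S v = {opp v 1 1, opp v (-1) 1, opp v (-1) (-1), opp v 1 (-1)}"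
    unfolding set_eq_iff neighbours_iff[OF assms(1)] using assms square_at_signs by (auto; metis)
  then show ?thesis using assms(1) by (simp add: internal_vertex_def opp_def)
qed

section \<open>Ring patterns in the hyperboloid model\<close>

definition ring_vec :: "real \<Rightarrow> ring \<Rightarrow> real^3 \<Rightarrow> bool" where
  "ring_vec q X C \<longleftrightarrow> norm (center X) \<le> 1 \<and> (\<exists>k>0. C = k *\<^sub>R cone_vec (center X)) \<and>
     inner X = {z \<in> hyp_plane. mink C (hpt z) = - q} \<and> outer X = {z \<in> hyp_plane. mink C (hpt z) = - 1}"

text \<open>
  The scaling factor \<open>1 / cosh R\<close> makes the level of the outer circle \<open>-1\<close>; then the level of the inner
  circle is \<open>- cosh r / cosh R\<close>.
\<close>

lemma finite_ring_circles:
  assumes a: "a \<in> hyp_plane" and rR: "cosh r = q * cosh R" "R > 0"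
  shows "hyp_circle a \<bar>r\<bar> = {z \<in> hyp_plane. mink ((1 / cosh R) *\<^sub>R hpt a) (hpt z) = - q}"
    "hyp_circle a R = {z \<in> hyp_plane. mink ((1 / cosh R) *\<^sub>R hpt a) (hpt z) = - 1}"
proof -
  have c: "cosh R > 0" using cosh_real_pos by blast
  have "hyp_dist a z = \<bar>r\<bar> \<longleftrightarrow> mink ((1 / cosh R) *\<^sub>R hpt a) (hpt z) = - q" if "z \<in> hyp_plane" for z
    using hyp_dist_eq_iff[OF a that, of "\<bar>r\<bar>"] c rR(1) by (simp add: field_simps)
  moreover have "hyp_dist a z = R \<longleftrightarrow> mink ((1 / cosh R) *\<^sub>R hpt a) (hpt z) = - 1" if "z \<in> hyp_plane" for z
    using hyp_dist_eq_iff[OF a that, of R] c rR(2) by (simp add: field_simps)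
  ultimately show "hyp_circle a \<bar>r\<bar> = {z \<in> hyp_plane. mink ((1 / cosh R) *\<^sub>R hpt a) (hpt z) = - q}"
    "hyp_circle a R = {z \<in> hyp_plane. mink ((1 / cosh R) *\<^sub>R hpt a) (hpt z) = - 1}"
    unfolding hyp_circle_def by blast+
qed

lemma horocycle_mink:
  assumes a: "norm a = 1" and s: "s > 0"
  shows "horocycle a (t * s) = {z \<in> hyp_plane. mink ((1 / (2 * s)) *\<^sub>R cone_vec a) (hpt z) = - t}"
proof -
  have "(norm (z - a))\<^sup>2 / (1 - (norm z)\<^sup>2) = t * s \<longleftrightarrow> mink ((1 / (2 * s)) *\<^sub>R cone_vec a) (hpt z) = - t"
    if z: "z \<in> hyp_plane" for z
  proof -
    define m where "m = 1 - (norm z)\<^sup>2"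
    have m: "m > 0" using disc_pos[OF z] by (simp add: m_def)
    have "(Re a)\<^sup>2 + (Im a)\<^sup>2 = 1" using a by (simp add: cmod_power2[symmetric])
    then have "mink (cone_vec a) (cone_vec z) = - 2 * (norm (z - a))\<^sup>2"
      unfolding mink_cone_vec cmod_power2 by (simp add: power2_eq_square algebra_simps)
    moreover have "hpt z = (1 / m) *\<^sub>R cone_vec z" by (simp add: hpt_def m_def)
    ultimately show ?thesis unfolding m_def[symmetric] using m s by (simp add: field_simps)
  qed
  then show ?thesis unfolding horocycle_def by blast
qed

lemma ring_vec_exists:
  assumes q: "0 < q" "q \<le> 1" and X: "hyperbolic_ring q X" "uniformizes q \<gamma> X"
  shows "\<exists>C. ring_vec q X C \<and> mink C C = - (q\<^sup>2 * (jacobi_sn q \<gamma>)\<^sup>2)"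
proof (cases "jacobi_sn q \<gamma> = 0")
  case False
  then obtain r R where rR: "rad X = ereal r" "Rad X = ereal R" "cosh R = 1 / (q * jacobi_sn q \<gamma>)"
    using X(2) by (auto simp: uniformizes_def)
  then have fin: "finite_ring q X" using X(1) by (auto simp: hyperbolic_ring_def infinite_ring_def)
  then have R: "R > 0" "cosh r = q * cosh R" "center X \<in> hyp_plane"
    "inner X = hyp_circle (center X) \<bar>r\<bar>" "outer X = hyp_circle (center X) R"
    using rR unfolding finite_ring_def by auto
  define C where "C = (1 / cosh R) *\<^sub>R hpt (center X)"
  have c: "cosh R > 0" using cosh_real_pos by blast
  have "C = (1 / cosh R * (1 / (1 - (norm (center X))\<^sup>2))) *\<^sub>R cone_vec (center X)" by (simp add: C_def hpt_def)
  moreover have "1 / cosh R * (1 / (1 - (norm (center X))\<^sup>2)) > 0" using c disc_pos[OF R(3)] by simp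
  moreover have "norm (center X) \<le> 1" using R(3) by (simp add: hyp_plane_def)
  ultimately have "ring_vec q X C"
    unfolding ring_vec_def R(4,5) C_def using finite_ring_circles[OF R(3,2,1)] by blast
  moreover have "mink C C = - (q\<^sup>2 * (jacobi_sn q \<gamma>)\<^sup>2)"
    using False q by (simp add: C_def hpt_unit[OF R(3)] rR(3) power2_eq_square)
  ultimately show ?thesis by blast
next
  case True
  then have "Rad X = \<infinity>" using X(2) by (auto simp: uniformizes_def)
  then have "infinite_ring q X" using X(1) by (auto simp: hyperbolic_ring_def finite_ring_def)
  then obtain s where s: "s > 0" "norm (center X) = 1"
    "inner X = horocycle (center X) (q * s)" "outer X = horocycle (center X) (1 * s)"
    unfolding infinite_ring_def by auto
  have "ring_vec q X ((1 / (2 * s)) *\<^sub>R cone_vec (center X))"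
    unfolding ring_vec_def s(3,4) horocycle_mink[OF s(2,1)] using s(1,2)
    by (intro conjI exI[of _ "1 / (2 * s)"]) auto
  moreover have "mink (cone_vec (center X)) (cone_vec (center X)) = 0"
    using s(2) unfolding mink_cone_vec by (simp add: cmod_power2[symmetric] power2_eq_square[symmetric])
  ultimately show ?thesis using True by (intro exI[of _ "(1 / (2 * s)) *\<^sub>R cone_vec (center X)"]) simp
qed

lemma ring_vec_build:
  assumes q: "0 < q" "q \<le> 1" and \<gamma>: "\<gamma> \<in> uniformizing_interval q"
    and C: "future C" "mink C C = - (q\<^sup>2 * (jacobi_sn q \<gamma>)\<^sup>2)"
  shows "\<exists>X. ring_vec q X C \<and> hyperbolic_ring q X \<and> uniformizes q \<gamma> X"
proof -
  have q0: "0 \<le> q" using q by simp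
  define s c d where defs: "s = jacobi_sn q \<gamma>" "c = jacobi_cn q \<gamma>" "d = jacobi_dn q \<gamma>"
  have s0: "0 \<le> s" using sn_nonneg[OF q0 q(2) \<gamma>] by (simp add: defs)
  note rel = jacobi_relations[OF q0 q(2), of \<gamma>, folded defs]
  have d: "d > 0" using dn_positive[OF q0 q(2)] by (simp add: defs)
  obtain a k where a: "k > 0" "norm a \<le> 1" "C = k *\<^sub>R cone_vec a" "mink C C < 0 \<Longrightarrow> norm a < 1" "mink C C = 0 \<Longrightarrow> norm a = 1"
    using future_causal_center[OF C(1)] by blast
  show ?thesis
  proof (cases "s = 0")
    case False
    then have s: "s > 0" using s0 by simp
    have qs: "q * s > 0" using q s by simp
    have "mink C C < 0" using C(2) q s by (simp add: defs)
    then have disc: "a \<in> hyp_plane" using a(4) by (simp add: hyp_plane_def)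
    have "(q * s)\<^sup>2 < 1" using d rel(2) by (simp add: power_mult_distrib) (smt (verit) zero_less_power)
    then have qs1: "q * s < 1" using qs by (simp add: abs_square_less_1)
    define R where "R = arcosh (1 / (q * s))"
    define r where "r = arsinh (c / s)"
    have cR: "cosh R = 1 / (q * s)" using qs qs1 by (simp add: R_def cosh_arcosh_real)
    have R: "R > 0"
    proof -
      have "R \<ge> 0" using qs qs1 unfolding R_def by (intro arcosh_nonneg_real) simp
      moreover have "R \<noteq> 0" using cR qs1 qs by auto
      ultimately show ?thesis by simp
    qed
    have sr: "sinh r = c / s" by (simp add: r_def)
    have "(cosh r)\<^sup>2 = (1 / s)\<^sup>2" using s rel(1) by (simp add: cosh_square_eq sr power_divide field_simps)
    then have cr: "cosh r = 1 / s" using s by (simp add: power2_eq_iff_nonneg)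
    have "(sinh R)\<^sup>2 = (d / (q * s))\<^sup>2"
    proof -
      define x where "x = q * s"
      have "x > 0" "d\<^sup>2 = 1 - x\<^sup>2" using qs rel(2) by (auto simp: x_def power_mult_distrib)
      then show ?thesis
        unfolding x_def[symmetric] sinh_square_eq cR by (simp add: power_divide field_simps)
    qed
    then have "sinh R = d / (q * s)" using R d qs by (simp add: power2_eq_iff_nonneg)
    then have tR: "tanh R = d" using q s by (simp add: tanh_def cR)
    have crR: "cosh r = q * cosh R" using cr cR q by simp
    have "\<bar>r\<bar> \<le> R"
    proof -
      have "cosh \<bar>r\<bar> \<le> cosh R" using crR q cosh_real_pos[of R] mult_right_mono[of q 1 "cosh R"] by simp
      then show ?thesis using R by (subst (asm) cosh_real_nonneg_le_iff) auto
    qed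
    define X where "X = \<lparr>center = a, inner = hyp_circle a \<bar>r\<bar>, outer = hyp_circle a R, rad = ereal r, Rad = ereal R\<rparr>"
    have "C = (k * (1 - (norm a)\<^sup>2)) *\<^sub>R hpt a" using disc_pos[OF disc] by (simp add: hpt_def a(3))
    moreover have "k * (1 - (norm a)\<^sup>2) = q * s"
    proof -
      have "(k * (1 - (norm a)\<^sup>2))\<^sup>2 = (q * s)\<^sup>2"
        using C(2) hpt_unit(1)[OF disc] by (simp add: \<open>C = _ *\<^sub>R hpt a\<close> power2_eq_square defs)
      then show ?thesis using a(1) disc_pos[OF disc] qs by (simp add: power2_eq_iff_nonneg)
    qed
    ultimately have Ch: "C = (1 / cosh R) *\<^sub>R hpt a" using cR by simp
    have "ring_vec q X C"
      unfolding ring_vec_def X_def using a finite_ring_circles[OF disc crR R] Ch by auto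
    moreover have "hyperbolic_ring q X"
      unfolding hyperbolic_ring_def finite_ring_def X_def using R \<open>\<bar>r\<bar> \<le> R\<close> crR disc by auto
    moreover have "uniformizes q \<gamma> X"
      unfolding uniformizes_def X_def using \<gamma> False cR tR sr by (simp add: defs)
    ultimately show ?thesis by blast
  next
    case True
    then have n: "norm a = 1" using a(5) C(2) by (simp add: defs)
    define t where "t = 1 / (2 * k)"
    have t: "t > 0" "1 / (2 * t) = k" using a(1) by (auto simp: t_def)
    define X where "X = \<lparr>center = a, inner = horocycle a (q * t), outer = horocycle a (1 * t),
      rad = (if c > 0 then \<infinity> else - \<infinity>), Rad = (\<infinity>::ereal)\<rparr>"
    have "ring_vec q X C"
      unfolding ring_vec_def X_def using horocycle_mink[OF n t(1), of q] horocycle_mink[OF n t(1), of 1] a(1,2,3) t(2)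
      by auto
    moreover have "hyperbolic_ring q X"
      unfolding hyperbolic_ring_def infinite_ring_def X_def using n t(1) by auto
    moreover have "uniformizes q \<gamma> X"
      unfolding uniformizes_def X_def using \<gamma> True by (simp add: defs)
    ultimately show ?thesis by blast
  qed
qed

lemma ring_vec_angles:
  assumes X: "ring_vec q X C" and Y: "ring_vec q Y C'" and z: "z \<in> hyp_plane"
  obtains \<kappa> where "\<kappa> > 0"
    "Re (cnj (hyp_dir z (center X)) * hyp_dir z (center Y)) = \<kappa> * (mink C C' + mink C (hpt z) * mink C' (hpt z))"
    "Im (cnj (hyp_dir z (center X)) * hyp_dir z (center Y)) = \<kappa> * det3 C C' (hpt z)"
proof -
  obtain k k' where "k > 0" "norm (center X) \<le> 1" "C = k *\<^sub>R cone_vec (center X)"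
    "k' > 0" "norm (center Y) \<le> 1" "C' = k' *\<^sub>R cone_vec (center Y)"
    using X Y by (auto simp: ring_vec_def)
  from hyp_dir_mink[OF z this] show thesis using that by blast
qed

lemma ccw_from_ring_vec:
  assumes X: "ring_vec q X C" and z: "z \<in> hyp_plane" "w \<in> hyp_plane"
  shows "ccw_from (center X) z w \<longleftrightarrow> det3 C (hpt z) (hpt w) > 0"
proof -
  obtain k where k: "k > 0" "C = k *\<^sub>R cone_vec (center X)" "norm (center X) \<le> 1" using X by (auto simp: ring_vec_def)
  have w: "1 / (1 - (norm w)\<^sup>2) > 0" "norm w \<le> 1" using disc_pos[OF z(2)] z(2) by (auto simp: hyp_plane_def)
  obtain \<kappa> where "\<kappa> > 0" "Im (cnj (hyp_dir z w) * hyp_dir z (center X)) = \<kappa> * det3 (hpt w) C (hpt z)"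
    using hyp_dir_mink[OF z(1) w(1,2) hpt_def k(1,3,2)] by blast
  then show ?thesis unfolding ccw_from_def by (simp add: zero_less_mult_iff det3_cyclic[of "hpt w"])
qed

section \<open>From a ring pattern to frames\<close>

text \<open>
  The conditions on a pattern in terms of ring vectors \<open>C\<close> and points \<open>p\<close>, stated square by
  square. The product of \<open>det3\<close> with \<open>\<sigma> * \<tau>\<close> expresses the orientation at \<open>v\<close> for all four kinds of
  squares, and the last clause is the external touching of outer circles.
\<close>

definition vec_pattern :: "vertex set \<Rightarrow> real \<Rightarrow> (vertex \<Rightarrow> real) \<Rightarrow> (vertex \<Rightarrow> real^3) \<Rightarrow> (vertex \<Rightarrow> real^3) \<Rightarrow> bool" where
  "vec_pattern S q \<gamma> C p \<longleftrightarrow>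
     (\<forall>x\<in>vertices_Gstar S. mink (p x) (p x) = - 1 \<and> p x $ 3 > 0) \<and>
     (\<forall>v\<in>vertices_G S. mink (C v) (C v) = - (q\<^sup>2 * (jacobi_sn q (\<gamma> v))\<^sup>2)) \<and>
     (\<forall>v \<sigma> \<tau>. square_at S v \<sigma> \<tau> \<longrightarrow>
        mink (C v) (C (opp v \<sigma> \<tau>)) = - q \<and> mink (C v) (p (hx v \<sigma>)) = - q \<and> mink (C v) (p (vy v \<tau>)) = - 1 \<and>
        (jacobi_cn q (\<gamma> v) > 0 \<longrightarrow> of_int \<sigma> * of_int \<tau> * det3 (C v) (p (hx v \<sigma>)) (p (vy v \<tau>)) > 0) \<and>
        (jacobi_cn q (\<gamma> v) < 0 \<longrightarrow> of_int \<sigma> * of_int \<tau> * det3 (C v) (p (hx v \<sigma>)) (p (vy v \<tau>)) < 0)) \<and>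
     (\<forall>v w \<sigma> \<sigma>' \<tau>. square_at S v \<sigma> \<tau> \<and> square_at S w \<sigma>' (- \<tau>) \<and> vy v \<tau> = vy w (- \<tau>) \<longrightarrow>
        det3 (C v) (C w) (p (vy v \<tau>)) = 0 \<and> mink (C v) (C w) < - 1)"

lemma vec_patternD:
  assumes "vec_pattern S q \<gamma> C p"
  shows "x \<in> vertices_Gstar S \<Longrightarrow> mink (p x) (p x) = - 1" "x \<in> vertices_Gstar S \<Longrightarrow> p x $ 3 > 0"
    "v \<in> vertices_G S \<Longrightarrow> mink (C v) (C v) = - (q\<^sup>2 * (jacobi_sn q (\<gamma> v))\<^sup>2)"
    "square_at S v \<sigma> \<tau> \<Longrightarrow> mink (C v) (C (opp v \<sigma> \<tau>)) = - q"
    "square_at S v \<sigma> \<tau> \<Longrightarrow> mink (C v) (p (hx v \<sigma>)) = - q"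
    "square_at S v \<sigma> \<tau> \<Longrightarrow> mink (C v) (p (vy v \<tau>)) = - 1"
    "square_at S v \<sigma> \<tau> \<Longrightarrow> jacobi_cn q (\<gamma> v) > 0 \<Longrightarrow> of_int \<sigma> * of_int \<tau> * det3 (C v) (p (hx v \<sigma>)) (p (vy v \<tau>)) > 0"
    "square_at S v \<sigma> \<tau> \<Longrightarrow> jacobi_cn q (\<gamma> v) < 0 \<Longrightarrow> of_int \<sigma> * of_int \<tau> * det3 (C v) (p (hx v \<sigma>)) (p (vy v \<tau>)) < 0"
    "square_at S v \<sigma> \<tau> \<Longrightarrow> square_at S w \<sigma>' (- \<tau>) \<Longrightarrow> vy v \<tau> = vy w (- \<tau>) \<Longrightarrow> det3 (C v) (C w) (p (vy v \<tau>)) = 0"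
    "square_at S v \<sigma> \<tau> \<Longrightarrow> square_at S w \<sigma>' (- \<tau>) \<Longrightarrow> vy v \<tau> = vy w (- \<tau>) \<Longrightarrow> mink (C v) (C w) < - 1"
  using assms unfolding vec_pattern_def by meson+

text \<open>
  The product of neighbouring ring vectors comes from the point \<open>y\<close> at which the outer circle of one
  ring meets the inner circle of the other: by \<open>ring_vec_angles\<close>, orthogonality there means
  \<open>mink C C' = - mink C y * mink C' y = - q\<close>.
\<close>

lemma pattern_vectors:
  assumes q: "0 < q" "q \<le> 1" and pat: "pattern_with S q \<gamma> X l"
  obtains C where "vec_pattern S q \<gamma> C (\<lambda>x. hpt (l x))" "\<And>v. v \<in> vertices_G S \<Longrightarrow> ring_vec q (X v) (C v)"
proof -
  have ring: "ring_pattern S q X l" and unif: "\<And>v. v \<in> vertices_G S \<Longrightarrow> uniformizes q (\<gamma> v) (X v)"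
    using pat by (auto simp: pattern_with_def)
  note R = ring[unfolded ring_pattern_def]
  have hyp: "hyperbolic_ring q (X v)" if "v \<in> vertices_G S" for v using conjunct1[OF R] that by blast
  note R = conjunct2[OF R]
  have disc: "l x \<in> hyp_plane" if "x \<in> vertices_Gstar S" for x using conjunct1[OF R] that by blast
  note R = conjunct2[OF R]
  have orth: "orthogonal_rings (X v) (X w)" if "v \<in> vertices_G S" "w \<in> neighbours S v" for v w
    using conjunct1[OF R] that by blast
  note R = conjunct2[OF R]
  have inn: "l x \<in> inner (X v)" if "x \<in> vertices_Gstar S" "hor_edge S x v" for x v
    by (rule conjunct1[OF bspec[OF conjunct1[OF R] that(1)], rule_format, OF that(2)])
  have out: "l x \<in> outer (X v)" if "x \<in> vertices_Gstar S" "ver_edge S x v" for x v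
    by (rule conjunct1[OF conjunct2[OF bspec[OF conjunct1[OF R] that(1)]], rule_format, OF that(2)])
  have tch: "touch_externally_at (l x) (center (X v)) (center (X w))"
    if "x \<in> vertices_Gstar S" "ver_edge S x v" "ver_edge S x w" "v \<noteq> w" for x v w
    using conjunct2[OF conjunct2[OF conjunct2[OF bspec[OF conjunct1[OF R] that(1)]]]] that(2-4) by blast
  have ccw: "(rad (X v) > 0 \<longrightarrow> ccw_from (center (X v)) (l x) (l y)) \<and> (rad (X v) < 0 \<longrightarrow> ccw_from (center (X v)) (l y) (l x))"
    if "v \<in> vertices_G S" "(x, y) \<in> consecutive S v" for v x y
    using bspec[OF bspec[OF conjunct2[OF R] that(1)] that(2)] by simp
  define C where "C v = (SOME C. ring_vec q (X v) C \<and> mink C C = - (q\<^sup>2 * (jacobi_sn q (\<gamma> v))\<^sup>2))" for v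
  have C: "ring_vec q (X v) (C v)" "mink (C v) (C v) = - (q\<^sup>2 * (jacobi_sn q (\<gamma> v))\<^sup>2)" if "v \<in> vertices_G S" for v
    using someI_ex[OF ring_vec_exists[OF q hyp[OF that] unif[OF that]]] unfolding C_def by blast+
  have odd_hv: "odd (fst (hx v \<sigma>) + snd (hx v \<sigma>))" "odd (fst (vy v \<tau>) + snd (vy v \<tau>))" if "square_at S v \<sigma> \<tau>" for v \<sigma> \<tau>
    using square_at_vertices(3,4)[OF that] by (auto simp: vertices_Gstar_iff)
  have inner_p: "mink (C v) (hpt (l (hx v \<sigma>))) = - q" if sq: "square_at S v \<sigma> \<tau>" for v \<sigma> \<tau>
  proof -
    have "l (hx v \<sigma>) \<in> inner (X v)"
      using inn square_at_vertices(3)[OF sq] hor_edge_iff[OF odd_hv(1)[OF sq]] sq by blast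
    then show ?thesis using C(1)[OF square_at_vertices(1)[OF sq]] by (simp add: ring_vec_def)
  qed
  have ver: "ver_edge S (vy v \<tau>) v" if sq: "square_at S v \<sigma> \<tau>" for v \<sigma> \<tau>
    using ver_edge_iff[OF odd_hv(2)[OF sq]] sq by blast
  have outer_p: "mink (C v) (hpt (l (vy v \<tau>))) = - 1" if sq: "square_at S v \<sigma> \<tau>" for v \<sigma> \<tau>
    using out[OF square_at_vertices(4)[OF sq] ver[OF sq]] C(1)[OF square_at_vertices(1)[OF sq]] by (simp add: ring_vec_def)
  have orth_p: "mink (C v) (C (opp v \<sigma> \<tau>)) = - q" if sq: "square_at S v \<sigma> \<tau>" for v \<sigma> \<tau>
  proof -
    let ?w = "opp v \<sigma> \<tau>" and ?z = "l (vy v \<tau>)"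
    note V = square_at_vertices[OF sq]
    have "hor_edge S (vy v \<tau>) ?w"
      using hor_edge_iff[OF odd_hv(2)[OF sq]] square_at_opp[OF sq] by (metis opp_simps(2))
    then have "?z \<in> outer (X v) \<inter> inner (X ?w)" using out[OF V(4) ver[OF sq]] inn[OF V(4)] by blast
    moreover have "orthogonal_rings (X v) (X ?w)" using orth[OF V(1)] neighbours_iff[OF V(1)] sq by blast
    ultimately have "Re (cnj (hyp_dir ?z (center (X v))) * hyp_dir ?z (center (X ?w))) = 0"
      unfolding orthogonal_rings_def orthogonal_circles_def by blast
    moreover obtain \<kappa> where "\<kappa> > 0" "Re (cnj (hyp_dir ?z (center (X v))) * hyp_dir ?z (center (X ?w))) =
        \<kappa> * (mink (C v) (C ?w) + mink (C v) (hpt ?z) * mink (C ?w) (hpt ?z))"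
      using ring_vec_angles[OF C(1)[OF V(1)] C(1)[OF V(2)] disc[OF V(4)]] by blast
    moreover have "mink (C ?w) (hpt ?z) = - q" using inner_p[OF square_at_opp[OF sq]] by simp
    ultimately show ?thesis using outer_p[OF sq] by simp
  qed
  have orient: "(jacobi_cn q (\<gamma> v) > 0 \<longrightarrow> of_int \<sigma> * of_int \<tau> * det3 (C v) (hpt (l (hx v \<sigma>))) (hpt (l (vy v \<tau>))) > 0) \<and>
      (jacobi_cn q (\<gamma> v) < 0 \<longrightarrow> of_int \<sigma> * of_int \<tau> * det3 (C v) (hpt (l (hx v \<sigma>))) (hpt (l (vy v \<tau>))) < 0)"
    if sq: "square_at S v \<sigma> \<tau>" for v \<sigma> \<tau>
  proof -
    note V = square_at_vertices[OF sq]
    note sgn = uniformizes_signs[OF q unif[OF V(1)]]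
    note d = disc[OF V(3)] disc[OF V(4)]
    have st: "\<sigma> * \<tau> = 1 \<or> \<sigma> * \<tau> = - 1" using square_at_signs[OF sq] by auto
    define p where "p = (if \<sigma> * \<tau> = 1 then (hx v \<sigma>, vy v \<tau>) else (vy v \<tau>, hx v \<sigma>))"
    have "p \<in> consecutive S v" unfolding consecutive_iff[OF V(1)] p_def using sq by blast
    then have "(jacobi_cn q (\<gamma> v) > 0 \<longrightarrow> ccw_from (center (X v)) (l (fst p)) (l (snd p))) \<and>
        (jacobi_cn q (\<gamma> v) < 0 \<longrightarrow> ccw_from (center (X v)) (l (snd p)) (l (fst p)))"
      using ccw[OF V(1), of "fst p" "snd p"] sgn by simp
    moreover have "(of_int \<sigma> * of_int \<tau> :: real) = of_int (\<sigma> * \<tau>)" by simp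
    ultimately show ?thesis
      using st det3_swap[of "C v" "hpt (l (hx v \<sigma>))" "hpt (l (vy v \<tau>))"]
      unfolding p_def by (auto simp: ccw_from_ring_vec[OF C(1)[OF V(1)]] d simp del: of_int_mult)
  qed
  have touch: "det3 (C v) (C w) (hpt (l (vy v \<tau>))) = 0 \<and> mink (C v) (C w) < - 1"
    if sq: "square_at S v \<sigma> \<tau>" "square_at S w \<sigma>' (- \<tau>)" "vy v \<tau> = vy w (- \<tau>)" for v w \<sigma> \<sigma>' \<tau>
  proof -
    let ?z = "l (vy v \<tau>)"
    note V = square_at_vertices[OF sq(1)] and W = square_at_vertices[OF sq(2)]
    have "v \<noteq> w" using sq(3) square_at_signs(2)[OF sq(1)] by (auto simp: vy_def)
    then have t: "touch_externally_at ?z (center (X v)) (center (X w))"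
      using tch[OF V(4) ver[OF sq(1)]] ver[OF sq(2)] sq(3) by simp
    obtain \<kappa> where \<kappa>: "\<kappa> > 0" "Re (cnj (hyp_dir ?z (center (X v))) * hyp_dir ?z (center (X w))) =
        \<kappa> * (mink (C v) (C w) + mink (C v) (hpt ?z) * mink (C w) (hpt ?z))"
      "Im (cnj (hyp_dir ?z (center (X v))) * hyp_dir ?z (center (X w))) = \<kappa> * det3 (C v) (C w) (hpt ?z)"
      using ring_vec_angles[OF C(1)[OF V(1)] C(1)[OF W(1)] disc[OF V(4)]] by blast
    have "mink (C v) (hpt ?z) = - 1" "mink (C w) (hpt ?z) = - 1" using outer_p[OF sq(1)] outer_p[OF sq(2)] sq(3) by simp_all
    then show ?thesis
      using t \<kappa> unfolding touch_externally_at_def touch_at_def by (simp add: mult_less_0_iff)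
  qed
  show thesis
  proof (rule that)
    show "vec_pattern S q \<gamma> C (\<lambda>x. hpt (l x))"
      unfolding vec_pattern_def using hpt_unit[OF disc] C(2) orth_p inner_p outer_p orient touch by auto
  qed (use C in blast)
qed

text \<open>
  A pattern in terms of frames: the third vector of \<open>F x\<close> is the point at \<open>x\<close>, and its second vector points
  to the upper vertical neighbour.
\<close>

definition framed :: "vertex set \<Rightarrow> real \<Rightarrow> (vertex \<Rightarrow> real) \<Rightarrow> (vertex \<Rightarrow> real^3^3) \<Rightarrow> (vertex \<Rightarrow> real^3) \<Rightarrow> bool" where
  "framed S q \<gamma> F C \<longleftrightarrow> (\<forall>x\<in>vertices_Gstar S. lorentz (F x)) \<and>
     (\<forall>v \<sigma> \<tau>. square_at S v \<sigma> \<tau> \<longrightarrow>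
        F (vy v \<tau>) = F (hx v \<sigma>) ** transition q \<sigma> \<tau> (\<gamma> v) (\<gamma> (opp v \<sigma> \<tau>)) \<and>
        C v = F (hx v \<sigma>) *v pos_h q \<sigma> (\<gamma> v) \<and> C v = F (vy v \<tau>) *v pos_v q \<tau> (\<gamma> v))"

lemma framedD:
  assumes "framed S q \<gamma> F C"
  shows "x \<in> vertices_Gstar S \<Longrightarrow> lorentz (F x)"
    "square_at S v \<sigma> \<tau> \<Longrightarrow> F (vy v \<tau>) = F (hx v \<sigma>) ** transition q \<sigma> \<tau> (\<gamma> v) (\<gamma> (opp v \<sigma> \<tau>))"
    "square_at S v \<sigma> \<tau> \<Longrightarrow> C v = F (hx v \<sigma>) *v pos_h q \<sigma> (\<gamma> v)"
    "square_at S v \<sigma> \<tau> \<Longrightarrow> C v = F (vy v \<tau>) *v pos_v q \<tau> (\<gamma> v)"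
  using assms unfolding framed_def by blast+

lemma square_at_squares:
  assumes "square_at S v \<sigma> \<tau>"
  shows "(of_int \<sigma> :: real)\<^sup>2 = 1" "(of_int \<tau> :: real)\<^sup>2 = 1"
  using square_at_signs[OF assms] by auto

text \<open>
  The frame at \<open>x\<close> is read off from one of its vertical neighbours. The other one gives the same frame
  since the outer circles touch externally; with this the conclusion of the lemma on a single square
  applies to all squares.
\<close>

lemma vec_pattern_framed:
  assumes q: "0 < q" "q \<le> 1" and pat: "vec_pattern S q \<gamma> C p"
  obtains F where "framed S q \<gamma> F C" "\<And>x. x \<in> vertices_Gstar S \<Longrightarrow> F x *v origin = p x"
proof -
  have q0: "0 \<le> q" using q by simp
  note pat = vec_patternD[OF pat]
  have d_pos: "jacobi_dn q a > 0" for a using dn_positive[OF q0 q(2)] .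
  define pick where "pick x = (SOME vt. (\<exists>\<sigma>. square_at S (fst vt) \<sigma> (snd vt)) \<and> x = vy (fst vt) (snd vt))" for x
  have pick: "(\<exists>\<sigma>. square_at S (fst (pick x)) \<sigma> (snd (pick x))) \<and> x = vy (fst (pick x)) (snd (pick x))"
    if x: "x \<in> vertices_Gstar S" for x
  proof -
    have "\<exists>vt. (\<exists>\<sigma>. square_at S (fst vt) \<sigma> (snd vt)) \<and> x = vy (fst vt) (snd vt)"
      using vertices_Gstar_square[OF x] by (metis fst_conv snd_conv)
    from someI_ex[OF this] show ?thesis unfolding pick_def .
  qed
  define F where "F x = (let v = fst (pick x); \<tau> = real_of_int (snd (pick x)) in
    frame ((- \<tau> / jacobi_dn q (\<gamma> v)) *\<^sub>R (C v - p x)) (p x))" for x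
  have F0: "lorentz (F x) \<and> F x *v origin = p x \<and>
      C (fst (pick x)) = F x *v pos_v q (snd (pick x)) (\<gamma> (fst (pick x)))"
    if x: "x \<in> vertices_Gstar S" for x
  proof -
    define v \<tau> where "v = fst (pick x)" and "\<tau> = snd (pick x)"
    obtain \<sigma> where sq: "square_at S v \<sigma> \<tau>" and xv: "x = vy v \<tau>" using pick[OF x] unfolding v_def \<tau>_def by blast
    define d where "d = jacobi_dn q (\<gamma> v)"
    have d: "d > 0" using d_pos by (simp add: d_def)
    have t: "real_of_int \<tau> = 1 \<or> real_of_int \<tau> = - 1" using square_at_signs[OF sq] by auto
    have Cp: "mink (C v) (p x) = - 1" "mink (p x) (C v) = - 1" using pat(6)[OF sq] xv by (simp_all add: mink_commute)
    have CC: "mink (C v) (C v) = d * d - 1"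
      using pat(3)[OF square_at_vertices(1)[OF sq]] jacobi_relations(2)[OF q0 q(2), of "\<gamma> v"]
      by (simp add: d_def power2_eq_square)
    have Fx: "F x = frame ((- \<tau> / d) *\<^sub>R (C v - p x)) (p x)" by (simp add: F_def Let_def v_def \<tau>_def d_def)
    have "lorentz (F x)"
      unfolding Fx
    proof (rule lorentz_frame)
      show "mink ((- \<tau> / d) *\<^sub>R (C v - p x)) ((- \<tau> / d) *\<^sub>R (C v - p x)) = 1"
        using t d pat(1)[OF x] by (auto simp: Cp CC)
      show "mink ((- \<tau> / d) *\<^sub>R (C v - p x)) (p x) = 0" using pat(1)[OF x] Cp by simp
    qed (use pat(1,2)[OF x] in auto)
    moreover have "F x *v origin = p x" unfolding Fx by (rule frame_columns)
    moreover have "C v = F x *v pos_v q \<tau> (\<gamma> v)"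
      unfolding Fx frame_mult pos_v_def d_def[symmetric] using t d by auto
    ultimately show ?thesis by (simp add: v_def \<tau>_def)
  qed
  \<comment> \<open>If \<open>v\<close> is not the chosen neighbour of \<open>x\<close>, the conditions at \<open>x\<close> leave the two opposite positions on the
    vertical line, and external touching excludes the position of the chosen neighbour.\<close>
  have Fv: "C v = F (vy v \<tau>) *v pos_v q \<tau> (\<gamma> v)" if sq: "square_at S v \<sigma> \<tau>" for v \<sigma> \<tau>
  proof -
    define x where "x = vy v \<tau>"
    have x: "x \<in> vertices_Gstar S" using square_at_vertices(4)[OF sq] by (simp add: x_def)
    define w \<tau>' where "w = fst (pick x)" and "\<tau>' = snd (pick x)"
    obtain \<sigma>' where sq': "square_at S w \<sigma>' \<tau>'" and xw: "x = vy w \<tau>'" using pick[OF x] unfolding w_def \<tau>'_def by blast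
    note F = F0[OF x, folded w_def \<tau>'_def]
    show ?thesis
    proof (cases "\<tau>' = \<tau>")
      case True
      then have "w = v" using xw unfolding x_def by (simp add: vy_def prod_eq_iff)
      then show ?thesis using F True by (simp add: x_def)
    next
      case False
      then have neg: "\<tau>' = - \<tau>" using square_at_signs[OF sq] square_at_signs[OF sq'] by auto
      have t: "real_of_int \<tau> = 1 \<or> real_of_int \<tau> = - 1" using square_at_signs[OF sq] by auto
      obtain B where B: "lorentz B" "F x ** B = mat 1" "B ** F x = mat 1" using lorentz_inverse F by blast
      have FB: "F x *v (B *v z) = z" and BF: "B *v (F x *v z) = z" for z by (simp_all add: matrix_vector_mul_assoc B)
      define u where "u = B *v C v"
      define d d' where "d = jacobi_dn q (\<gamma> v)" and "d' = jacobi_dn q (\<gamma> w)"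
      have d: "d > 0" "d' > 0" using d_pos by (auto simp: d_def d'_def)
      have pres: "mink (B *v a) (B *v b) = mink a b" "det3 (B *v a) (B *v b) (B *v c) = det3 a b c" for a b c
        using B(1) by (auto simp: lorentz_def)
      have Bp: "B *v p x = origin" using F BF[of origin] by simp
      have Bw: "B *v C w = vec3 0 (\<tau> * d') 1" using F BF by (simp add: pos_v_def neg d'_def)
      have 1: "mink u origin = - 1" using pat(6)[OF sq] by (simp add: u_def Bp[symmetric] pres x_def)
      have 2: "mink u u = d * d - 1"
        using pat(3)[OF square_at_vertices(1)[OF sq]] jacobi_relations(2)[OF q0 q(2), of "\<gamma> v"]
        by (simp add: u_def pres d_def power2_eq_square)
      have 3: "det3 u (vec3 0 (\<tau> * d') 1) origin = 0" "mink u (vec3 0 (\<tau> * d') 1) < - 1"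
        using pat(9,10)[OF sq sq'[unfolded neg]] xw neg
        by (simp_all add: u_def Bp[symmetric] Bw[symmetric] pres x_def)
      have u3: "u $ 3 = 1" using 1 by (simp add: mink_def)
      have u1: "u $ 1 = 0" using 3(1) t d by (auto simp: det3_def)
      have "u $ 2 * (\<tau> * d') < 0" using 3(2) u1 u3 by (simp add: mink_def)
      then have "\<tau> * u $ 2 < 0" using d by (simp add: mult_less_0_iff zero_less_mult_iff) (smt (verit))
      moreover have "(u $ 2)\<^sup>2 = d\<^sup>2" using 2 u1 u3 by (simp add: mink_def power2_eq_square)
      then have "u $ 2 = d \<or> u $ 2 = - d" by (simp add: power2_eq_iff)
      ultimately have "u $ 2 = - \<tau> * d" using t d by auto
      then have "u = pos_v q \<tau> (\<gamma> v)" by (simp add: vec3_eq_iff pos_v_def u1 u3 d_def)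
      then show ?thesis using FB[of "C v"] by (simp add: u_def x_def)
    qed
  qed
  have main: "F (vy v \<tau>) = F (hx v \<sigma>) ** transition q \<sigma> \<tau> (\<gamma> v) (\<gamma> (opp v \<sigma> \<tau>)) \<and> C v = F (hx v \<sigma>) *v pos_h q \<sigma> (\<gamma> v)"
    if sq: "square_at S v \<sigma> \<tau>" for v \<sigma> \<tau>
  proof -
    let ?w = "opp v \<sigma> \<tau>" and ?T = "transition q \<sigma> \<tau> (\<gamma> v) (\<gamma> (opp v \<sigma> \<tau>))"
    note V = square_at_vertices[OF sq] and so = square_at_opp[OF sq] and signs = square_at_squares[OF sq]
    have FH: "lorentz (F (hx v \<sigma>))" "F (hx v \<sigma>) *v origin = p (hx v \<sigma>)"
      and FV: "lorentz (F (vy v \<tau>))" "F (vy v \<tau>) *v origin = p (vy v \<tau>)" using F0[OF V(3)] F0[OF V(4)] by auto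
    have "C v = F (hx v \<sigma>) *v pos_h q \<sigma> (\<gamma> v) \<and> p (vy v \<tau>) = F (hx v \<sigma>) *v step_point q \<sigma> \<tau> (\<gamma> v) (\<gamma> ?w)"
    proof (rule conjI; rule square_rigid[OF q signs FH(1) FH(2)[symmetric], where Cw = "C ?w"])
      show "C ?w = F (hx v \<sigma>) *v pos_v q (- real_of_int \<tau>) (\<gamma> ?w)" using Fv[OF so] by simp
      then show "C ?w = F (hx v \<sigma>) *v pos_v q (- real_of_int \<tau>) (\<gamma> ?w)" .
    qed (use pat(1,2)[OF V(4)] pat(3)[OF V(1)] pat(4-8)[OF sq] pat(5-8)[OF so] in simp_all)
    then have Cv: "C v = F (hx v \<sigma>) *v pos_h q \<sigma> (\<gamma> v)" and py: "p (vy v \<tau>) = F (hx v \<sigma>) *v step_point q \<sigma> \<tau> (\<gamma> v) (\<gamma> ?w)" by auto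
    have o: "F (vy v \<tau>) *v origin = (F (hx v \<sigma>) ** ?T) *v origin"
      unfolding FV(2) py by (simp add: transition_def frame_columns flip: matrix_vector_mul_assoc)
    have n: "F (vy v \<tau>) *v pos_v q \<tau> (\<gamma> v) = (F (hx v \<sigma>) ** ?T) *v pos_v q \<tau> (\<gamma> v)"
      using Fv[OF sq] Cv by (simp add: transition_pos_v[OF q signs] flip: matrix_vector_mul_assoc)
    have "F (vy v \<tau>) *v vec3 0 1 0 = (F (hx v \<sigma>) ** ?T) *v vec3 0 1 0"
    proof -
      define e where "e = - real_of_int \<tau> * jacobi_dn q (\<gamma> v)"
      have "e \<noteq> 0" using d_pos[of "\<gamma> v"] square_at_signs[OF sq] by (auto simp: e_def)
      have "pos_v q \<tau> (\<gamma> v) = e *\<^sub>R vec3 0 1 0 + origin" by (simp add: pos_v_def vec3_eq_iff e_def)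
      then have "e *\<^sub>R (F (vy v \<tau>) *v vec3 0 1 0) = e *\<^sub>R ((F (hx v \<sigma>) ** ?T) *v vec3 0 1 0)"
        using n o by (simp add: matrix_vector_right_distrib linear_scale[OF matrix_vector_mul_linear])
      then show ?thesis using \<open>e \<noteq> 0\<close> by simp
    qed
    then have "F (vy v \<tau>) = F (hx v \<sigma>) ** ?T"
      using lorentz_eqI FV(1) lorentz_mult[OF FH(1) lorentz_transition[OF q signs]] o by blast
    then show ?thesis using Cv by blast
  qed
  show thesis
  proof (rule that)
    show "framed S q \<gamma> F C" unfolding framed_def using F0 main Fv by blast
  qed (use F0 in blast)
qed

section \<open>The closing condition\<close>

text \<open>On a horocycle the consecutive points move in one direction, so they do not close up.\<close>

lemma internal_ring_finite:
  assumes q: "0 < q" "q \<le> 1" and pat: "vec_pattern S q \<gamma> C p" and v: "internal_vertex S v"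
  shows "jacobi_sn q (\<gamma> v) \<noteq> 0"
proof
  assume s: "jacobi_sn q (\<gamma> v) = 0"
  note sq = internal_vertex_squares[OF v]
  have sq4: "square_at S v 1 1" "square_at S v (-1) 1" "square_at S v (-1) (-1)" "square_at S v 1 (-1)" using sq by auto
  note pat = vec_patternD[OF pat]
  let ?C = "C v" and ?E = "p (hx v 1)" and ?W = "p (hx v (-1))" and ?N = "p (vy v 1)" and ?S = "p (vy v (-1))"
  have CC: "mink ?C ?C = 0" using pat(3)[OF square_at_vertices(1)[OF sq4(1)]] s by simp
  have m: "mink ?C ?E = - q" "mink ?C ?W = - q" "mink ?C ?N = - 1" "mink ?C ?S = - 1"
    using pat(5,6)[OF sq4(1)] pat(5,6)[OF sq4(3)] by auto
  \<comment> \<open>For light-like \<open>c\<close>, this says that \<open>det3 c x y / (mink c x * mink c y)\<close> is additive along a sequence of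
    points: it is the displacement along the horocycles with centre \<open>c\<close>.\<close>
  have id: "mink c z * det3 c x y + mink c x * det3 c y z + mink c y * det3 c z x = det3 x y z * mink c c" for c x y z
    by (simp add: mink_def det3_def algebra_simps)
  have "- q * det3 ?C ?E ?N - q * det3 ?C ?N ?W - det3 ?C ?W ?E = 0"
    using id[of ?C ?W ?E ?N] by (simp add: m CC)
  moreover have "- det3 ?C ?E ?W - q * det3 ?C ?W ?S - q * det3 ?C ?S ?E = 0"
    using id[of ?C ?S ?E ?W] by (simp add: m CC)
  ultimately have "q * (det3 ?C ?E ?N + det3 ?C ?N ?W + det3 ?C ?W ?S + det3 ?C ?S ?E) = 0"
    using det3_swap[of ?C ?E ?W] by (simp add: algebra_simps)
  then have sum: "det3 ?C ?E ?N - det3 ?C ?W ?N + det3 ?C ?W ?S - det3 ?C ?E ?S = 0"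
    using q det3_swap[of ?C ?N ?W] det3_swap[of ?C ?S ?E] by simp
  have "jacobi_cn q (\<gamma> v) \<noteq> 0" using sn_cn_square[of q "\<gamma> v"] s by auto
  then show False
    using sum pat(7,8)[OF sq4(1)] pat(7,8)[OF sq4(2)] pat(7,8)[OF sq4(3)] pat(7,8)[OF sq4(4)]
    by (cases "jacobi_cn q (\<gamma> v) > 0") auto
qed

lemma rotation_eq_id: "rotation t = mat 1 \<Longrightarrow> cos t = 1"
  by (drule arg_cong[where f = "\<lambda>A. A $ 1 $ 1"]) (simp add: rotation_def mat_def)

text \<open>
  Going around an internal vertex, the frames at its centre are rotated by the sum of the
  angles minus \<open>4 * \<pi>/2\<close>, and they have to come back to themselves.
\<close>

lemma internal_vertex_angle_sum:
  assumes q: "0 < q" "q \<le> 1" and fr: "framed S q \<gamma> F C" and v: "internal_vertex S v"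
    and a: "\<gamma> v \<in> uniformizing_interval q" and s: "jacobi_sn q (\<gamma> v) \<noteq> 0"
  shows "(\<Sum>w\<in>neighbours S v. theta q (\<gamma> v) (\<gamma> w)) = 2 * pi"
proof -
  have q0: "0 \<le> q" using q by simp
  have sp: "jacobi_sn q (\<gamma> v) > 0" using sn_nonneg[OF q0 q(2) a] s by simp
  note sq = internal_vertex_squares[OF v]
  define t where "t \<sigma> \<tau> = theta q (\<gamma> v) (\<gamma> (opp v \<sigma> \<tau>))" for \<sigma> \<tau>
  define H where "H \<sigma> = F (hx v \<sigma>) ** center_h q \<sigma> (\<gamma> v)" for \<sigma> :: int
  define V where "V \<tau> = F (vy v \<tau>) ** center_v q \<tau> (\<gamma> v)" for \<tau> :: int
  have step: "V \<tau> = H \<sigma> ** rotation (\<sigma> * \<tau> * (t \<sigma> \<tau> - pi / 2))"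
    if "\<sigma> = 1 \<or> \<sigma> = -1" "\<tau> = 1 \<or> \<tau> = -1" for \<sigma> \<tau> :: int
  proof -
    have sq': "square_at S v \<sigma> \<tau>" using sq that by blast
    from framedD(2)[OF fr sq'] show ?thesis
      using transition_rotation[OF q square_at_squares[OF sq'] sp, of "\<gamma> (opp v \<sigma> \<tau>)"]
      by (simp add: V_def H_def t_def flip: matrix_mul_assoc)
  qed
  have step_back: "H \<sigma> = V \<tau> ** rotation (- (\<sigma> * \<tau> * (t \<sigma> \<tau> - pi / 2)))"
    if "\<sigma> = 1 \<or> \<sigma> = -1" "\<tau> = 1 \<or> \<tau> = -1" for \<sigma> \<tau> :: int
  proof -
    have "rotation 0 = mat 1" by (simp add: rotation_def vec_eq_iff forall_3 mat_def)
    then show ?thesis unfolding step[OF that] by (simp add: rotation_add flip: matrix_mul_assoc)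
  qed
  define \<Sigma> where "\<Sigma> = t 1 1 + t (-1) 1 + t (-1) (-1) + t 1 (-1)"
  have "H 1 = V (-1) ** rotation (t 1 (-1) - pi / 2)" using step_back[of 1 "-1"] by simp
  also have "V (-1) = H (-1) ** rotation (t (-1) (-1) - pi / 2)" using step[of "-1" "-1"] by simp
  also have "H (-1) = V 1 ** rotation (t (-1) 1 - pi / 2)" using step_back[of "-1" 1] by simp
  also have "V 1 = H 1 ** rotation (t 1 1 - pi / 2)" using step[of 1 1] by simp
  finally have "H 1 = H 1 ** rotation (\<Sigma> - 2 * pi)"
    by (simp add: rotation_add \<Sigma>_def algebra_simps flip: matrix_mul_assoc)
  moreover have "lorentz (H 1)"
  proof -
    have "square_at S v 1 1" using sq by simp
    then show ?thesis
      unfolding H_def using framedD(1)[OF fr] lorentz_centers(1)[OF q _ _ sp, of 1 1] square_at_vertices(3)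
      by (intro lorentz_mult) auto
  qed
  then obtain B where "B ** H 1 = mat 1" using lorentz_inverse by blast
  ultimately have "rotation (\<Sigma> - 2 * pi) = mat 1" by (metis matrix_mul_assoc matrix_mul_lid)
  then have "cos (\<Sigma> - 2 * pi) = 1" by (rule rotation_eq_id)
  then obtain n :: int where n: "\<Sigma> - 2 * pi = n * (2 * pi)" by (auto simp: cos_one_2pi_int)
  \<comment> \<open>The sum is between \<open>0\<close> and \<open>4\<pi>\<close>, so \<open>2\<pi>\<close> is the only multiple of \<open>2\<pi>\<close> that it can be.\<close>
  have "0 < t \<sigma> \<tau> \<and> t \<sigma> \<tau> < pi" for \<sigma> \<tau>
    using theta_bounds(1)[OF q0 q(2) a sp] by (simp add: t_def)
  then have "\<bar>\<Sigma> - 2 * pi\<bar> < 2 * pi" unfolding \<Sigma>_def by (smt (verit))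
  then have "\<bar>real_of_int n\<bar> * (2 * pi) < 1 * (2 * pi)" unfolding n by (simp add: abs_mult)
  then have "\<bar>real_of_int n\<bar> < 1" by (rule mult_right_less_imp_less) simp
  then have "\<Sigma> - 2 * pi = 0" using n by simp
  then show ?thesis unfolding internal_vertex_sum[OF v] by (simp add: \<Sigma>_def t_def)
qed

section \<open>Uniqueness\<close>

lemma odd_corners:
  assumes s: "s \<in> S" and x: "x \<in> corners s" "odd (fst x + snd x)" and y: "y \<in> corners s" "odd (fst y + snd y)" "x \<noteq> y"
  obtains v \<sigma> \<tau> where "square_at S v \<sigma> \<tau>" "s = square_of_corner v \<sigma> \<tau>" "x = hx v \<sigma>" "y = vy v \<tau>"
proof -
  define v where "v = (fst y, snd x)"
  have v: "v \<in> corners s" using x(1) y(1) by (auto simp: v_def corners_iff)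
  have "fst x \<noteq> fst y" "snd x \<noteq> snd y"
    using x y by (auto simp: corners_iff prod_eq_iff)
  then have "even (fst v + snd v)" "x \<noteq> v" "y \<noteq> v"
    using x y by (auto simp: v_def corners_iff prod_eq_iff)
  then obtain \<sigma> \<tau> where sq: "square_at S v \<sigma> \<tau>" "s = square_of_corner v \<sigma> \<tau>" using square_at_exists[OF s v] by blast
  have "x \<in> {v, hx v \<sigma>, vy v \<tau>, opp v \<sigma> \<tau>}" "y \<in> {v, hx v \<sigma>, vy v \<tau>, opp v \<sigma> \<tau>}"
    using x(1) y(1) square_at_corners[OF sq(1)] sq(2) by simp_all
  then have "x = hx v \<sigma>" "y = vy v \<tau>"
    using \<open>x \<noteq> v\<close> \<open>y \<noteq> v\<close> square_at_signs[OF sq(1)] by (auto simp: v_def hx_def vy_def opp_def prod_eq_iff)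
  then show thesis using that sq by blast
qed

text \<open>
  The common edge of two squares has one end in \<open>G\<close> and one end in \<open>G\<^sup>*\<close>. Squares that only share a
  vertex in \<open>G\<close> are not coupled in this way, as there is no common frame.
\<close>

lemma adjacent_squares_odd_corner:
  fixes s t :: vertex
  assumes "\<bar>fst s - fst t\<bar> + \<bar>snd s - snd t\<bar> = 1"
  obtains x where "x \<in> corners s" "x \<in> corners t" "odd (fst x + snd x)"
proof -
  define m n where "m = max (fst s) (fst t)" and "n = max (snd s) (snd t)"
  have c: "(m, n) \<in> corners s \<and> (m, n) \<in> corners t"
    using assms by (auto simp: m_def n_def corners_iff max_def abs_if split: if_splits)
  have "fst s = fst t \<or> snd s = snd t" using assms by arith
  then consider "fst s = fst t" | "snd s = snd t" by blast
  then have "(m + 1, n) \<in> corners s \<and> (m + 1, n) \<in> corners t \<or> (m, n + 1) \<in> corners s \<and> (m, n + 1) \<in> corners t"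
  proof cases
    case 1
    then have "m = fst s" "m = fst t" by (auto simp: m_def)
    then show ?thesis using c by (auto simp: corners_iff)
  next
    case 2
    then have "n = snd s" "n = snd t" by (auto simp: n_def)
    then show ?thesis using c by (auto simp: corners_iff)
  qed
  then show thesis using c that[of "(m, n)"] that[of "(m + 1, n)"] that[of "(m, n + 1)"] by auto
qed

text \<open>
  The transformation \<open>G\<close> is chosen to match the frames at one vertex of \<open>G\<^sup>*\<close>. Since the transitions only
  depend on the variables, it then matches the frames at the other such vertex of the same square, and
  via common edges in all squares.
\<close>

lemma framed_unique:
  assumes fr: "framed S q \<gamma> F C" "framed S q \<gamma> F' C'" and conn: "edge_connected S"
  obtains G where "lorentz G" "\<And>x. x \<in> vertices_Gstar S \<Longrightarrow> F' x = G ** F x"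
    "\<And>v. v \<in> vertices_G S \<Longrightarrow> C' v = G *v C v"
proof (cases "S = {}")
  case True
  then show thesis using that[OF lorentz_id] by (simp add: vertices_Gstar_def vertices_G_def)
next
  case False
  then obtain s0 where s0: "s0 \<in> S" by blast
  obtain x0 where x0: "x0 \<in> corners s0" "odd (fst x0 + snd x0)"
  proof (cases "even (fst s0 + snd s0)")
    case True
    then show thesis using that[of "(fst s0 + 1, snd s0)"] by (simp add: corners_iff)
  next
    case False
    then show thesis using that[of s0] by (simp add: corners_iff)
  qed
  then have x0S: "x0 \<in> vertices_Gstar S" using s0 by (auto simp: vertices_Gstar_iff)
  obtain B where B: "lorentz B" "B ** F x0 = mat 1" using lorentz_inverse[OF framedD(1)[OF fr(1) x0S]] by blast
  define G where "G = F' x0 ** B"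
  have G: "lorentz G" unfolding G_def by (rule lorentz_mult[OF framedD(1)[OF fr(2) x0S] B(1)])
  have G0: "F' x0 = G ** F x0" by (simp add: G_def B(2) flip: matrix_mul_assoc)
  have propagate: "F' y = G ** F y"
    if "s \<in> S" "x \<in> corners s" "odd (fst x + snd x)" "y \<in> corners s" "odd (fst y + snd y)" "F' x = G ** F x" for s x y
  proof (cases "x = y")
    case False
    note prem = that
    obtain v \<sigma> \<tau> where sq: "square_at S v \<sigma> \<tau>" and "s = square_of_corner v \<sigma> \<tau>"
      and xy: "x = hx v \<sigma>" "y = vy v \<tau>"
      by (rule odd_corners[OF prem(1-5) False])
    show ?thesis
      unfolding xy framedD(2)[OF fr(1) sq] framedD(2)[OF fr(2) sq] prem(6)[unfolded xy] matrix_mul_assoc ..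
  next
    case True
    then show ?thesis using that(6) by blast
  qed
  define good where "good s \<longleftrightarrow> (\<forall>x\<in>corners s. odd (fst x + snd x) \<longrightarrow> F' x = G ** F x)" for s
  have good0: "good s0" unfolding good_def using propagate[OF s0 x0] G0 by blast
  have good: "good s" if s: "s \<in> S" for s
  proof -
    have "(s0, s) \<in> {(a, b). a \<in> S \<and> b \<in> S \<and> \<bar>fst a - fst b\<bar> + \<bar>snd a - snd b\<bar> = 1}\<^sup>*"
      using conn s0 s unfolding edge_connected_def by blast
    then show ?thesis
    proof (induction rule: rtrancl_induct)
      case base
      show ?case by (rule good0)
    next
      case (step a b)
      then have ab: "a \<in> S" "b \<in> S" "\<bar>fst a - fst b\<bar> + \<bar>snd a - snd b\<bar> = 1" by auto
      obtain x where x: "x \<in> corners a" "x \<in> corners b" "odd (fst x + snd x)" using adjacent_squares_odd_corner[OF ab(3)] by blast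
      then have "F' x = G ** F x" using step.IH unfolding good_def by blast
      then show ?case unfolding good_def using propagate[OF ab(2) x(2,3)] by blast
    qed
  qed
  have GF: "F' x = G ** F x" if "x \<in> vertices_Gstar S" for x
    using that good unfolding vertices_Gstar_iff good_def by blast
  show thesis
  proof (rule that[OF G GF])
    fix v assume "v \<in> vertices_G S"
    then obtain \<sigma> \<tau> where sq: "square_at S v \<sigma> \<tau>" by (rule vertices_G_square)
    show "C' v = G *v C v"
      using framedD(3)[OF fr(1) sq] framedD(3)[OF fr(2) sq] GF[OF square_at_vertices(3)[OF sq]]
      by (simp add: matrix_vector_mul_assoc)
  qed
qed

lemma isometry_image_circle:
  assumes f: "\<And>z. z \<in> hyp_plane \<Longrightarrow> f z \<in> hyp_plane" "\<And>z. z \<in> hyp_plane \<Longrightarrow> hpt (f z) = A *v hpt z" and A: "lorentz A"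
  shows "{z \<in> hyp_plane. mink (A *v C) (hpt z) = k} = f ` {z \<in> hyp_plane. mink C (hpt z) = k}"
proof (rule set_eqI, rule iffI)
  fix w assume w: "w \<in> {z \<in> hyp_plane. mink (A *v C) (hpt z) = k}"
  obtain B where B: "lorentz B" "A ** B = mat 1" using lorentz_inverse[OF A] by blast
  have "future (hpt w)" using hpt_unit w by (simp add: future_def)
  then have "mink (B *v hpt w) (B *v hpt w) = - 1" "(B *v hpt w) $ 3 > 0"
    using B(1) hpt_unit(1) w by (auto simp: lorentz_def future_def)
  then obtain z where z: "z \<in> hyp_plane" "hpt z = B *v hpt w" using hpt_surj by blast
  have Az: "A *v hpt z = hpt w" by (simp add: z(2) matrix_vector_mul_assoc B(2))
  then have "f z = w" using hpt_inj[OF f(1)[OF z(1)]] f(2)[OF z(1)] w by simp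
  moreover have "mink C (hpt z) = k" using w A Az by (metis (mono_tags, lifting) lorentz_def mem_Collect_eq)
  ultimately show "w \<in> f ` {z \<in> hyp_plane. mink C (hpt z) = k}" using z(1) by blast
next
  fix w assume "w \<in> f ` {z \<in> hyp_plane. mink C (hpt z) = k}"
  then show "w \<in> {z \<in> hyp_plane. mink (A *v C) (hpt z) = k}" using f A by (auto simp: lorentz_def)
qed

theorem patterns_congruent:
  assumes q: "0 < q" "q \<le> 1" and pat: "pattern_with S q \<gamma> X l" "pattern_with S q \<gamma> X' l'" and conn: "edge_connected S"
  shows "congruent_patterns S X l X' l'"
proof -
  obtain C where C: "vec_pattern S q \<gamma> C (\<lambda>x. hpt (l x))" "\<And>v. v \<in> vertices_G S \<Longrightarrow> ring_vec q (X v) (C v)"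
    using pattern_vectors[OF q pat(1)] by blast
  obtain C' where C': "vec_pattern S q \<gamma> C' (\<lambda>x. hpt (l' x))" "\<And>v. v \<in> vertices_G S \<Longrightarrow> ring_vec q (X' v) (C' v)"
    using pattern_vectors[OF q pat(2)] by blast
  obtain F where F: "framed S q \<gamma> F C" "\<And>x. x \<in> vertices_Gstar S \<Longrightarrow> F x *v origin = hpt (l x)"
    using vec_pattern_framed[OF q C(1)] by blast
  obtain F' where F': "framed S q \<gamma> F' C'" "\<And>x. x \<in> vertices_Gstar S \<Longrightarrow> F' x *v origin = hpt (l' x)"
    using vec_pattern_framed[OF q C'(1)] by blast
  obtain G where G: "lorentz G" "\<And>x. x \<in> vertices_Gstar S \<Longrightarrow> F' x = G ** F x" "\<And>v. v \<in> vertices_G S \<Longrightarrow> C' v = G *v C v"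
    using framed_unique[OF F(1) F'(1) conn] by blast
  obtain f where f: "hyp_isometry f" "\<And>z. z \<in> hyp_plane \<Longrightarrow> f z \<in> hyp_plane" "\<And>z. z \<in> hyp_plane \<Longrightarrow> hpt (f z) = G *v hpt z"
    using lorentz_isometry[OF G(1)] by blast
  have "inner (X' v) = f ` inner (X v) \<and> outer (X' v) = f ` outer (X v)" if v: "v \<in> vertices_G S" for v
    using C(2)[OF v] C'(2)[OF v] isometry_image_circle[OF f(2,3) G(1)] by (simp add: ring_vec_def G(3)[OF v])
  moreover have "l' x = f (l x)" if x: "x \<in> vertices_Gstar S" for x
  proof (rule hpt_inj)
    have "\<And>X l. pattern_with S q \<gamma> X l \<Longrightarrow> l x \<in> hyp_plane" using x by (simp add: pattern_with_def ring_pattern_def)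
    then show "l' x \<in> hyp_plane" "f (l x) \<in> hyp_plane" and "hpt (l' x) = hpt (f (l x))"
      using pat f(2,3) F(2)[OF x] F'(2)[OF x] G(2)[OF x] by (auto simp flip: matrix_vector_mul_assoc)
  qed
  ultimately show ?thesis unfolding congruent_patterns_def using f(1) by blast
qed

section \<open>Existence\<close>

text \<open>
  The frames around a vertex \<open>v\<close>, relative to each other. If \<open>v\<close> is internal, the product of the four
  transitions is the identity; otherwise one of the squares is missing, and the frames are
  obtained successively from the other three transitions.
\<close>

lemma frames_around_vertex:
  assumes A: "lorentz A1" "lorentz A2" "lorentz A3" "lorentz A4"
    and pos: "A1 *v pN = pE" "A2 *v pN = pW" "A3 *v pS = pW" "A4 *v pS = pE"
    and close: "b1 \<and> b2 \<and> b3 \<and> b4 \<Longrightarrow> \<exists>B2. A2 ** B2 = mat 1 \<and> A1 ** B2 ** A3 = A4"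
  shows "\<exists>hE hN hW hS C. lorentz hE \<and> lorentz hN \<and> lorentz hW \<and> lorentz hS \<and>
    hE *v pE = C \<and> hN *v pN = C \<and> hW *v pW = C \<and> hS *v pS = C \<and>
    (b1 \<longrightarrow> hN = hE ** A1) \<and> (b2 \<longrightarrow> hN = hW ** A2) \<and> (b3 \<longrightarrow> hS = hW ** A3) \<and> (b4 \<longrightarrow> hS = hE ** A4)"
proof -
  obtain B2 where B2: "lorentz B2" "A2 ** B2 = mat 1" "B2 ** A2 = mat 1" using lorentz_inverse[OF A(2)] by blast
  obtain B3 where B3: "lorentz B3" "A3 ** B3 = mat 1" "B3 ** A3 = mat 1" using lorentz_inverse[OF A(3)] by blast
  have "B2 *v pW = pN" by (simp add: pos(2)[symmetric] matrix_vector_mul_assoc B2)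
  moreover have "B3 *v pW = pS" by (simp add: pos(3)[symmetric] matrix_vector_mul_assoc B3)
  ultimately have undo: "B2 *v pW = pN" "B3 *v pW = pS" by auto
  have cancel: "X ** B2 ** A2 = X" "X ** B3 ** A3 = X" for X :: "real^3^3"
    by (simp_all add: B2 B3 flip: matrix_mul_assoc)
  have L: "lorentz (A1 ** B2)" "lorentz (A4 ** B3)" by (intro lorentz_mult A B2(1) B3(1))+
  consider "b1 \<and> b2 \<and> b3 \<and> b4" | "\<not> b4" | "\<not> b1" | "\<not> b2" | "\<not> b3" by blast
  then show ?thesis
  proof cases
    case 1
    then obtain B where B: "A2 ** B = mat 1" "A1 ** B ** A3 = A4" using close by blast
    have "B = B2"
      using B(1) B2(3) by (metis matrix_mul_assoc matrix_mul_lid matrix_mul_rid)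
    then have "A1 ** B2 ** A3 = A4" using B(2) by simp
    then show ?thesis
      using L A lorentz_id
      by (intro exI[of _ "mat 1"] exI[of _ A1] exI[of _ "A1 ** B2"] exI[of _ A4] exI[of _ pE])
        (simp add: pos undo cancel flip: matrix_vector_mul_assoc)
  next
    case 2
    then show ?thesis
      using lorentz_mult[OF L(1) A(3)] L A lorentz_id
      by (intro exI[of _ "mat 1"] exI[of _ A1] exI[of _ "A1 ** B2"] exI[of _ "A1 ** B2 ** A3"] exI[of _ pE])
        (simp add: pos undo cancel flip: matrix_vector_mul_assoc)
  next
    case 3
    then show ?thesis
      using lorentz_mult[OF L(2) A(2)] L A lorentz_id
      by (intro exI[of _ "mat 1"] exI[of _ "A4 ** B3 ** A2"] exI[of _ "A4 ** B3"] exI[of _ A4] exI[of _ pE])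
        (simp add: pos undo cancel flip: matrix_vector_mul_assoc)
  next
    case 4
    then show ?thesis
      using L A lorentz_id
      by (intro exI[of _ "mat 1"] exI[of _ A1] exI[of _ "A4 ** B3"] exI[of _ A4] exI[of _ pE])
        (simp add: pos undo cancel flip: matrix_vector_mul_assoc)
  next
    case 5
    then show ?thesis
      using L A lorentz_id
      by (intro exI[of _ "mat 1"] exI[of _ A1] exI[of _ "A1 ** B2"] exI[of _ A4] exI[of _ pE])
        (simp add: pos undo cancel flip: matrix_vector_mul_assoc)
  qed
qed

text \<open>
  The converse of the closing condition: moved to the centre, the transitions are rotations, with
  total angle \<open>2\<pi> - 4 * \<pi>/2 = 0\<close>.
\<close>

lemma transitions_close:
  assumes q: "0 < q" "q \<le> 1" and s: "0 < jacobi_sn q a"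
    and sum: "theta q a b1 + theta q a b2 + theta q a b3 + theta q a b4 = 2 * pi"
  shows "\<exists>B2. transition q (-1) 1 a b2 ** B2 = mat 1 \<and>
    transition q 1 1 a b1 ** B2 ** transition q (-1) (-1) a b3 = transition q 1 (-1) a b4"
proof -
  let ?A1 = "transition q 1 1 a b1" and ?A2 = "transition q (-1) 1 a b2"
    and ?A3 = "transition q (-1) (-1) a b3" and ?A4 = "transition q 1 (-1) a b4"
  have sg: "(1::real)\<^sup>2 = 1" "(- 1::real)\<^sup>2 = 1" by auto
  have r1: "?A1 ** center_v q 1 a = center_h q 1 a ** rotation (theta q a b1 - pi / 2)"
    using transition_rotation[OF q sg(1) sg(1) s] by simp
  have r2: "?A2 ** center_v q 1 a = center_h q (-1) a ** rotation (- (theta q a b2 - pi / 2))"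
    using transition_rotation[OF q sg(2) sg(1) s] by simp
  have r3: "?A3 ** center_v q (-1) a = center_h q (-1) a ** rotation (theta q a b3 - pi / 2)"
    using transition_rotation[OF q sg(2) sg(2) s] by simp
  have r4: "?A4 ** center_v q (-1) a = center_h q 1 a ** rotation (- (theta q a b4 - pi / 2))"
    using transition_rotation[OF q sg(1) sg(2) s] by simp
  have rot0: "rotation 0 = mat 1" by (simp add: rotation_def vec_eq_iff forall_3 mat_def)
  obtain B2 where B2: "?A2 ** B2 = mat 1" "B2 ** ?A2 = mat 1" using lorentz_inverse[OF lorentz_transition[OF q sg(2) sg(1)]] by metis
  have "?A2 ** (center_v q 1 a ** rotation (theta q a b2 - pi / 2)) = center_h q (-1) a"
    unfolding matrix_mul_assoc r2 by (simp add: rotation_add rot0 flip: matrix_mul_assoc)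
  then have b2: "B2 ** center_h q (-1) a = center_v q 1 a ** rotation (theta q a b2 - pi / 2)"
    by (metis B2(2) matrix_mul_assoc matrix_mul_lid)
  have "(?A1 ** B2 ** ?A3) ** center_v q (-1) a = ?A1 ** (B2 ** (center_h q (-1) a ** rotation (theta q a b3 - pi / 2)))"
    by (simp add: r3 flip: matrix_mul_assoc)
  also have "\<dots> = ?A1 ** (center_v q 1 a ** (rotation (theta q a b2 - pi / 2) ** rotation (theta q a b3 - pi / 2)))"
    by (simp add: matrix_mul_assoc b2)
  also have "\<dots> = center_h q 1 a ** (rotation (theta q a b1 - pi / 2) ** (rotation (theta q a b2 - pi / 2) ** rotation (theta q a b3 - pi / 2)))"
    by (simp add: matrix_mul_assoc r1)
  also have "\<dots> = center_h q 1 a ** rotation (- (theta q a b4 - pi / 2))"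
  proof -
    have "theta q a b1 - pi / 2 + (theta q a b2 - pi / 2 + (theta q a b3 - pi / 2)) = - (theta q a b4 - pi / 2)"
      using sum by simp
    then show ?thesis unfolding rotation_add by simp
  qed
  finally have "(?A1 ** B2 ** ?A3) ** center_v q (-1) a = ?A4 ** center_v q (-1) a" by (simp add: r4)
  moreover obtain D where "center_v q (-1) a ** D = mat 1"
    using lorentz_inverse[OF lorentz_centers(2)[OF q sg(1) sg(2) s]] by blast
  ultimately have "?A1 ** B2 ** ?A3 = ?A4" by (metis matrix_mul_assoc matrix_mul_rid)
  then show ?thesis using B2(1) by blast
qed

text \<open>
  At an infinite ring either all four angles are \<open>0\<close>, or all are \<open>\<pi>\<close>; the sum is \<open>0\<close> or \<open>4\<pi>\<close>.
\<close>

lemma angle_sum_finite: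
  assumes q: "0 < q" "q \<le> 1" and a: "a \<in> uniformizing_interval q"
    and sum: "theta q a b1 + theta q a b2 + theta q a b3 + theta q a b4 = 2 * pi"
  shows "0 < jacobi_sn q a"
proof -
  have q0: "0 \<le> q" using q by simp
  have "jacobi_sn q a \<noteq> 0"
  proof
    assume "jacobi_sn q a = 0"
    then have "theta q a b = (if jacobi_cn q a > 0 then 0 else pi)" for b using theta_bounds(2)[OF q0 q(2) a] by blast
    then show False using sum by (auto split: if_splits)
  qed
  then show ?thesis using sn_nonneg[OF q0 q(2) a] by simp
qed

text \<open>
  The frames around a single vertex, up to a common transformation. These are the pieces that have
  to be glued.
\<close>

lemma vertex_star:
  assumes q: "0 < q" "q \<le> 1" and a: "v \<in> vertices_G S \<Longrightarrow> \<gamma> v \<in> uniformizing_interval q"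
    and closing: "internal_vertex S v \<Longrightarrow> (\<Sum>w\<in>neighbours S v. theta q (\<gamma> v) (\<gamma> w)) = 2 * pi"
  shows "\<exists>h C. \<forall>\<sigma> \<tau>. square_at S v \<sigma> \<tau> \<longrightarrow> lorentz (h (hx v \<sigma>)) \<and> lorentz (h (vy v \<tau>)) \<and>
    h (vy v \<tau>) = h (hx v \<sigma>) ** transition q \<sigma> \<tau> (\<gamma> v) (\<gamma> (opp v \<sigma> \<tau>)) \<and>
    h (hx v \<sigma>) *v pos_h q \<sigma> (\<gamma> v) = C \<and> h (vy v \<tau>) *v pos_v q \<tau> (\<gamma> v) = C"
proof -
  define A where "A \<sigma> \<tau> = transition q \<sigma> \<tau> (\<gamma> v) (\<gamma> (opp v \<sigma> \<tau>))" for \<sigma> \<tau> :: int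
  have LA: "lorentz (A \<sigma> \<tau>)" and pA: "A \<sigma> \<tau> *v pos_v q \<tau> (\<gamma> v) = pos_h q \<sigma> (\<gamma> v)"
    if "\<sigma> = 1 \<or> \<sigma> = -1" "\<tau> = 1 \<or> \<tau> = -1" for \<sigma> \<tau> :: int
    using that lorentz_transition[OF q, of \<sigma> \<tau>] transition_pos_v[OF q, of \<sigma> \<tau>] unfolding A_def by auto
  have close: "\<exists>B2. A (-1) 1 ** B2 = mat 1 \<and> A 1 1 ** B2 ** A (-1) (-1) = A 1 (-1)"
    if b: "square_at S v 1 1 \<and> square_at S v (-1) 1 \<and> square_at S v (-1) (-1) \<and> square_at S v 1 (-1)"
  proof -
    have v: "v \<in> vertices_G S" using b square_at_vertices(1) by blast
    then have int: "internal_vertex S v" using all_squares_internal b by blast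
    have sum: "theta q (\<gamma> v) (\<gamma> (opp v 1 1)) + theta q (\<gamma> v) (\<gamma> (opp v (-1) 1)) +
        theta q (\<gamma> v) (\<gamma> (opp v (-1) (-1))) + theta q (\<gamma> v) (\<gamma> (opp v 1 (-1))) = 2 * pi"
      using closing[OF int] unfolding internal_vertex_sum[OF int] .
    show ?thesis
      using transitions_close[OF q angle_sum_finite[OF q a[OF v] sum] sum] unfolding A_def by simp
  qed
  obtain hE hN hW hS C where h: "lorentz hE" "lorentz hN" "lorentz hW" "lorentz hS"
    "hE *v pos_h q 1 (\<gamma> v) = C" "hN *v pos_v q 1 (\<gamma> v) = C" "hW *v pos_h q (-1) (\<gamma> v) = C" "hS *v pos_v q (-1) (\<gamma> v) = C"
    "square_at S v 1 1 \<longrightarrow> hN = hE ** A 1 1" "square_at S v (-1) 1 \<longrightarrow> hN = hW ** A (-1) 1"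
    "square_at S v (-1) (-1) \<longrightarrow> hS = hW ** A (-1) (-1)" "square_at S v 1 (-1) \<longrightarrow> hS = hE ** A 1 (-1)"
    using frames_around_vertex[OF LA[of 1 1] LA[of "-1" 1] LA[of "-1" "-1"] LA[of 1 "-1"],
        where pN = "pos_v q 1 (\<gamma> v)" and pE = "pos_h q 1 (\<gamma> v)" and pW = "pos_h q (-1) (\<gamma> v)"
          and pS = "pos_v q (-1) (\<gamma> v)" and ?b1.0 = "square_at S v 1 1" and ?b2.0 = "square_at S v (-1) 1"
          and ?b3.0 = "square_at S v (-1) (-1)" and ?b4.0 = "square_at S v 1 (-1)"]
      pA[of 1 1] pA[of "-1" 1] pA[of "-1" "-1"] pA[of 1 "-1"] close
    by simp metis
  define g where "g x = (if x = hx v 1 then hE else if x = hx v (-1) then hW else if x = vy v 1 then hN else hS)" for x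
  have g: "g (hx v 1) = hE" "g (hx v (-1)) = hW" "g (vy v 1) = hN" "g (vy v (-1)) = hS"
    by (auto simp: g_def hx_def vy_def)
  show ?thesis
  proof (intro exI allI impI)
    fix \<sigma> \<tau> assume sq: "square_at S v \<sigma> \<tau>"
    from square_at_signs[OF sq] sq h show "lorentz (g (hx v \<sigma>)) \<and> lorentz (g (vy v \<tau>)) \<and>
      g (vy v \<tau>) = g (hx v \<sigma>) ** transition q \<sigma> \<tau> (\<gamma> v) (\<gamma> (opp v \<sigma> \<tau>)) \<and>
      g (hx v \<sigma>) *v pos_h q \<sigma> (\<gamma> v) = C \<and> g (vy v \<tau>) *v pos_v q \<tau> (\<gamma> v) = C"
      unfolding A_def by (elim disjE) (simp_all add: g)
  qed
qed

subsection \<open>Gluing the frames\<close>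

definition linv :: "real^3^3 \<Rightarrow> real^3^3" where
  "linv A = (SOME B. lorentz B \<and> A ** B = mat 1 \<and> B ** A = mat 1)"

lemma linv:
  assumes "lorentz A"
  shows "lorentz (linv A)" "A ** linv A = mat 1" "linv A ** A = mat 1"
proof -
  have "\<exists>B. lorentz B \<and> A ** B = mat 1 \<and> B ** A = mat 1" using lorentz_inverse[OF assms] by metis
  from someI_ex[OF this] show "lorentz (linv A)" "A ** linv A = mat 1" "linv A ** A = mat 1"
    unfolding linv_def by blast+
qed

lemma linv_cancel:
  assumes "lorentz A"
  shows "X ** A ** linv A = X" "X ** linv A ** A = X"
  using linv[OF assms] by (simp_all flip: matrix_mul_assoc)

text \<open>
  Within a square, the relative frames \<open>h v x\<close> of the vertices \<open>x\<close> of \<open>G\<^sup>*\<close> with respect to a corner \<open>v\<close> in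
  \<open>G\<close> come from a potential.
\<close>

lemma square_potential:
  assumes q: "0 < q" "q \<le> 1" and s: "s \<in> S"
    and h: "\<And>v \<sigma> \<tau>. square_at S v \<sigma> \<tau> \<Longrightarrow> lorentz (h v (hx v \<sigma>)) \<and> lorentz (h v (vy v \<tau>)) \<and>
      h v (vy v \<tau>) = h v (hx v \<sigma>) ** transition q \<sigma> \<tau> (\<gamma> v) (\<gamma> (opp v \<sigma> \<tau>))"
  shows "\<exists>g. (\<forall>a\<in>corners s. lorentz (g a)) \<and>
    (\<forall>v\<in>corners s. \<forall>x\<in>corners s. even (fst v + snd v) \<longrightarrow> odd (fst x + snd x) \<longrightarrow> g v = h v x ** g x)"
proof -
  obtain v where v: "v \<in> corners s" "even (fst v + snd v)"
  proof (cases "even (fst s + snd s)")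
    case True
    then show thesis using that[of s] by (simp add: corners_iff)
  next
    case False
    then show thesis using that[of "(fst s + 1, snd s)"] by (simp add: corners_iff)
  qed
  then obtain \<sigma> \<tau> where sq: "square_at S v \<sigma> \<tau>" "s = square_of_corner v \<sigma> \<tau>" using square_at_exists[OF s] by blast
  let ?x = "hx v \<sigma>" and ?y = "vy v \<tau>" and ?w = "opp v \<sigma> \<tau>"
  note signs = square_at_squares[OF sq(1)]
  define Q Q' where "Q = transition q \<sigma> \<tau> (\<gamma> v) (\<gamma> ?w)" and "Q' = transition q (- real_of_int \<sigma>) (- real_of_int \<tau>) (\<gamma> ?w) (\<gamma> v)"
  have QQ: "Q ** Q' = mat 1" unfolding Q_def Q'_def using transition_opposite[OF q signs] by simp
  have LQ: "lorentz Q'" using lorentz_transition[OF q, of "- \<sigma>" "- \<tau>"] signs by (simp add: Q'_def)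
  note hv = h[OF sq(1), folded Q_def] and hw = h[OF square_at_opp[OF sq(1)], simplified opp_simps, simplified, folded Q'_def]
  define g where "g a = (if a = ?x then mat 1 else if a = ?y then Q' else h a ?x)" for a
  have ne: "v \<noteq> ?x" "v \<noteq> ?y" "?w \<noteq> ?x" "?w \<noteq> ?y" "?y \<noteq> ?x"
    using square_at_signs[OF sq(1)] by (auto simp: hx_def vy_def opp_def prod_eq_iff)
  have g: "g ?x = mat 1" "g ?y = Q'" "g v = h v ?x" "g ?w = h ?w ?x" using ne by (auto simp: g_def)
  have c: "corners s = {v, ?x, ?y, ?w}" using square_at_corners[OF sq(1)] sq(2) by simp
  have par: "odd (fst ?x + snd ?x)" "odd (fst ?y + snd ?y)" "even (fst ?w + snd ?w)"
    using square_at_vertices[OF sq(1)] by (auto simp: vertices_G_iff vertices_Gstar_iff)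
  have "lorentz (g a)" if "a \<in> corners s" for a
    using that hv hw LQ lorentz_id unfolding c by (auto simp: g)
  moreover have "g v = h v ?x ** g ?x" "g v = h v ?y ** g ?y" "g ?w = h ?w ?x ** g ?x" "g ?w = h ?w ?y ** g ?y"
    using hv hw QQ by (simp_all add: g flip: matrix_mul_assoc)
  ultimately have "(\<forall>a\<in>corners s. lorentz (g a)) \<and>
    (\<forall>v\<in>corners s. \<forall>x\<in>corners s. even (fst v + snd v) \<longrightarrow> odd (fst x + snd x) \<longrightarrow> g v = h v x ** g x)"
    unfolding c using par v(2) by auto
  then show ?thesis by blast
qed

text \<open>
  Each square has a potential, and \<open>K s a b\<close> is the change of frames from \<open>a\<close> to \<open>b\<close> within the square
  \<open>s\<close>. On an edge it is the relative frame of the edge, which has been fixed at the end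
  of the edge in \<open>G\<close> and is the same for both squares at the edge. So the \<open>K s a b\<close> form a local system, and
  its global section consists of the frames.
\<close>

theorem frames_exist:
  assumes q: "0 < q" "q \<le> 1" and sc: "simply_connected (cells S)"
    and a: "\<And>v. v \<in> vertices_G S \<Longrightarrow> \<gamma> v \<in> uniformizing_interval q"
    and closing: "\<And>v. internal_vertex S v \<Longrightarrow> (\<Sum>w\<in>neighbours S v. theta q (\<gamma> v) (\<gamma> w)) = 2 * pi"
  obtains F C where "framed S q \<gamma> F C"
proof -
  define star where "star v hC \<longleftrightarrow> (\<forall>\<sigma> \<tau>. square_at S v \<sigma> \<tau> \<longrightarrow> lorentz (fst hC (hx v \<sigma>)) \<and> lorentz (fst hC (vy v \<tau>)) \<and>
    fst hC (vy v \<tau>) = fst hC (hx v \<sigma>) ** transition q \<sigma> \<tau> (\<gamma> v) (\<gamma> (opp v \<sigma> \<tau>)) \<and>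
    fst hC (hx v \<sigma>) *v pos_h q \<sigma> (\<gamma> v) = snd hC \<and> fst hC (vy v \<tau>) *v pos_v q \<tau> (\<gamma> v) = snd hC)"
    for v and hC :: "(vertex \<Rightarrow> real^3^3) \<times> (real^3)"
  have "\<exists>hC. star v hC" for v
  proof -
    have "\<exists>h C. star v (h, C)"
      unfolding star_def fst_conv snd_conv by (rule vertex_star[OF q]) (fact a, fact closing)
    then show ?thesis by blast
  qed
  then obtain hC where star: "\<And>v. star v (hC v)" by metis
  define h where "h v = fst (hC v)" for v
  define C0 where "C0 v = snd (hC v)" for v
  have h: "lorentz (h v (hx v \<sigma>)) \<and> lorentz (h v (vy v \<tau>)) \<and>
      h v (vy v \<tau>) = h v (hx v \<sigma>) ** transition q \<sigma> \<tau> (\<gamma> v) (\<gamma> (opp v \<sigma> \<tau>))"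
    and hC0: "h v (hx v \<sigma>) *v pos_h q \<sigma> (\<gamma> v) = C0 v" "h v (vy v \<tau>) *v pos_v q \<tau> (\<gamma> v) = C0 v"
    if "square_at S v \<sigma> \<tau>" for v \<sigma> \<tau>
    using star[of v] that unfolding star_def h_def C0_def by blast+
  define pot where "pot s g \<longleftrightarrow> (\<forall>a\<in>corners s. lorentz (g a)) \<and>
    (\<forall>v\<in>corners s. \<forall>x\<in>corners s. even (fst v + snd v) \<longrightarrow> odd (fst x + snd x) \<longrightarrow> g v = h v x ** g x)"
    for s and g :: "vertex \<Rightarrow> real^3^3"
  have "\<exists>g. pot s g" if "s \<in> S" for s
    unfolding pot_def by (rule square_potential[OF q that h])
  then obtain g where pot: "\<And>s. s \<in> S \<Longrightarrow> pot s (g s)" by metis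
  have g: "\<And>s a. s \<in> S \<Longrightarrow> a \<in> corners s \<Longrightarrow> lorentz (g s a)"
    "\<And>s v x. s \<in> S \<Longrightarrow> v \<in> corners s \<Longrightarrow> x \<in> corners s \<Longrightarrow> even (fst v + snd v) \<Longrightarrow> odd (fst x + snd x) \<Longrightarrow> g s v = h v x ** g s x"
    using pot unfolding pot_def by blast+
  define K where "K s a b = g s a ** linv (g s b)" for s a b
  have K_comp: "K s a b ** K s b d = K s a d" if "s \<in> S" "a \<in> corners s" "b \<in> corners s" "d \<in> corners s" for s a b d
    by (simp add: K_def matrix_mul_assoc linv_cancel(2)[OF g(1)[OF that(1,3)]])
  have K_refl: "K s a a = mat 1" if "s \<in> S" "a \<in> corners s" for s a using linv[OF g(1)[OF that]] by (simp add: K_def)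
  have K_lorentz: "lorentz (K s a b)" if "s \<in> S" "a \<in> corners s" "b \<in> corners s" for s a b
    unfolding K_def by (rule lorentz_mult[OF g(1)[OF that(1,2)] linv(1)[OF g(1)[OF that(1,3)]]])
  have K_edge: "K s v x = h v x" if "s \<in> S" "v \<in> corners s" "x \<in> corners s" "even (fst v + snd v)" "odd (fst x + snd x)" for s v x
    by (simp add: K_def g(2)[OF that] linv_cancel(1)[OF g(1)[OF that(1,3)]])
  have K_swap: "K s a b = K s' a b"
    if "s \<in> S" "s' \<in> S" "a \<in> corners s" "b \<in> corners s" "a \<in> corners s'" "b \<in> corners s'" "K s b a = K s' b a" for s s' a b
  proof -
    have "K s a b = K s a b ** (K s' b a ** K s' a b)" using K_comp[of s' b a b] K_refl[of s' b] that by simp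
    also have "\<dots> = (K s a b ** K s b a) ** K s' a b" using that(7) by (simp add: matrix_mul_assoc)
    also have "\<dots> = K s' a b" using K_comp[of s a b a] K_refl[of s a] that by simp
    finally show ?thesis .
  qed
  have K_indep: "K s a b = K s' a b"
    if "s \<in> S" "s' \<in> S" "a \<in> corners s" "b \<in> corners s" "a \<in> corners s'" "b \<in> corners s'" for s s' a b
  proof (cases "even (fst a + snd a) = even (fst b + snd b)")
    case ne: False
    show ?thesis
    proof (cases "even (fst a + snd a)")
      case True
      then have "odd (fst b + snd b)" using ne by blast
      from K_edge[OF that(1,3,4) True this] K_edge[OF that(2,5,6) True this] show ?thesis by (rule trans[OF _ sym])
    next
      case False
      then have "even (fst b + snd b)" using ne by blast
      from K_edge[OF that(1,4,3) this False] K_edge[OF that(2,6,5) this False] have "K s b a = K s' b a" by (rule trans[OF _ sym])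
      then show ?thesis by (rule K_swap[OF that])
    qed
  next
    case True
    show ?thesis
    proof (cases "a = b")
      case False
      then have "fst a \<noteq> fst b \<and> snd a \<noteq> snd b"
        using True that(3,4) by (auto simp: corners_iff prod_eq_iff)
      then have "s = s'" using that(3-6) by (auto simp: corners_iff prod_eq_iff)
      then show ?thesis by simp
    qed (use K_refl that in simp)
  qed
  define c where "c a b t = t ** K (SOME s. s \<in> S \<and> a \<in> corners s \<and> b \<in> corners s) a b"
    for a b and t :: "real^3^3"
  have c: "c a b t = t ** K s a b" if "s \<in> S" "a \<in> corners s" "b \<in> corners s" for s a b t
  proof -
    let ?P = "\<lambda>s. s \<in> S \<and> a \<in> corners s \<and> b \<in> corners s"
    have P: "?P (SOME s. ?P s)" by (rule someI[of ?P s]) (use that in blast)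
    have "K (SOME s. ?P s) a b = K s a b"
      by (rule K_indep) (use P that in simp_all)
    then show ?thesis unfolding c_def by (rule arg_cong)
  qed
  interpret local_system S c lorentz
  proof
    fix s a t assume "s \<in> S" "a \<in> corners s"
    then show "c a a t = t" using c K_refl by simp
  next
    fix s a b d t assume "s \<in> S" "a \<in> corners s" "b \<in> corners s" "d \<in> corners s"
    then show "c b d (c a b t) = c a d t" using c K_comp by (simp flip: matrix_mul_assoc)
  next
    fix s a b t assume "s \<in> S" "a \<in> corners s" "b \<in> corners s" "lorentz t"
    then show "lorentz (c a b t)" using c K_lorentz lorentz_mult by simp
  qed
  obtain T where T: "\<And>s a. s \<in> S \<Longrightarrow> a \<in> corners s \<Longrightarrow> lorentz (T a)"
    "\<And>s a b. s \<in> S \<Longrightarrow> a \<in> corners s \<Longrightarrow> b \<in> corners s \<Longrightarrow> T b = c a b (T a)"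
    using global_section[OF sc lorentz_id] by blast
  define C where "C v = T v *v C0 v" for v
  have "framed S q \<gamma> T C"
    unfolding framed_def
  proof (intro conjI ballI allI impI)
    fix x assume "x \<in> vertices_Gstar S"
    then obtain s where "s \<in> S" "x \<in> corners s" unfolding vertices_Gstar_iff by blast
    then show "lorentz (T x)" by (rule T(1))
  next
    fix v \<sigma> \<tau> assume sq: "square_at S v \<sigma> \<tau>"
    let ?s = "square_of_corner v \<sigma> \<tau>"
    have s: "?s \<in> S" using sq by (simp add: square_at_def)
    note V = square_at_vertices[OF sq] and c4 = square_at_corners[OF sq]
    have "T x = T v ** h v x" if "x = hx v \<sigma> \<or> x = vy v \<tau>" for x
    proof -
      have x: "v \<in> corners ?s" "x \<in> corners ?s" "even (fst v + snd v)" "odd (fst x + snd x)"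
        using that c4 V by (auto simp: vertices_G_iff vertices_Gstar_iff)
      then show ?thesis using T(2)[OF s x(1,2)] c[OF s x(1,2)] K_edge[OF s x] by simp
    qed
    then have Tx: "T (hx v \<sigma>) = T v ** h v (hx v \<sigma>)" "T (vy v \<tau>) = T v ** h v (vy v \<tau>)" by auto
    note hs = h[OF sq] hC0[OF sq]
    show "T (vy v \<tau>) = T (hx v \<sigma>) ** transition q \<sigma> \<tau> (\<gamma> v) (\<gamma> (opp v \<sigma> \<tau>))"
      unfolding Tx using hs by (simp flip: matrix_mul_assoc)
    show "C v = T (hx v \<sigma>) *v pos_h q \<sigma> (\<gamma> v)" "C v = T (vy v \<tau>) *v pos_v q \<tau> (\<gamma> v)"
      unfolding Tx C_def using hs by (simp_all flip: matrix_vector_mul_assoc)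
  qed
  then show thesis by (rule that)
qed

subsection \<open>From frames to a ring pattern\<close>

text \<open>
  All conditions at a point or in a square are invariant under Lorentz transformations, so they can be
  checked in the coordinates of the frame, where the vectors are explicit.
\<close>

lemma pattern_from_frames:
  assumes q: "0 < q" "q \<le> 1" and fr: "framed S q \<gamma> F C"
    and a: "\<And>v. v \<in> vertices_G S \<Longrightarrow> \<gamma> v \<in> uniformizing_interval q"
  obtains X l where "pattern_with S q \<gamma> X l"
proof -
  have q0: "0 \<le> q" using q by simp
  note fr = framedD[OF fr]
  have d_pos: "jacobi_dn q a > 0" for a using dn_positive[OF q0 q(2)] .
  have pres: "mink (F x *v y) (F x *v z) = mink y z" "det3 (F x *v y) (F x *v z) (F x *v u) = det3 y z u" "future y \<Longrightarrow> future (F x *v y)"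
    if "x \<in> vertices_Gstar S" for x y z u
    using fr(1)[OF that] by (auto simp: lorentz_def)
  have C: "mink (C v) (C v) = - (q\<^sup>2 * (jacobi_sn q (\<gamma> v))\<^sup>2) \<and> future (C v)" if "v \<in> vertices_G S" for v
  proof -
    obtain \<sigma> \<tau> where sq: "square_at S v \<sigma> \<tau>" using vertices_G_square[OF \<open>v \<in> vertices_G S\<close>] .
    have m: "mink (pos_h q \<sigma> (\<gamma> v)) (pos_h q \<sigma> (\<gamma> v)) = - (q\<^sup>2 * (jacobi_sn q (\<gamma> v))\<^sup>2)"
      using square_at_signs[OF sq]
      by (auto simp: pos_h_def mink_def jacobi_relations(1)[OF q0 q(2), THEN square_rewrites(1)]
          jacobi_relations(1)[OF q0 q(2), THEN square_rewrites(2)] power2_eq_square algebra_simps)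
    moreover have "future (pos_h q \<sigma> (\<gamma> v))" unfolding future_def m using q by (simp add: pos_h_def)
    ultimately show ?thesis
      unfolding fr(3)[OF sq] using pres square_at_vertices(3)[OF sq] by simp
  qed
  define X where "X v = (SOME X. ring_vec q X (C v) \<and> hyperbolic_ring q X \<and> uniformizes q (\<gamma> v) X)" for v
  have X: "ring_vec q (X v) (C v)" "hyperbolic_ring q (X v)" "uniformizes q (\<gamma> v) (X v)" if "v \<in> vertices_G S" for v
    using someI_ex[OF ring_vec_build[OF q a[OF that]]] C[OF that] unfolding X_def by blast+
  define l where "l x = (SOME z. z \<in> hyp_plane \<and> hpt z = F x *v origin)" for x
  have l: "l x \<in> hyp_plane" "hpt (l x) = F x *v origin" if x: "x \<in> vertices_Gstar S" for x
  proof -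
    have "mink origin origin = - 1" "future origin" by (auto simp: mink_def future_def)
    then have "mink (F x *v origin) (F x *v origin) = - 1" "(F x *v origin) $ 3 > 0"
      using pres[OF x] by (auto simp: future_def)
    then have "\<exists>z. z \<in> hyp_plane \<and> hpt z = F x *v origin" using hpt_surj by metis
    from someI_ex[OF this] show "l x \<in> hyp_plane" "hpt (l x) = F x *v origin" unfolding l_def by blast+
  qed
  have inn: "l (hx v \<sigma>) \<in> inner (X v)" and out: "l (vy v \<tau>) \<in> outer (X v)"
    and Cl: "mink (C v) (hpt (l (hx v \<sigma>))) = - q" "mink (C v) (hpt (l (vy v \<tau>))) = - 1"
    if sq: "square_at S v \<sigma> \<tau>" for v \<sigma> \<tau>
  proof -
    note V = square_at_vertices[OF sq]
    show 1: "mink (C v) (hpt (l (hx v \<sigma>))) = - q"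
      unfolding fr(3)[OF sq] l(2)[OF V(3)] pres[OF V(3)] by (simp add: pos_h_def mink_def)
    show 2: "mink (C v) (hpt (l (vy v \<tau>))) = - 1"
      unfolding fr(4)[OF sq] l(2)[OF V(4)] pres[OF V(4)] by (simp add: pos_v_def mink_def)
    show "l (hx v \<sigma>) \<in> inner (X v)" "l (vy v \<tau>) \<in> outer (X v)"
      using X(1)[OF V(1)] l(1)[OF V(3)] l(1)[OF V(4)] 1 2 by (simp_all add: ring_vec_def)
  qed
  have orth: "orthogonal_circles (outer (X v)) (center (X v)) (inner (X (opp v \<sigma> \<tau>))) (center (X (opp v \<sigma> \<tau>)))"
    if sq: "square_at S v \<sigma> \<tau>" for v \<sigma> \<tau>
  proof -
    let ?w = "opp v \<sigma> \<tau>"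
    note V = square_at_vertices[OF sq] and so = square_at_opp[OF sq]
    have Cw: "C ?w = F (hx v \<sigma>) *v pos_v q (- \<tau>) (\<gamma> ?w)" using fr(4)[OF so] by simp
    have "mink (C v) (C ?w) = - q"
      unfolding fr(3)[OF sq] Cw pres[OF V(3)] by (simp add: pos_h_def pos_v_def mink_def)
    moreover have "mink (C v) (hpt z) * mink (C ?w) (hpt z) = q" and "z \<in> hyp_plane"
      if "z \<in> outer (X v) \<inter> inner (X ?w)" for z
      using that X(1)[OF V(1)] X(1)[OF V(2)] by (auto simp: ring_vec_def)
    ultimately have "Re (cnj (hyp_dir z (center (X v))) * hyp_dir z (center (X ?w))) = 0"
      if "z \<in> outer (X v) \<inter> inner (X ?w)" for z
      using that ring_vec_angles[OF X(1)[OF V(1)] X(1)[OF V(2)], of z] by (metis add.left_inverse mult_zero_right)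
    moreover have "l (vy v \<tau>) \<in> outer (X v) \<inter> inner (X ?w)" using out[OF sq] inn[OF so] by simp
    ultimately show ?thesis unfolding orthogonal_circles_def by blast
  qed
  have orth_rings: "orthogonal_rings (X v) (X w)" if v: "v \<in> vertices_G S" and w: "w \<in> neighbours S v" for v w
  proof -
    obtain \<sigma> \<tau> where sq: "square_at S v \<sigma> \<tau>" "w = opp v \<sigma> \<tau>" using neighbours_iff[OF v] w by blast
    show ?thesis unfolding orthogonal_rings_def using orth[OF sq(1)] orth[OF square_at_opp[OF sq(1)]] sq(2) by simp
  qed
  have touch: "touch_at (l x) (center (X v)) (center (X w))"
    if x: "x \<in> vertices_Gstar S" and sq: "square_at S v \<sigma> \<tau>" "x = hx v \<sigma>" "square_at S w \<sigma>' \<tau>'" "x = hx w \<sigma>'" for x v w \<sigma> \<tau> \<sigma>' \<tau>'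
  proof -
    obtain \<kappa> where "Im (cnj (hyp_dir (l x) (center (X v))) * hyp_dir (l x) (center (X w))) = \<kappa> * det3 (C v) (C w) (hpt (l x))"
      using ring_vec_angles[OF X(1)[OF square_at_vertices(1)[OF sq(1)]] X(1)[OF square_at_vertices(1)[OF sq(3)]] l(1)[OF x]] by blast
    moreover have "det3 (C v) (C w) (hpt (l x)) = 0"
      unfolding fr(3)[OF sq(1), folded sq(2)] fr(3)[OF sq(3), folded sq(4)] l(2)[OF x] pres[OF x] by (simp add: pos_h_def det3_def)
    ultimately show ?thesis by (simp add: touch_at_def)
  qed
  have touch_ext: "touch_externally_at (l x) (center (X v)) (center (X w))"
    if x: "x \<in> vertices_Gstar S" and ne: "v \<noteq> w" and sq: "square_at S v \<sigma> \<tau>" "x = vy v \<tau>" "square_at S w \<sigma>' \<tau>'" "x = vy w \<tau>'" for x v w \<sigma> \<tau> \<sigma>' \<tau>'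
  proof -
    obtain \<kappa> where \<kappa>: "\<kappa> > 0" "Re (cnj (hyp_dir (l x) (center (X v))) * hyp_dir (l x) (center (X w))) =
        \<kappa> * (mink (C v) (C w) + mink (C v) (hpt (l x)) * mink (C w) (hpt (l x)))"
      "Im (cnj (hyp_dir (l x) (center (X v))) * hyp_dir (l x) (center (X w))) = \<kappa> * det3 (C v) (C w) (hpt (l x))"
      using ring_vec_angles[OF X(1)[OF square_at_vertices(1)[OF sq(1)]] X(1)[OF square_at_vertices(1)[OF sq(3)]] l(1)[OF x]] by blast
    have t: "\<tau>' = - \<tau>"
      using ne sq(2,4) square_at_signs(2)[OF sq(1)] square_at_signs(2)[OF sq(3)] by (auto simp: vy_def prod_eq_iff)
    have tt: "real_of_int \<tau> * real_of_int \<tau> = 1" using square_at_signs[OF sq(1)] by auto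
    have "det3 (C v) (C w) (hpt (l x)) = 0"
      unfolding fr(4)[OF sq(1), folded sq(2)] fr(4)[OF sq(3), folded sq(4)] l(2)[OF x] pres[OF x] by (simp add: pos_v_def det3_def)
    moreover have "mink (C v) (C w) = - (jacobi_dn q (\<gamma> v) * jacobi_dn q (\<gamma> w)) - 1"
      unfolding fr(4)[OF sq(1), folded sq(2)] fr(4)[OF sq(3), folded sq(4)] pres[OF x] t using tt
      by (simp add: pos_v_def mink_def mult_ac)
    moreover have "mink (C v) (hpt (l x)) = - 1" "mink (C w) (hpt (l x)) = - 1" using Cl(2)[OF sq(1)] Cl(2)[OF sq(3)] sq by auto
    ultimately show ?thesis
      unfolding touch_externally_at_def touch_at_def \<kappa>(2,3) using \<kappa>(1) d_pos[of "\<gamma> v"] d_pos[of "\<gamma> w"]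
      by (simp add: mult_less_0_iff)
  qed
  have orient: "(rad (X v) > 0 \<longrightarrow> ccw_from (center (X v)) (l (fst p)) (l (snd p))) \<and>
      (rad (X v) < 0 \<longrightarrow> ccw_from (center (X v)) (l (snd p)) (l (fst p)))"
    if v: "v \<in> vertices_G S" and p: "p \<in> consecutive S v" for v p
  proof -
    obtain \<sigma> \<tau> where sq: "square_at S v \<sigma> \<tau>" and p: "p = (if \<sigma> * \<tau> = 1 then (hx v \<sigma>, vy v \<tau>) else (vy v \<tau>, hx v \<sigma>))"
      using p consecutive_iff[OF v] by blast
    let ?w = "opp v \<sigma> \<tau>"
    note V = square_at_vertices[OF sq] and signs = square_at_squares[OF sq]
    have hy: "hpt (l (vy v \<tau>)) = F (hx v \<sigma>) *v step_point q \<sigma> \<tau> (\<gamma> v) (\<gamma> ?w)"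
      unfolding l(2)[OF V(4)] fr(2)[OF sq] by (simp add: transition_def frame_columns flip: matrix_vector_mul_assoc)
    define k where "k = jacobi_dn q (\<gamma> v) * weight q (\<gamma> v) (\<gamma> ?w) / add_denom q (\<gamma> v) (\<gamma> ?w)"
    have k: "k > 0" using d_pos weight_pos[OF q0 q(2)] add_denom_pos[OF q0 q(2)] by (simp add: k_def)
    have st: "\<sigma> * \<tau> = 1 \<or> \<sigma> * \<tau> = - 1" using square_at_signs[OF sq] by auto
    have "det3 (C v) (hpt (l (hx v \<sigma>))) (hpt (l (vy v \<tau>))) = of_int (\<sigma> * \<tau>) * (jacobi_cn q (\<gamma> v) * k)"
      unfolding fr(3)[OF sq] hy l(2)[OF V(3)] pres[OF V(3)] using q
      by (simp add: pos_h_def step_point_def det3_def k_def)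
    then have det: "det3 (C v) (hpt (l (fst p))) (hpt (l (snd p))) = jacobi_cn q (\<gamma> v) * k"
      using st det3_swap[of "C v" "hpt (l (vy v \<tau>))" "hpt (l (hx v \<sigma>))"] unfolding p
      by (elim disjE) (simp_all del: of_int_mult)
    have "fst p \<in> vertices_Gstar S" "snd p \<in> vertices_Gstar S" using V by (auto simp: p)
    then have "ccw_from (center (X v)) (l (fst p)) (l (snd p)) \<longleftrightarrow> jacobi_cn q (\<gamma> v) * k > 0"
      "ccw_from (center (X v)) (l (snd p)) (l (fst p)) \<longleftrightarrow> - (jacobi_cn q (\<gamma> v) * k) > 0"
      using det3_swap[of "C v" "hpt (l (snd p))" "hpt (l (fst p))"] by (simp_all add: ccw_from_ring_vec[OF X(1)[OF V(1)]] l(1) det)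
    then have "(jacobi_cn q (\<gamma> v) > 0 \<longrightarrow> ccw_from (center (X v)) (l (fst p)) (l (snd p))) \<and>
      (jacobi_cn q (\<gamma> v) < 0 \<longrightarrow> ccw_from (center (X v)) (l (snd p)) (l (fst p)))"
      using k by (simp add: mult_less_0_iff)
    then show ?thesis using uniformizes_signs[OF q X(3)[OF v]] by simp
  qed
  have "ring_pattern S q X l"
    unfolding ring_pattern_def
  proof (intro conjI ballI allI impI)
    fix v assume v: "v \<in> vertices_G S"
    show "hyperbolic_ring q (X v)" by (rule X(2)[OF v])
    show "orthogonal_rings (X v) (X w)" if "w \<in> neighbours S v" for w by (rule orth_rings[OF v that])
    show "case p of (x, y) \<Rightarrow> (0 < rad (X v) \<longrightarrow> ccw_from (center (X v)) (l x) (l y)) \<and>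
        (rad (X v) < 0 \<longrightarrow> ccw_from (center (X v)) (l y) (l x))" if "p \<in> consecutive S v" for p
      using orient[OF v that] by (simp add: case_prod_beta)
  next
    fix x assume x: "x \<in> vertices_Gstar S"
    then have odd: "odd (fst x + snd x)" by (simp add: vertices_Gstar_iff)
    show "l x \<in> hyp_plane" by (rule l(1)[OF x])
    show "l x \<in> inner (X v)" if "hor_edge S x v" for v
      using that inn unfolding hor_edge_iff[OF odd] by blast
    show "l x \<in> outer (X v)" if "ver_edge S x v" for v
      using that out unfolding ver_edge_iff[OF odd] by blast
    show "touch_at (l x) (center (X v)) (center (X w))" if "hor_edge S x v \<and> hor_edge S x w \<and> v \<noteq> w" for v w
      using that touch[OF x] unfolding hor_edge_iff[OF odd] by blast
    show "touch_externally_at (l x) (center (X v)) (center (X w))" if "ver_edge S x v \<and> ver_edge S x w \<and> v \<noteq> w" for v w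
      using that touch_ext[OF x] unfolding ver_edge_iff[OF odd] by blast
  qed
  then have "pattern_with S q \<gamma> X l" unfolding pattern_with_def using X(3) by blast
  then show thesis by (rule that)
qed

section \<open>The characterization\<close>

theorem theorem3p4:
  fixes S :: "(int \<times> int) set" and q :: real and \<gamma> :: "int \<times> int \<Rightarrow> real"
  assumes "simply_connected (cells S)" and "0 < q" and "q \<le> 1"
  shows "(determines_pattern S q \<gamma> \<longleftrightarrow>
            (\<forall>v \<in> vertices_G S. \<gamma> v \<in> uniformizing_interval q) \<and>
            (\<forall>v. internal_vertex S v \<longrightarrow>
               (\<Sum>w \<in> neighbours S v. ring_g q (\<gamma> v + \<gamma> w) + ring_g q (\<gamma> v - \<gamma> w)) = 2 * pi)) \<and>
         (\<forall>X l v. pattern_with S q \<gamma> X l \<and> boundary_vertex S v \<longrightarrow>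
            (rad (X v) > 0 \<longrightarrow>
               (\<Sum>w \<in> neighbours S v. ring_g q (\<gamma> v - \<gamma> w) + ring_g q (\<gamma> v + \<gamma> w)) = cone_angle S X v) \<and>
            (rad (X v) < 0 \<longrightarrow>
               (\<Sum>w \<in> neighbours S v. ring_g q (\<gamma> v - \<gamma> w) + ring_g q (\<gamma> v + \<gamma> w)) =
               cone_angle S X v + pi * real (card (neighbours S v))))"
proof -
  note q = assms(2,3)
  have g: "ring_g q (a + b) + ring_g q (a - b) = theta q a b" "ring_g q (a - b) + ring_g q (a + b) = theta q a b" for a b
    by (simp_all add: theta_def ring_g_explicit[OF q])
  have forward: "(\<forall>v\<in>vertices_G S. \<gamma> v \<in> uniformizing_interval q) \<and>
      (\<forall>v. internal_vertex S v \<longrightarrow> (\<Sum>w\<in>neighbours S v. theta q (\<gamma> v) (\<gamma> w)) = 2 * pi)"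
    if pat: "pattern_with S q \<gamma> X l" for X l
  proof (intro conjI ballI allI impI)
    show a: "\<gamma> v \<in> uniformizing_interval q" if "v \<in> vertices_G S" for v
      using pat that by (auto simp: pattern_with_def uniformizes_def)
    fix v assume v: "internal_vertex S v"
    obtain C where C: "vec_pattern S q \<gamma> C (\<lambda>x. hpt (l x))" using pattern_vectors[OF q pat] by blast
    obtain F where F: "framed S q \<gamma> F C" using vec_pattern_framed[OF q C] by blast
    show "(\<Sum>w\<in>neighbours S v. theta q (\<gamma> v) (\<gamma> w)) = 2 * pi"
      using internal_vertex_angle_sum[OF q F v a internal_ring_finite[OF q C v]] v by (simp add: internal_vertex_def)
  qed
  have backward: "determines_pattern S q \<gamma>"
    if a: "\<forall>v\<in>vertices_G S. \<gamma> v \<in> uniformizing_interval q"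
      and sum: "\<forall>v. internal_vertex S v \<longrightarrow> (\<Sum>w\<in>neighbours S v. theta q (\<gamma> v) (\<gamma> w)) = 2 * pi"
  proof -
    obtain F C where F: "framed S q \<gamma> F C" using frames_exist[OF q assms(1)] a sum by blast
    obtain X l where "pattern_with S q \<gamma> X l" using pattern_from_frames[OF q F] a by blast
    then show ?thesis unfolding determines_pattern_def using patterns_congruent[OF q] by blast
  qed
  have "determines_pattern S q \<gamma> \<longleftrightarrow> (\<forall>v\<in>vertices_G S. \<gamma> v \<in> uniformizing_interval q) \<and>
      (\<forall>v. internal_vertex S v \<longrightarrow> (\<Sum>w\<in>neighbours S v. theta q (\<gamma> v) (\<gamma> w)) = 2 * pi)"
    using forward backward unfolding determines_pattern_def by blast
  moreover have "(rad (X v) > 0 \<longrightarrow> (\<Sum>w\<in>neighbours S v. theta q (\<gamma> v) (\<gamma> w)) = cone_angle S X v) \<and>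
      (rad (X v) < 0 \<longrightarrow> (\<Sum>w\<in>neighbours S v. theta q (\<gamma> v) (\<gamma> w)) = cone_angle S X v + pi * real (card (neighbours S v)))"
    if "pattern_with S q \<gamma> X l" "boundary_vertex S v" for X l v
    using theta_sum_cone_angle[OF q, of S \<gamma> X v] that by (auto simp: pattern_with_def boundary_vertex_def)
  ultimately show ?thesis unfolding g by blast
qed

end
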